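(* Let $\mathcal F$ be a non-empty family of graphs. If $\mathcal F$ does not contain an anti-clique, then $$\lim_{p\to 0^+}\frac{1}{p}\,\mathrm{ed}_{\mathrm{Forb}(\mathcal F)}(p)=\frac{1}{\chi(\mathcal F)-1}.$$ Similarly, if $\mathcal F$ does not contain a clique, then $$\lim_{p\to 1^-}\frac{1}{1-p}\,\mathrm{ed}_{\mathrm{Forb}(\mathcal F)}(p)=\frac{1}{\overline{\chi}(\mathcal F)-1}.$$
   Context: All graphs are finite and simple. A clique is a complete graph and an anti-clique is a graph with no edges (the one-vertex graph is both). For a family $\mathcal F$ of graphs, $\mathrm{Forb}(\mathcal F)$ is the family of all graphs containing no member of $\mathcal F$ as an induced subgraph. Set $\chi(\mathcal F)=\min\{\chi(F):F\in\mathcal F\}$, where $\chi$ is the chromatic number, and $\overline\chi(\mathcal F)=\min\{\overline\chi(F):F\in\mathcal F\}$, where $\overline\chi(F)$ is the clique-cover number of $F$ (the least number of cliques needed to partition $V(F)$, i.e. the chromatic number of the complement of $F$). For two graphs $G,H$ on the same vertex set $V$, $\mathrm{dist}(G,H)=|E(G)\triangle E(H)|/\binom{|V|}{2}$. A hereditary property $\mathcal H$ is a family of graphs closed under isomorphism and vertex-deletion; it is non-trivial if it contains graphs of unbounded order (and then it contains graphs of every order). For a non-trivial hereditary property $\mathcal H$, $\mathrm{dist}(G,\mathcal H)=\min\{\mathrm{dist}(G,H):H\in\mathcal H,\ V(H)=V(G)\}$, and the edit distance function is $$\mathrm{ed}_{\mathcal H}(p)=\limsup_{n\to\infty}\max\Bigl\{\mathrm{dist}(G,\mathcal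 H):|V(G)|=n,\ |E(G)|=\Bigl\lfloor p\tbinom n2\Bigr\rfloor\Bigr\},\qquad p\in[0,1].$$ *)

theory Defs
  imports Complex_Main "HOL-Library.Disjoint_Sets" "HOL-Library.Extended_Real"
    "HOL-Library.Liminf_Limsup"
begin

datatype 'a graph = Graph (verts: "'a set") (edges: "'a set set")

definition all_pairs :: "'a set \<Rightarrow> 'a set set" where
  "all_pairs V = {e. e \<subseteq> V \<and> card e = 2}"

definition simple_graph :: "'a graph \<Rightarrow> bool" where
  "simple_graph G \<longleftrightarrow> finite (verts G) \<and> edges G \<subseteq> all_pairs (verts G)"

definition is_clique :: "'a graph \<Rightarrow> bool" where
  "is_clique G \<longleftrightarrow> edges G = all_pairs (verts G)"

definition is_anticlique :: "'a graph \<Rightarrow> bool" where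
  "is_anticlique G \<longleftrightarrow> edges G = {}"

definition induced_subgraph :: "'a graph \<Rightarrow> 'a set \<Rightarrow> 'a graph" where
  "induced_subgraph G U = Graph U {e \<in> edges G. e \<subseteq> U}"

definition isomorphic :: "'a graph \<Rightarrow> 'b graph \<Rightarrow> bool" where
  "isomorphic G H \<longleftrightarrow>
     (\<exists>f. bij_betw f (verts G) (verts H) \<and>
          (\<forall>u\<in>verts G. \<forall>v\<in>verts G. {u, v} \<in> edges G \<longleftrightarrow> {f u, f v} \<in> edges H))"

text \<open>The members of the family and the graphs of \<open>Forb\<close> may live on different vertex types.\<close>

definition Forb :: "'a graph set \<Rightarrow> 'b graph set" where
  "Forb \<F> = {G. simple_graph G \<and>
     \<not> (\<exists>F\<in>\<F>. \<exists>U\<subseteq>verts G. isomorphic F (induced_subgraph G U))}"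

definition proper_colouring :: "'a graph \<Rightarrow> nat \<Rightarrow> ('a \<Rightarrow> nat) \<Rightarrow> bool" where
  "proper_colouring G k c \<longleftrightarrow> c ` verts G \<subseteq> {..<k} \<and>
     (\<forall>u\<in>verts G. \<forall>v\<in>verts G. {u, v} \<in> edges G \<longrightarrow> c u \<noteq> c v)"

definition chromatic_number :: "'a graph \<Rightarrow> nat" where
  "chromatic_number G = (LEAST k. \<exists>c. proper_colouring G k c)"

definition clique_cover_number :: "'a graph \<Rightarrow> nat" where
  "clique_cover_number G =
     (LEAST k. \<exists>P. partition_on (verts G) P \<and> card P = k \<and>
                   (\<forall>C\<in>P. is_clique (induced_subgraph G C)))"

text \<open>On \<open>nat\<close>, the infimum of a non-empty set is its minimum.\<close>

definition family_chromatic_number :: "'a graph set \<Rightarrow> nat" where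
  "family_chromatic_number \<F> = (INF F\<in>\<F>. chromatic_number F)"

definition family_clique_cover_number :: "'a graph set \<Rightarrow> nat" where
  "family_clique_cover_number \<F> = (INF F\<in>\<F>. clique_cover_number F)"

definition graph_dist :: "'a graph \<Rightarrow> 'a graph \<Rightarrow> real" where
  "graph_dist G H = real (card (sym_diff (edges G) (edges H))) / real (card (verts G) choose 2)"

definition dist_to_property :: "'a graph \<Rightarrow> 'a graph set \<Rightarrow> real" where
  "dist_to_property G \<H> = Min {graph_dist G H | H. H \<in> \<H> \<and> verts H = verts G}"

text \<open>Hereditary properties are closed under isomorphism, so it is enough to consider graphs
  whose vertices are natural numbers. For a non-trivial hereditary property and
  \<open>0 \<le> p \<le> 1\<close>, the sets under \<open>Min\<close> and \<open>Max\<close> are finite and non-empty, since each distance is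
  \<open>k / (n choose 2)\<close> for some \<open>k \<le> n choose 2\<close>. Hence the limit superior lies in \<open>[0, 1]\<close>
  and the conversion from \<open>ereal\<close> loses nothing.\<close>

definition edit_distance_function :: "nat graph set \<Rightarrow> real \<Rightarrow> real" where
  "edit_distance_function \<H> p = real_of_ereal (limsup (\<lambda>n. ereal (Max
     {dist_to_property G \<H> | G. simple_graph G \<and> card (verts G) = n \<and>
        int (card (edges G)) = \<lfloor>p * real (n choose 2)\<rfloor>})))"

end

theory Submission
  imports Defs "HOL-Analysis.Analysis" "HOL-Computational_Algebra.Primes"
begin

text \<open>
  Write \<open>r\<close> for the chromatic number of the family minus one. The second limit follows from the first by
  taking complements, so only small \<open>p\<close> matter. The claim is that a graph of density \<open>p\<close> can always be
  moved into \<open>Forb \<F>\<close> at cost \<open>p / r\<close>, and that for some graphs this cannot be improved by a constant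
  factor once \<open>p\<close> is small.

  \<^emph>\<open>Upper bound.\<close> A uniformly random colouring of the vertices with \<open>r\<close> colours makes each edge
  monochromatic with probability \<open>1 / r\<close>. Deleting the monochromatic edges of a colouring that is no
  worse than average leaves an \<open>r\<close>-colourable graph, and no induced subgraph of it can be a member of
  \<open>\<F>\<close> (\<open>close_member_of_Forb\<close>).

  \<^emph>\<open>Lower bound.\<close> Let \<open>F0\<close> be a member of \<open>\<F>\<close> with chromatic number \<open>r + 1\<close>, and let \<open>G\<close> be a
  quasirandom graph of density \<open>p\<close>. Suppose that \<open>H\<close> differs from \<open>G\<close> in at most a proportion
  \<open>(1 - \<epsilon>) p / r\<close> of the pairs. The weak regularity lemma of Frieze and Kannan (\<open>weak_regularity\<close>)
  gives a partition of the vertices into a bounded number of cells such that the average \<open>g\<close> of \<open>H\<close>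
  over pairs of cells is close to \<open>H\<close> in the cut norm. Averaging does not increase distances, and the
  average of \<open>G\<close> is almost the constant \<open>p\<close>; so \<open>g\<close> is within about \<open>(1 - \<epsilon>) p / r\<close> of the constant
  \<open>p\<close>. Call a pair white, grey or black when \<open>g\<close> is almost \<open>0\<close>, intermediate, or almost \<open>1\<close> on it. A
  white pair costs almost \<open>p\<close> and a black pair costs almost \<open>1\<close>. Hence fewer than a proportion
  \<open>(1 - \<epsilon> / 2) / r\<close> of the pairs are white and at most \<open>2 p\<close> are black, so the grey pairs have density
  more than \<open>1 - 1 / r\<close>. By supersaturation (\<open>partite_supersaturation\<close>, a counting form of the
  theorem of Erdos and Stone) a proportion \<open>\<kappa>\<close> of all maps from the vertices of \<open>F0\<close> send any two
  vertices of different colours to a grey pair, where \<open>\<kappa>\<close> depends on \<open>\<epsilon>\<close> and \<open>F0\<close> but not on \<open>p\<close>. This is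
  where \<open>p \<rightarrow> 0\<close> enters: when \<open>p\<close> is small compared with \<open>\<kappa>\<close>, most of these maps avoid black pairs
  altogether. In such a map the edges of \<open>F0\<close> are at grey pairs and the non-edges are at grey or white
  pairs, so it contributes to the induced density of \<open>F0\<close> in \<open>g\<close> (\<open>pattern_sum_near_sparse\<close>).
  Closeness in the cut norm transfers this density from \<open>g\<close> to \<open>H\<close> (\<open>counting_lemma\<close>), so \<open>H\<close> contains
  an induced copy of \<open>F0\<close> and is not in \<open>Forb \<F>\<close>.

  The limit superior requires quasirandom graphs only for infinitely many orders. On \<open>q\<^sup>2\<close> vertices,
  with \<open>q\<close> prime, the relation \<open>a c + b + d mod q < s\<close> between \<open>(a, b)\<close> and \<open>(c, d)\<close> is quasirandom
  with density \<open>s / q\<close> (\<open>product_relation_discrepancy\<close>).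
\<close>

section \<open>Averages over the cells of a partition\<close>

text \<open>
  The conditional expectation of \<open>f\<close> given the label \<open>L\<close>, under the uniform distribution on \<open>Z\<close>.
\<close>

definition fibre_avg :: "'z set \<Rightarrow> ('z \<Rightarrow> 'l) \<Rightarrow> ('z \<Rightarrow> real) \<Rightarrow> 'z \<Rightarrow> real" where
  "fibre_avg Z L f z = (\<Sum>z'\<in>{z' \<in> Z. L z' = L z}. f z') / real (card {z' \<in> Z. L z' = L z})"

lemma fibre_avg_cong_label:
  "L z = L z' \<Longrightarrow> fibre_avg Z L f z = fibre_avg Z L f z'"
  by (simp add: fibre_avg_def)

text \<open>
  Averaging over fibres is the orthogonal projection onto the functions that are constant on
  fibres: it is invisible to inner products with such functions.
\<close>

lemma sum_fibre_avg_mult: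
  assumes "finite Z" and h: "\<And>z z'. z \<in> Z \<Longrightarrow> z' \<in> Z \<Longrightarrow> L z = L z' \<Longrightarrow> h z = h z'"
  shows "(\<Sum>z\<in>Z. fibre_avg Z L f z * h z) = (\<Sum>z\<in>Z. f z * h z)"
proof -
  have fib: "(\<Sum>z\<in>{z \<in> Z. L z = l}. fibre_avg Z L f z * h z) = (\<Sum>z\<in>{z \<in> Z. L z = l}. f z * h z)"
    if l: "l \<in> L ` Z" for l
  proof -
    obtain z0 where z0: "z0 \<in> Z" "L z0 = l" using l by auto
    let ?A = "{z \<in> Z. L z = l}"
    have c: "card ?A \<noteq> 0" using z0 assms(1) by auto
    have hz: "h z = h z0" if "z \<in> ?A" for z by (rule h) (use that z0 in auto)
    have "(\<Sum>z\<in>?A. fibre_avg Z L f z * h z) = (\<Sum>z\<in>?A. (sum f ?A / real (card ?A)) * h z0)"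
      using hz by (intro sum.cong) (simp_all add: fibre_avg_def)
    also have "\<dots> = sum f ?A * h z0" using c by simp
    also have "\<dots> = (\<Sum>z\<in>?A. f z * h z)"
      unfolding sum_distrib_right using hz by (intro sum.cong) simp_all
    finally show ?thesis .
  qed
  show ?thesis
    unfolding sum.image_gen[OF assms(1), where g = L] using fib by (rule sum.cong[OF refl])
qed

lemma sum_fibre_avg:
  assumes "finite Z"
  shows "(\<Sum>z\<in>Z. fibre_avg Z L f z) = (\<Sum>z\<in>Z. f z)"
  using sum_fibre_avg_mult[OF assms, of L "\<lambda>_. 1" f] by simp

lemma fibre_avg_mono:
  assumes "\<And>z. z \<in> Z \<Longrightarrow> f z \<le> f' z"
  shows "fibre_avg Z L f z \<le> fibre_avg Z L f' z"
  unfolding fibre_avg_def using assms by (intro divide_right_mono sum_mono) auto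

lemma fibre_avg_const:
  assumes "finite Z" "z \<in> Z"
  shows "fibre_avg Z L (\<lambda>_. c) z = c"
proof -
  have "card {z' \<in> Z. L z' = L z} \<noteq> 0" using assms by auto
  then show ?thesis by (simp add: fibre_avg_def)
qed

lemma fibre_avg_diff:
  "fibre_avg Z L (\<lambda>z. f z - f' z) z = fibre_avg Z L f z - fibre_avg Z L f' z"
  by (simp add: fibre_avg_def sum_subtractf diff_divide_distrib)

lemma fibre_avg_contraction:
  assumes "finite Z"
  shows "(\<Sum>z\<in>Z. \<bar>fibre_avg Z L f z\<bar>) \<le> (\<Sum>z\<in>Z. \<bar>f z\<bar>)"
proof -
  have "\<bar>fibre_avg Z L f z\<bar> \<le> fibre_avg Z L (\<lambda>z. \<bar>f z\<bar>) z" for z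
    by (simp add: fibre_avg_def abs_divide divide_right_mono sum_abs)
  then show ?thesis
    using sum_mono[of Z "\<lambda>z. \<bar>fibre_avg Z L f z\<bar>" "fibre_avg Z L (\<lambda>z. \<bar>f z\<bar>)"]
    by (simp add: sum_fibre_avg[OF assms])
qed

text \<open>
  A family \<open>\<S>\<close> of vertex sets stands for the partition of the vertices into the atoms that it
  generates. With the set of members containing a vertex as its label, refining a partition is
  enlarging \<open>\<S>\<close>, and the number of labels of pairs is at most \<open>4 ^ card \<S>\<close>.
\<close>

definition cell_label :: "'v set set \<Rightarrow> 'v \<times> 'v \<Rightarrow> 'v set set \<times> 'v set set" where
  "cell_label \<S> z = ({S \<in> \<S>. fst z \<in> S}, {S \<in> \<S>. snd z \<in> S})"

lemma cell_label_mono: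
  assumes "cell_label \<S>' z = cell_label \<S>' z'" "\<S> \<subseteq> \<S>'"
  shows "cell_label \<S> z = cell_label \<S> z'"
  using assms by (auto simp: cell_label_def)

text \<open>
  When \<open>L'\<close> refines \<open>L\<close>, the coarse average is the projection of the fine one, so their
  difference is orthogonal to the coarse average.
\<close>

lemma fibre_avg_pythagoras:
  assumes "finite Z" and ref: "\<And>z z'. z \<in> Z \<Longrightarrow> z' \<in> Z \<Longrightarrow> L' z = L' z' \<Longrightarrow> L z = L z'"
  shows "(\<Sum>z\<in>Z. (fibre_avg Z L' f z - fibre_avg Z L f z)\<^sup>2)
       = (\<Sum>z\<in>Z. (fibre_avg Z L' f z)\<^sup>2) - (\<Sum>z\<in>Z. (fibre_avg Z L f z)\<^sup>2)"
proof -
  let ?g = "fibre_avg Z L f" and ?g' = "fibre_avg Z L' f"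
  have "(\<Sum>z\<in>Z. ?g' z * ?g z) = (\<Sum>z\<in>Z. f z * ?g z)"
    by (rule sum_fibre_avg_mult[OF assms(1)]) (metis ref fibre_avg_cong_label)
  also have "\<dots> = (\<Sum>z\<in>Z. ?g z * ?g z)"
    by (rule sum_fibre_avg_mult[OF assms(1), symmetric]) (metis fibre_avg_cong_label)
  finally have e: "(\<Sum>z\<in>Z. ?g' z * ?g z) = (\<Sum>z\<in>Z. (?g z)\<^sup>2)" by (simp add: power2_eq_square card_cartesian_product)
  have "(\<Sum>z\<in>Z. (?g' z - ?g z)\<^sup>2) = (\<Sum>z\<in>Z. (?g' z)\<^sup>2) - 2 * (\<Sum>z\<in>Z. ?g' z * ?g z) + (\<Sum>z\<in>Z. (?g z)\<^sup>2)"
    by (simp add: power2_diff sum.distrib sum_subtractf sum_distrib_left mult.assoc)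
  then show ?thesis using e by simp
qed

section \<open>Weak regularity\<close>

text \<open>
  The regularity lemma of Frieze and Kannan, by energy increment. If sets \<open>A\<close> and \<open>B\<close> witness that
  the average over the present partition is far from \<open>f\<close> in the cut norm, then adding both of
  them to \<open>\<S>\<close> increases the squared norm of the average by more than \<open>\<eta>\<^sup>2\<close> per pair. The squared
  norm is at most \<open>1\<close> per pair, so this happens fewer than \<open>1 / \<eta>\<^sup>2\<close> times.
\<close>

lemma weak_regularity:
  fixes f :: "'v \<times> 'v \<Rightarrow> real"
  assumes V: "finite V" and f: "\<And>z. z \<in> V \<times> V \<Longrightarrow> 0 \<le> f z \<and> f z \<le> 1"
    and \<eta>: "\<eta> > 0" and N: "real N * \<eta>\<^sup>2 \<ge> 1"
  obtains \<S> where "finite \<S>" "card \<S> \<le> 2 * N"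
    "\<And>A B. A \<subseteq> V \<Longrightarrow> B \<subseteq> V \<Longrightarrow>
       \<bar>\<Sum>z\<in>A \<times> B. f z - fibre_avg (V \<times> V) (cell_label \<S>) f z\<bar> \<le> \<eta> * (real (card V))\<^sup>2"
proof -
  let ?n = "real (card V)"
  define g where "g = (\<lambda>\<S>. fibre_avg (V \<times> V) (cell_label \<S>) f)"
  define energy where "energy = (\<lambda>\<S>. \<Sum>z\<in>V \<times> V. (g \<S> z)\<^sup>2)"
  define good where "good = (\<lambda>\<S>. \<forall>A B. A \<subseteq> V \<longrightarrow> B \<subseteq> V \<longrightarrow> \<bar>\<Sum>z\<in>A \<times> B. f z - g \<S> z\<bar> \<le> \<eta> * ?n\<^sup>2)"
  have fin: "finite (V \<times> V)" using V by simp
  have cVV: "real (card (V \<times> V)) = ?n\<^sup>2" by (simp add: power2_eq_square card_cartesian_product)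
  have g01: "0 \<le> g \<S> z \<and> g \<S> z \<le> 1" if z: "z \<in> V \<times> V" for \<S> z
  proof
    have "fibre_avg (V \<times> V) (cell_label \<S>) (\<lambda>_. 0) z \<le> g \<S> z"
      unfolding g_def by (rule fibre_avg_mono) (use f in blast)
    then show "0 \<le> g \<S> z" by (simp add: fibre_avg_const[OF fin z])
    have "g \<S> z \<le> fibre_avg (V \<times> V) (cell_label \<S>) (\<lambda>_. 1) z"
      unfolding g_def by (rule fibre_avg_mono) (use f in blast)
    then show "g \<S> z \<le> 1" by (simp add: fibre_avg_const[OF fin z])
  qed
  have energy_le: "energy \<S> \<le> ?n\<^sup>2" for \<S>
  proof -
    have "energy \<S> \<le> (\<Sum>z\<in>V \<times> V. 1)"
      unfolding energy_def by (intro sum_mono) (use g01 in \<open>simp add: power_le_one\<close>)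
    then show ?thesis using cVV by simp
  qed
  have step: "energy (insert A (insert B \<S>)) > energy \<S> + \<eta>\<^sup>2 * ?n\<^sup>2"
    if AB: "A \<subseteq> V" "B \<subseteq> V" and bad: "\<bar>\<Sum>z\<in>A \<times> B. f z - g \<S> z\<bar> > \<eta> * ?n\<^sup>2" for A B \<S>
  proof -
    let ?T = "insert A (insert B \<S>)"
    have ABV: "A \<times> B \<subseteq> V \<times> V" using AB by auto
    define d where "d = (\<lambda>z. g ?T z - g \<S> z)"
    have npos: "?n > 0"
    proof (rule ccontr)
      assume "\<not> ?n > 0"
      then have "V = {}" using V by auto
      then show False using bad AB by simp
    qed
    have sub: "(\<Sum>z\<in>A \<times> B. u z) = (\<Sum>z\<in>V \<times> V. u z * indicator (A \<times> B) z)" for u :: "'v \<times> 'v \<Rightarrow> real"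
      by (rule sum.mono_neutral_cong_left[OF fin ABV]) auto
    \<comment> \<open>Both sets are generators of the new partition, so the rectangle is a union of its cells.\<close>
    have cell: "indicator (A \<times> B) z = (indicator (A \<times> B) z' :: real)" if "cell_label ?T z = cell_label ?T z'" for z z'
    proof -
      have "A \<in> fst (cell_label ?T z) \<longleftrightarrow> A \<in> fst (cell_label ?T z')"
        "B \<in> snd (cell_label ?T z) \<longleftrightarrow> B \<in> snd (cell_label ?T z')" using that by simp_all
      then show ?thesis by (simp add: cell_label_def mem_Times_iff indicator_def)
    qed
    have "(\<Sum>z\<in>A \<times> B. f z) = (\<Sum>z\<in>V \<times> V. f z * indicator (A \<times> B) z)" by (rule sub)
    also have "\<dots> = (\<Sum>z\<in>V \<times> V. g ?T z * indicator (A \<times> B) z)"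
      unfolding g_def
      by (rule sum_fibre_avg_mult[OF fin, symmetric]) (rule cell)
    also have "\<dots> = (\<Sum>z\<in>A \<times> B. g ?T z)" by (simp add: sub)
    finally have e: "(\<Sum>z\<in>A \<times> B. f z - g \<S> z) = (\<Sum>z\<in>A \<times> B. d z)"
      by (simp add: d_def sum_subtractf)
    have "(\<eta> * ?n\<^sup>2)\<^sup>2 < \<bar>\<Sum>z\<in>A \<times> B. d z\<bar>\<^sup>2"
      using bad e \<eta> by (intro power_strict_mono) auto
    also have "\<dots> = (\<Sum>z\<in>A \<times> B. d z)\<^sup>2" by simp
    also have "\<dots> \<le> (\<Sum>z\<in>A \<times> B. 1\<^sup>2) * (\<Sum>z\<in>A \<times> B. (d z)\<^sup>2)"
      using Cauchy_Schwarz_ineq_sum[of "\<lambda>_. 1" d "A \<times> B"] by simp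
    also have "\<dots> \<le> ?n\<^sup>2 * (\<Sum>z\<in>V \<times> V. (d z)\<^sup>2)"
    proof (intro mult_mono)
      have "real (card (A \<times> B)) \<le> real (card (V \<times> V))" using card_mono[OF fin ABV] by linarith
      then show "(\<Sum>z\<in>A \<times> B. 1\<^sup>2) \<le> ?n\<^sup>2" using cVV by simp
      show "(\<Sum>z\<in>A \<times> B. (d z)\<^sup>2) \<le> (\<Sum>z\<in>V \<times> V. (d z)\<^sup>2)" using fin ABV by (intro sum_mono2) auto
    qed (auto intro: sum_nonneg)
    also have "(\<Sum>z\<in>V \<times> V. (d z)\<^sup>2) = energy ?T - energy \<S>"
      unfolding d_def g_def energy_def
      by (rule fibre_avg_pythagoras[OF fin]) (metis cell_label_mono subset_insertI subset_trans)
    finally have "?n\<^sup>2 * (\<eta>\<^sup>2 * ?n\<^sup>2) < ?n\<^sup>2 * (energy ?T - energy \<S>)"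
      by (simp add: power2_eq_square algebra_simps)
    then have "\<eta>\<^sup>2 * ?n\<^sup>2 < energy ?T - energy \<S>" using npos by (simp add: mult_less_cancel_left_pos)
    then show ?thesis by simp
  qed
  have "\<exists>\<S>. finite \<S> \<and> card \<S> \<le> 2 * N \<and> good \<S>"
  proof (rule ccontr)
    assume none: "\<not> ?thesis"
    have "\<exists>\<S>. finite \<S> \<and> card \<S> \<le> 2 * k \<and> energy \<S> \<ge> real k * (\<eta>\<^sup>2 * ?n\<^sup>2) \<and> (k > 0 \<longrightarrow> energy \<S> > real k * (\<eta>\<^sup>2 * ?n\<^sup>2))" if "k \<le> Suc N" for k
      using that
    proof (induction k)
      case 0
      then show ?case by (intro exI[of _ "{}"]) (simp add: energy_def sum_nonneg)
    next
      case (Suc k)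
      then obtain \<S> where S: "finite \<S>" "card \<S> \<le> 2 * k" "energy \<S> \<ge> real k * (\<eta>\<^sup>2 * ?n\<^sup>2)" by auto
      then have "\<not> good \<S>" using none Suc.prems by auto
      then obtain A B where AB: "A \<subseteq> V" "B \<subseteq> V" "\<bar>\<Sum>z\<in>A \<times> B. f z - g \<S> z\<bar> > \<eta> * ?n\<^sup>2"
        unfolding good_def by (meson not_le)
      have "energy (insert A (insert B \<S>)) > real (Suc k) * (\<eta>\<^sup>2 * ?n\<^sup>2)"
        using step[OF AB] S(3) by (simp add: algebra_simps)
      moreover have "card (insert A (insert B \<S>)) \<le> 2 * Suc k"
        using S by (simp add: card_insert_if)
      ultimately show ?case using S(1) by (intro exI[of _ "insert A (insert B \<S>)"]) auto
    qed
    then obtain \<S> where "energy \<S> > real (Suc N) * (\<eta>\<^sup>2 * ?n\<^sup>2)" by blast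
    moreover have "?n\<^sup>2 \<le> (real N * \<eta>\<^sup>2) * ?n\<^sup>2" using N by (simp add: mult_le_cancel_right1)
    moreover have "\<dots> \<le> real (Suc N) * (\<eta>\<^sup>2 * ?n\<^sup>2)" by (simp add: algebra_simps)
    ultimately show False using energy_le[of \<S>] by linarith
  qed
  then show ?thesis using that unfolding good_def g_def by blast
qed

text \<open>
  The fibres are rectangles, and each of them contributes the absolute value of one rectangle sum.
\<close>

lemma fibre_avg_discrepancy:
  fixes f :: "'v \<times> 'v \<Rightarrow> real"
  assumes V: "finite V" and S: "finite \<S>"
    and D: "\<And>A B. A \<subseteq> V \<Longrightarrow> B \<subseteq> V \<Longrightarrow> \<bar>\<Sum>z\<in>A \<times> B. f z\<bar> \<le> D"
  shows "(\<Sum>z\<in>V \<times> V. \<bar>fibre_avg (V \<times> V) (cell_label \<S>) f z\<bar>) \<le> 4 ^ card \<S> * D"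
proof -
  let ?L = "cell_label \<S>" and ?Z = "V \<times> V"
  have fin: "finite ?Z" using V by simp
  have D0: "D \<ge> 0" using D[of "{}" "{}"] by simp
  have fib: "(\<Sum>z\<in>{z \<in> ?Z. ?L z = l}. \<bar>fibre_avg ?Z ?L f z\<bar>) \<le> D" for l
  proof -
    let ?A = "{z \<in> ?Z. ?L z = l}"
    let ?X = "{x \<in> V. {S \<in> \<S>. x \<in> S} = fst l}" and ?Y = "{y \<in> V. {S \<in> \<S>. y \<in> S} = snd l}"
    have rect: "?A = ?X \<times> ?Y" by (auto simp: cell_label_def)
    have "(\<Sum>z\<in>?A. \<bar>fibre_avg ?Z ?L f z\<bar>) = (\<Sum>z\<in>?A. \<bar>sum f ?A\<bar> / real (card ?A))"
      by (intro sum.cong) (auto simp: fibre_avg_def)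
    also have "\<dots> \<le> \<bar>sum f ?A\<bar>" by (cases "card ?A = 0") auto
    also have "\<dots> \<le> D" unfolding rect by (rule D) auto
    finally show ?thesis .
  qed
  have "?L ` ?Z \<subseteq> Pow \<S> \<times> Pow \<S>" by (auto simp: cell_label_def)
  moreover have "finite (Pow \<S> \<times> Pow \<S>)" using S by simp
  moreover have "card (Pow \<S> \<times> Pow \<S>) = 4 ^ card \<S>"
    using S by (simp add: card_Pow card_cartesian_product flip: power_mult_distrib)
  ultimately have c: "card (?L ` ?Z) \<le> 4 ^ card \<S>" by (metis card_mono)
  have "(\<Sum>z\<in>?Z. \<bar>fibre_avg ?Z ?L f z\<bar>) = (\<Sum>l\<in>?L ` ?Z. \<Sum>z\<in>{z \<in> ?Z. ?L z = l}. \<bar>fibre_avg ?Z ?L f z\<bar>)"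
    by (rule sum.image_gen[OF fin])
  also have "\<dots> \<le> (\<Sum>l\<in>?L ` ?Z. D)" by (intro sum_mono fib)
  also have "\<dots> = real (card (?L ` ?Z)) * D" by simp
  also have "\<dots> \<le> real (4 ^ card \<S>) * D" using c D0 by (intro mult_right_mono) (auto simp del: of_nat_power)
  finally show ?thesis by simp
qed

section \<open>Counting copies of a pattern\<close>

text \<open>
  Overwriting one value of a uniformly random map by a fresh random vertex gives a uniformly random
  map again: exchanging the new value with the old one is an involution of the pairs (map, vertex).
\<close>

lemma sum_resample_one:
  fixes X :: "('i \<Rightarrow> 'v) \<Rightarrow> real"
  assumes "u \<in> I"
  shows "(\<Sum>\<phi>\<in>I \<rightarrow>\<^sub>E V. \<Sum>x\<in>V. X (\<phi>(u := x))) = real (card V) * (\<Sum>\<phi>\<in>I \<rightarrow>\<^sub>E V. X \<phi>)"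
proof -
  have "(\<Sum>\<phi>\<in>I \<rightarrow>\<^sub>E V. \<Sum>x\<in>V. X (\<phi>(u := x))) = (\<Sum>(\<phi>, x)\<in>(I \<rightarrow>\<^sub>E V) \<times> V. X (\<phi>(u := x)))"
    by (simp add: sum.cartesian_product)
  also have "\<dots> = (\<Sum>(\<phi>, x)\<in>(I \<rightarrow>\<^sub>E V) \<times> V. X \<phi>)"
    by (rule sum.reindex_bij_witness[where i = "\<lambda>(\<phi>, x). (\<phi>(u := x), \<phi> u)"
          and j = "\<lambda>(\<phi>, x). (\<phi>(u := x), \<phi> u)"])
       (use assms in \<open>auto simp: PiE_iff extensional_def\<close>)
  also have "\<dots> = real (card V) * (\<Sum>\<phi>\<in>I \<rightarrow>\<^sub>E V. X \<phi>)"
    by (simp add: sum.cartesian_product[symmetric] sum_distrib_left)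
  finally show ?thesis .
qed

lemma sum_resample_two:
  fixes X :: "('i \<Rightarrow> 'v) \<Rightarrow> real"
  assumes "u \<in> I" "v \<in> I"
  shows "(\<Sum>\<phi>\<in>I \<rightarrow>\<^sub>E V. \<Sum>(x, y)\<in>V \<times> V. X (\<phi>(u := x, v := y)))
    = (real (card V))\<^sup>2 * (\<Sum>\<phi>\<in>I \<rightarrow>\<^sub>E V. X \<phi>)"
proof -
  have "(\<Sum>\<phi>\<in>I \<rightarrow>\<^sub>E V. \<Sum>(x, y)\<in>V \<times> V. X (\<phi>(u := x, v := y)))
    = (\<Sum>\<phi>\<in>I \<rightarrow>\<^sub>E V. \<Sum>x\<in>V. (\<lambda>\<psi>. \<Sum>y\<in>V. X (\<psi>(v := y))) (\<phi>(u := x)))"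
    by (simp add: sum.cartesian_product)
  also have "\<dots> = (real (card V))\<^sup>2 * (\<Sum>\<phi>\<in>I \<rightarrow>\<^sub>E V. X \<phi>)"
    by (subst sum_resample_one[OF assms(1), where X = "\<lambda>\<psi>. \<Sum>y\<in>V. X (\<psi>(v := y))"])
       (subst sum_resample_one[OF assms(2), where X = X], simp add: power2_eq_square)
  finally show ?thesis .
qed

lemma sum_maps_pair:
  fixes F :: "'v \<times> 'v \<Rightarrow> real"
  assumes "finite I" "u \<in> I" "v \<in> I" "u \<noteq> v"
  shows "(real (card V))\<^sup>2 * (\<Sum>\<phi>\<in>I \<rightarrow>\<^sub>E V. F (\<phi> u, \<phi> v)) = real (card V) ^ card I * (\<Sum>z\<in>V \<times> V. F z)"
proof -
  have "(real (card V))\<^sup>2 * (\<Sum>\<phi>\<in>I \<rightarrow>\<^sub>E V. F (\<phi> u, \<phi> v))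
    = (\<Sum>\<phi>\<in>I \<rightarrow>\<^sub>E V. \<Sum>(x, y)\<in>V \<times> V. F (x, y))"
    using sum_resample_two[OF assms(2,3), where V = V and X = "\<lambda>\<phi>. F (\<phi> u, \<phi> v)"] assms(4) by simp
  also have "\<dots> = real (card V) ^ card I * (\<Sum>z\<in>V \<times> V. F z)"
    using assms(1) by (simp add: card_PiE)
  finally show ?thesis .
qed

text \<open>
  A bilinear form in weights from \<open>[0, 1]\<close> is largest at an extreme point, that is, for the
  indicators of two sets: first replace \<open>a\<close> by the indicator of the positive coefficients, then \<open>b\<close>.
\<close>

lemma cut_bound_upper:
  fixes F :: "'v \<times> 'v \<Rightarrow> real"
  assumes V: "finite V"
    and D: "\<And>A B. A \<subseteq> V \<Longrightarrow> B \<subseteq> V \<Longrightarrow> (\<Sum>z\<in>A \<times> B. F z) \<le> D"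
    and a: "\<And>x. x \<in> V \<Longrightarrow> 0 \<le> a x \<and> a x \<le> 1" and b: "\<And>x. x \<in> V \<Longrightarrow> 0 \<le> b x \<and> b x \<le> 1"
  shows "(\<Sum>(x, y)\<in>V \<times> V. F (x, y) * (a x * b y)) \<le> D"
proof -
  have ext: "(\<Sum>x\<in>V. c x * w x) \<le> (\<Sum>x\<in>{x \<in> V. c x > 0}. c x)"
    if w: "\<And>x. x \<in> V \<Longrightarrow> 0 \<le> w x \<and> w x \<le> 1" for c w :: "'v \<Rightarrow> real"
  proof -
    have "(\<Sum>x\<in>V. c x * w x) \<le> (\<Sum>x\<in>V. if c x > 0 then c x else 0)"
    proof (rule sum_mono)
      fix x assume "x \<in> V"
      then show "c x * w x \<le> (if c x > 0 then c x else 0)"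
        using w[of x] by (auto simp: mult_left_le mult_nonpos_nonneg not_less)
    qed
    also have "\<dots> = (\<Sum>x\<in>{x \<in> V. c x > 0}. c x)" using V by (simp add: sum.inter_filter)
    finally show ?thesis .
  qed
  define c where "c x = (\<Sum>y\<in>V. F (x, y) * b y)" for x
  define A where "A = {x \<in> V. c x > 0}"
  define c' where "c' y = (\<Sum>x\<in>A. F (x, y))" for y
  define B where "B = {y \<in> V. c' y > 0}"
  have "(\<Sum>(x, y)\<in>V \<times> V. F (x, y) * (a x * b y)) = (\<Sum>x\<in>V. c x * a x)"
    by (simp add: sum.cartesian_product[symmetric] c_def sum_distrib_right sum_distrib_left algebra_simps)
  also have "\<dots> \<le> (\<Sum>x\<in>A. c x)" unfolding A_def by (rule ext[OF a])
  also have "\<dots> = (\<Sum>y\<in>V. c' y * b y)"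
    unfolding c_def c'_def sum_distrib_right by (rule sum.swap)
  also have "\<dots> \<le> (\<Sum>y\<in>B. c' y)" unfolding B_def by (rule ext[OF b])
  also have "\<dots> = (\<Sum>x\<in>A. \<Sum>y\<in>B. F (x, y))" unfolding c'_def by (rule sum.swap)
  also have "\<dots> = (\<Sum>z\<in>A \<times> B. F z)" by (simp add: sum.cartesian_product)
  also have "\<dots> \<le> D" by (rule D) (auto simp: A_def B_def)
  finally show ?thesis .
qed

lemma cut_bound_weighted:
  fixes F :: "'v \<times> 'v \<Rightarrow> real"
  assumes V: "finite V"
    and D: "\<And>A B. A \<subseteq> V \<Longrightarrow> B \<subseteq> V \<Longrightarrow> \<bar>\<Sum>z\<in>A \<times> B. F z\<bar> \<le> D"
    and a: "\<And>x. x \<in> V \<Longrightarrow> 0 \<le> a x \<and> a x \<le> 1" and b: "\<And>x. x \<in> V \<Longrightarrow> 0 \<le> b x \<and> b x \<le> 1"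
  shows "\<bar>\<Sum>(x, y)\<in>V \<times> V. F (x, y) * (a x * b y)\<bar> \<le> D"
proof -
  have "(\<Sum>(x, y)\<in>V \<times> V. F (x, y) * (a x * b y)) \<le> D"
    by (rule cut_bound_upper[OF V order_trans[OF abs_ge_self D] a b])
  moreover have "(\<Sum>(x, y)\<in>V \<times> V. (\<lambda>z. - F z) (x, y) * (a x * b y)) \<le> D"
    by (rule cut_bound_upper[OF V _ a b]) (use order_trans[OF abs_ge_minus_self D] in \<open>simp add: sum_negf\<close>)
  then have "- (\<Sum>(x, y)\<in>V \<times> V. F (x, y) * (a x * b y)) \<le> D"
    by (simp add: sum_negf case_prod_unfold)
  ultimately show ?thesis by linarith
qed

text \<open>
  The number of maps \<open>I \<rightarrow> V\<close>, weighted by a product over the pairs of the pattern. A weight of its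
  own for each pair makes it possible to exchange the weights one pair at a time, and to use \<open>g\<close> at
  edges and \<open>1 - g\<close> at non-edges of the pattern.
\<close>

definition pattern_sum ::
  "'i set \<Rightarrow> ('i \<times> 'i) set \<Rightarrow> 'v set \<Rightarrow> ('i \<times> 'i \<Rightarrow> 'v \<times> 'v \<Rightarrow> real) \<Rightarrow> real" where
  "pattern_sum I P V w = (\<Sum>\<phi>\<in>I \<rightarrow>\<^sub>E V. \<Prod>e\<in>P. w e (\<phi> (fst e), \<phi> (snd e)))"

text \<open>
  Fix all values of the map but those at \<open>u\<close> and \<open>v\<close>. Apart from \<open>(u, v)\<close> itself no pair of \<open>P\<close>
  meets both \<open>u\<close> and \<open>v\<close>, so the remaining product splits into a function of the value at \<open>u\<close> times
  a function of the value at \<open>v\<close>, and the cut norm of \<open>F\<close> bounds the sum over these two values.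
\<close>

lemma pattern_sum_replace_one:
  fixes w :: "'i \<times> 'i \<Rightarrow> 'v \<times> 'v \<Rightarrow> real"
  assumes V: "finite V" and I: "finite I" and P: "P \<subseteq> I \<times> I"
    and asym: "\<And>i j. (i, j) \<in> P \<Longrightarrow> (j, i) \<notin> P"
    and e: "(u, v) \<in> P"
    and w: "\<And>e z. e \<in> P \<Longrightarrow> z \<in> V \<times> V \<Longrightarrow> 0 \<le> w e z \<and> w e z \<le> 1"
    and D: "\<And>A B. A \<subseteq> V \<Longrightarrow> B \<subseteq> V \<Longrightarrow> \<bar>\<Sum>z\<in>A \<times> B. F z\<bar> \<le> D"
  shows "(real (card V))\<^sup>2 * \<bar>\<Sum>\<phi>\<in>I \<rightarrow>\<^sub>E V. F (\<phi> u, \<phi> v) * (\<Prod>e\<in>P - {(u, v)}. w e (\<phi> (fst e), \<phi> (snd e)))\<bar>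
    \<le> real (card V) ^ card I * D"
proof -
  let ?n = "real (card V)"
  have uv: "u \<in> I" "v \<in> I" using e P by auto
  have ne: "u \<noteq> v" using asym e by blast
  have finP: "finite P" by (rule finite_subset[OF P]) (use I in simp)
  define rest where "rest = (\<lambda>\<phi>. \<Prod>e\<in>P - {(u, v)}. w e (\<phi> (fst e), \<phi> (snd e)))"
  define Pu where "Pu = {e \<in> P - {(u, v)}. fst e = u \<or> snd e = u}"
  define Pr where "Pr = P - {(u, v)} - Pu"
  have split: "P - {(u, v)} = Pu \<union> Pr" "Pu \<inter> Pr = {}" "finite Pu" "finite Pr"
    using finP by (auto simp: Pu_def Pr_def)
  have inner: "\<bar>\<Sum>(x, y)\<in>V \<times> V. F (x, y) * rest (\<phi>(u := x, v := y))\<bar> \<le> D"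
    if phi: "\<phi> \<in> I \<rightarrow>\<^sub>E V" for \<phi>
  proof -
    define a where "a x = (\<Prod>e\<in>Pu. w e ((\<phi>(u := x)) (fst e), (\<phi>(u := x)) (snd e)))" for x
    define b where "b y = (\<Prod>e\<in>Pr. w e ((\<phi>(v := y)) (fst e), (\<phi>(v := y)) (snd e)))" for y
    have ab: "rest (\<phi>(u := x, v := y)) = a x * b y" for x y
    proof -
      have "rest (\<phi>(u := x, v := y))
        = (\<Prod>e\<in>Pu. w e ((\<phi>(u := x, v := y)) (fst e), (\<phi>(u := x, v := y)) (snd e)))
        * (\<Prod>e\<in>Pr. w e ((\<phi>(u := x, v := y)) (fst e), (\<phi>(u := x, v := y)) (snd e)))"
        unfolding rest_def split(1) by (rule prod.union_disjoint[OF split(3,4,2)])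
      moreover have "fst e \<noteq> v \<and> snd e \<noteq> v" if "e \<in> Pu" for e
      proof -
        obtain i j where ij: "e = (i, j)" by (cases e)
        have "e \<in> P" "e \<noteq> (u, v)" "i = u \<or> j = u" using that by (auto simp: Pu_def ij)
        then show ?thesis using asym[of u v] asym[of i j] e ne ij by auto
      qed
      then have "(\<Prod>e\<in>Pu. w e ((\<phi>(u := x, v := y)) (fst e), (\<phi>(u := x, v := y)) (snd e))) = a x"
        unfolding a_def by (intro prod.cong) auto
      moreover have "fst e \<noteq> u \<and> snd e \<noteq> u" if "e \<in> Pr" for e
        using that by (auto simp: Pr_def Pu_def)
      then have "(\<Prod>e\<in>Pr. w e ((\<phi>(u := x, v := y)) (fst e), (\<phi>(u := x, v := y)) (snd e))) = b y"
        unfolding b_def by (intro prod.cong) auto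
      ultimately show ?thesis by simp
    qed
    have val: "\<psi> (fst e) \<in> V \<and> \<psi> (snd e) \<in> V" if "e \<in> P" "\<psi> \<in> I \<rightarrow>\<^sub>E V" for e \<psi>
      using that P by (cases e) (auto simp: PiE_iff)
    have a01: "0 \<le> a x \<and> a x \<le> 1" if "x \<in> V" for x
    proof -
      have "\<phi>(u := x) \<in> I \<rightarrow>\<^sub>E V" using phi that uv by (auto simp: PiE_iff extensional_def)
      then have "0 \<le> w e ((\<phi>(u := x)) (fst e), (\<phi>(u := x)) (snd e)) \<and>
          w e ((\<phi>(u := x)) (fst e), (\<phi>(u := x)) (snd e)) \<le> 1" if "e \<in> Pu" for e
        using that val[of e "\<phi>(u := x)"] by (intro w) (auto simp: Pu_def)
      then show ?thesis unfolding a_def by (auto intro!: prod_nonneg prod_le_1)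
    qed
    have b01: "0 \<le> b x \<and> b x \<le> 1" if "x \<in> V" for x
    proof -
      have "\<phi>(v := x) \<in> I \<rightarrow>\<^sub>E V" using phi that uv by (auto simp: PiE_iff extensional_def)
      then have "0 \<le> w e ((\<phi>(v := x)) (fst e), (\<phi>(v := x)) (snd e)) \<and>
          w e ((\<phi>(v := x)) (fst e), (\<phi>(v := x)) (snd e)) \<le> 1" if "e \<in> Pr" for e
        using that val[of e "\<phi>(v := x)"] by (intro w) (auto simp: Pr_def)
      then show ?thesis unfolding b_def by (auto intro!: prod_nonneg prod_le_1)
    qed
    show ?thesis unfolding ab by (rule cut_bound_weighted[OF V D a01 b01])
  qed
  have "?n\<^sup>2 * \<bar>\<Sum>\<phi>\<in>I \<rightarrow>\<^sub>E V. F (\<phi> u, \<phi> v) * rest \<phi>\<bar>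
    = \<bar>?n\<^sup>2 * (\<Sum>\<phi>\<in>I \<rightarrow>\<^sub>E V. F (\<phi> u, \<phi> v) * rest \<phi>)\<bar>"
    by (simp add: abs_mult)
  also have "\<dots> = \<bar>\<Sum>\<phi>\<in>I \<rightarrow>\<^sub>E V. \<Sum>(x, y)\<in>V \<times> V. F (x, y) * rest (\<phi>(u := x, v := y))\<bar>"
    using sum_resample_two[OF uv, where V = V and X = "\<lambda>\<phi>. F (\<phi> u, \<phi> v) * rest \<phi>"] ne by simp
  also have "\<dots> \<le> (\<Sum>\<phi>\<in>I \<rightarrow>\<^sub>E V. \<bar>\<Sum>(x, y)\<in>V \<times> V. F (x, y) * rest (\<phi>(u := x, v := y))\<bar>)"
    by (rule sum_abs)
  also have "\<dots> \<le> (\<Sum>\<phi>\<in>I \<rightarrow>\<^sub>E V. D)" by (intro sum_mono inner)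
  also have "\<dots> = ?n ^ card I * D" using I by (simp add: card_PiE)
  finally show ?thesis unfolding rest_def .
qed

text \<open>
  Replacing the weights one pair at a time costs at most the cut norm of the difference at each step.
\<close>

lemma counting_lemma:
  fixes w w' :: "'i \<times> 'i \<Rightarrow> 'v \<times> 'v \<Rightarrow> real"
  assumes V: "finite V" and I: "finite I" and P: "P \<subseteq> I \<times> I"
    and asym: "\<And>i j. (i, j) \<in> P \<Longrightarrow> (j, i) \<notin> P"
    and w: "\<And>e z. e \<in> P \<Longrightarrow> z \<in> V \<times> V \<Longrightarrow> 0 \<le> w e z \<and> w e z \<le> 1"
    and w': "\<And>e z. e \<in> P \<Longrightarrow> z \<in> V \<times> V \<Longrightarrow> 0 \<le> w' e z \<and> w' e z \<le> 1"
    and D: "\<And>e A B. e \<in> P \<Longrightarrow> A \<subseteq> V \<Longrightarrow> B \<subseteq> V \<Longrightarrow> \<bar>\<Sum>z\<in>A \<times> B. w e z - w' e z\<bar> \<le> D"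
  shows "(real (card V))\<^sup>2 * \<bar>pattern_sum I P V w - pattern_sum I P V w'\<bar>
    \<le> real (card P) * (real (card V) ^ card I * D)"
proof -
  let ?n = "real (card V)"
  have finP: "finite P" by (rule finite_subset[OF P]) (use I in simp)
  define mix where "mix S = (\<lambda>e. if e \<in> S then w e else w' e)" for S
  have "?n\<^sup>2 * \<bar>pattern_sum I P V (mix S) - pattern_sum I P V w'\<bar> \<le> real (card S) * (?n ^ card I * D)"
    if "finite S" "S \<subseteq> P" for S
    using that
  proof (induction S)
    case empty
    then show ?case by (simp add: mix_def)
  next
    case (insert e S)
    then have e: "e \<in> P" "e \<notin> S" by auto
    obtain u v where uv: "e = (u, v)" by (cases e)
    define F where "F = (\<lambda>z. w e z - w' e z)"
    have fac: "(\<Prod>e\<in>P. mix T e (\<phi> (fst e), \<phi> (snd e)))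
      = mix T e (\<phi> u, \<phi> v) * (\<Prod>e\<in>P - {(u, v)}. mix T e (\<phi> (fst e), \<phi> (snd e)))" for T \<phi>
      using prod.remove[OF finP e(1), of "\<lambda>e. mix T e (\<phi> (fst e), \<phi> (snd e))"] by (simp add: uv)
    have same': "(\<Prod>e'\<in>P - {(u, v)}. mix (insert e S) e' (\<phi> (fst e'), \<phi> (snd e')))
      = (\<Prod>e'\<in>P - {(u, v)}. mix S e' (\<phi> (fst e'), \<phi> (snd e')))" for \<phi>
      by (intro prod.cong) (auto simp: mix_def uv)
    have "pattern_sum I P V (mix (insert e S)) - pattern_sum I P V (mix S)
      = (\<Sum>\<phi>\<in>I \<rightarrow>\<^sub>E V. F (\<phi> u, \<phi> v) * (\<Prod>e\<in>P - {(u, v)}. mix S e (\<phi> (fst e), \<phi> (snd e))))"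
      unfolding pattern_sum_def sum_subtractf[symmetric] fac same'
      by (intro sum.cong refl) (use e in \<open>simp add: mix_def F_def algebra_simps\<close>)
    moreover have "?n\<^sup>2 * \<bar>\<Sum>\<phi>\<in>I \<rightarrow>\<^sub>E V. F (\<phi> u, \<phi> v) * (\<Prod>e\<in>P - {(u, v)}. mix S e (\<phi> (fst e), \<phi> (snd e)))\<bar>
      \<le> ?n ^ card I * D"
    proof (rule pattern_sum_replace_one[OF V I P asym])
      show "(u, v) \<in> P" using e uv by simp
      show "0 \<le> mix S e z \<and> mix S e z \<le> 1" if "e \<in> P" "z \<in> V \<times> V" for e z
        using w[OF that] w'[OF that] by (simp add: mix_def)
      show "\<bar>\<Sum>z\<in>A \<times> B. F z\<bar> \<le> D" if "A \<subseteq> V" "B \<subseteq> V" for A B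
        using D[OF e(1) that] by (simp add: F_def)
    qed auto
    ultimately have "?n\<^sup>2 * \<bar>pattern_sum I P V (mix (insert e S)) - pattern_sum I P V (mix S)\<bar> \<le> ?n ^ card I * D"
      by simp
    moreover have "?n\<^sup>2 * \<bar>pattern_sum I P V (mix S) - pattern_sum I P V w'\<bar> \<le> real (card S) * (?n ^ card I * D)"
      using insert by auto
    moreover have "?n\<^sup>2 * \<bar>pattern_sum I P V (mix (insert e S)) - pattern_sum I P V w'\<bar>
      \<le> ?n\<^sup>2 * (\<bar>pattern_sum I P V (mix (insert e S)) - pattern_sum I P V (mix S)\<bar>
          + \<bar>pattern_sum I P V (mix S) - pattern_sum I P V w'\<bar>)"
      by (intro mult_left_mono) auto
    ultimately show ?case using insert.hyps by (simp add: distrib_left algebra_simps)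
  qed
  from this[OF finP] show ?thesis by (simp add: pattern_sum_def mix_def)
qed

section \<open>Supersaturation for complete multipartite graphs\<close>

text \<open>
  The homomorphisms into \<open>W\<close> from the complete multipartite graph on \<open>I\<close> whose classes are the
  colour classes of \<open>c\<close>; vertices of the same colour are unrestricted.
\<close>

definition coloured_maps ::
  "'i set \<Rightarrow> ('i \<Rightarrow> nat) \<Rightarrow> 'v set \<Rightarrow> ('v \<Rightarrow> 'v \<Rightarrow> bool) \<Rightarrow> ('i \<Rightarrow> 'v) set" where
  "coloured_maps I c V W = {\<phi> \<in> I \<rightarrow>\<^sub>E V. \<forall>i\<in>I. \<forall>j\<in>I. c i \<noteq> c j \<longrightarrow> W (\<phi> i) (\<phi> j)}"

lemma finite_coloured_maps: "finite I \<Longrightarrow> finite V \<Longrightarrow> finite (coloured_maps I c V W)"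
  unfolding coloured_maps_def by (simp add: finite_PiE)

lemma card_coloured_maps_le:
  assumes "finite I" "finite V"
  shows "card (coloured_maps I c V W) \<le> card V ^ card I"
proof -
  have "card (coloured_maps I c V W) \<le> card (I \<rightarrow>\<^sub>E V)"
    using assms by (intro card_mono) (auto simp: coloured_maps_def finite_PiE)
  then show ?thesis using assms by (simp add: card_PiE)
qed

text \<open>
  The vertices of one colour class \<open>J\<close> can be placed independently of each other, anywhere in the
  common neighbourhood of the images of the other classes.
\<close>

lemma card_coloured_maps_split:
  assumes fin: "finite V" "finite I" "finite J" and disj: "I \<inter> J = {}"
    and cJ: "\<And>j. j \<in> J \<Longrightarrow> c j = k" and cI: "\<And>i. i \<in> I \<Longrightarrow> c i \<noteq> k"
    and sym: "\<And>x y. W x y \<Longrightarrow> W y x"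
  shows "card (coloured_maps (I \<union> J) c V W)
    = (\<Sum>\<psi>\<in>coloured_maps I c V W. card {x \<in> V. \<forall>i\<in>I. W (\<psi> i) x} ^ card J)"
proof -
  define N where "N \<psi> = {x \<in> V. \<forall>i\<in>I. W (\<psi> i) x}" for \<psi>
  let ?S = "Sigma (coloured_maps I c V W) (\<lambda>\<psi>. J \<rightarrow>\<^sub>E N \<psi>)"
  let ?g = "\<lambda>(\<psi>, \<theta>). \<lambda>x. if x \<in> I then \<psi> x else \<theta> x"
  have "bij_betw (\<lambda>\<phi>. (restrict \<phi> I, restrict \<phi> J)) (coloured_maps (I \<union> J) c V W) ?S"
  proof (rule bij_betw_byWitness[where f' = ?g])
    show "\<forall>\<phi>\<in>coloured_maps (I \<union> J) c V W. ?g (restrict \<phi> I, restrict \<phi> J) = \<phi>"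
      by (auto simp: coloured_maps_def PiE_iff extensional_def fun_eq_iff)
    show "\<forall>p\<in>?S. (restrict (?g p) I, restrict (?g p) J) = p"
      using disj by (auto simp: coloured_maps_def PiE_iff extensional_def fun_eq_iff)
    show "(\<lambda>\<phi>. (restrict \<phi> I, restrict \<phi> J)) ` coloured_maps (I \<union> J) c V W \<subseteq> ?S"
    proof (clarify, intro conjI)
      fix \<phi> assume phi: "\<phi> \<in> coloured_maps (I \<union> J) c V W"
      show "restrict \<phi> I \<in> coloured_maps I c V W" using phi by (auto simp: coloured_maps_def)
      have "W (\<phi> i) (\<phi> j)" if "i \<in> I" "j \<in> J" for i j
      proof -
        have "c i \<noteq> c j" using cI[OF that(1)] cJ[OF that(2)] by simp
        then show ?thesis using phi that by (simp add: coloured_maps_def)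
      qed
      moreover have "\<phi> j \<in> V" if "j \<in> J" for j
        using phi that by (auto simp: coloured_maps_def PiE_iff)
      ultimately show "restrict \<phi> J \<in> J \<rightarrow>\<^sub>E N (restrict \<phi> I)" by (auto simp: N_def)
    qed
    show "?g ` ?S \<subseteq> coloured_maps (I \<union> J) c V W"
    proof (clarify)
      fix \<psi> \<theta> assume psi: "\<psi> \<in> coloured_maps I c V W" and th: "\<theta> \<in> J \<rightarrow>\<^sub>E N \<psi>"
      let ?\<phi> = "\<lambda>x. if x \<in> I then \<psi> x else \<theta> x"
      have cross: "W (\<psi> i) (\<theta> j)" if "i \<in> I" "j \<in> J" for i j
        using th that by (auto simp: N_def PiE_iff)
      have mem: "?\<phi> \<in> I \<union> J \<rightarrow>\<^sub>E V"
        using psi th by (auto simp: coloured_maps_def PiE_iff N_def extensional_def)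
      have "W (?\<phi> i) (?\<phi> j)" if ij: "i \<in> I \<union> J" "j \<in> I \<union> J" "c i \<noteq> c j" for i j
      proof -
        have "\<not> (i \<in> J \<and> j \<in> J)" using cJ[of i] cJ[of j] ij(3) by auto
        moreover have "W (\<psi> i) (\<psi> j)" if "i \<in> I" "j \<in> I"
          using psi that ij(3) by (simp add: coloured_maps_def)
        moreover have "\<not> (i \<in> I \<and> i \<in> J)" "\<not> (j \<in> I \<and> j \<in> J)" using disj by auto
        ultimately show ?thesis using ij(1,2) cross[of i j] sym[OF cross[of j i]] by auto
      qed
      then show "?\<phi> \<in> coloured_maps (I \<union> J) c V W" using mem by (simp add: coloured_maps_def)
    qed
  qed
  then have "card (coloured_maps (I \<union> J) c V W) = card ?S" by (rule bij_betw_same_card)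
  also have "\<dots> = (\<Sum>\<psi>\<in>coloured_maps I c V W. card (J \<rightarrow>\<^sub>E N \<psi>))"
    using fin by (intro card_SigmaI) (auto simp: finite_coloured_maps N_def intro!: finite_PiE)
  also have "\<dots> = (\<Sum>\<psi>\<in>coloured_maps I c V W. card (N \<psi>) ^ card J)"
    using fin by (simp add: card_PiE)
  finally show ?thesis by (simp add: N_def)
qed

text \<open>
  Choose \<open>Y\<close> so as to maximise \<open>e(Y) - \<alpha> |Y|\<^sup>2\<close>, where \<open>e\<close> counts ordered pairs. Removing a vertex
  must not increase this value, which bounds its degree below; the value for \<open>V\<close> itself is
  at least \<open>\<beta> |V|\<^sup>2\<close>, which bounds \<open>|Y|\<close> below. The error \<open>1 / 2\<close> comes from
  \<open>|Y|\<^sup>2 - (|Y| - 1)\<^sup>2 = 2 |Y| - 1\<close>.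
\<close>

lemma dense_subset_with_min_degree:
  fixes V :: "'v set" and \<alpha> \<beta> :: real
  assumes V: "finite V" and sym: "\<And>x y. W x y \<Longrightarrow> W y x" and \<alpha>: "\<alpha> \<ge> 0" and \<beta>: "\<beta> \<ge> 0" "\<beta> \<le> 1"
    and dens: "(\<Sum>x\<in>V. \<Sum>y\<in>V. of_bool (W x y)) \<ge> (\<alpha> + \<beta>) * (real (card V))\<^sup>2"
  obtains Y where "Y \<subseteq> V" "real (card Y) \<ge> \<beta> * real (card V)"
    "\<And>x. x \<in> Y \<Longrightarrow> real (card {y \<in> Y. W x y}) \<ge> \<alpha> * real (card Y) - 1 / 2"
proof -
  define e where "e Y = (\<Sum>x\<in>Y. \<Sum>y\<in>Y. of_bool (W x y) :: real)" for Y
  define \<Phi> where "\<Phi> Y = e Y - \<alpha> * (real (card Y))\<^sup>2" for Y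
  have fin: "finite (\<Phi> ` Pow V)" "\<Phi> ` Pow V \<noteq> {}" using V by auto
  obtain Y where Y: "Y \<subseteq> V" "\<Phi> Y = Max (\<Phi> ` Pow V)" using Max_in[OF fin] by auto
  have max: "\<Phi> Z \<le> \<Phi> Y" if "Z \<subseteq> V" for Z using Y(2) fin that by auto
  have finY: "finite Y" by (rule finite_subset[OF Y(1) V])
  show ?thesis
  proof (rule that[OF Y(1)])
    have "\<beta>\<^sup>2 \<le> \<beta>" using \<beta> by (simp add: power2_eq_square mult_left_le)
    then have "(\<beta> * real (card V))\<^sup>2 \<le> \<beta> * (real (card V))\<^sup>2"
      unfolding power_mult_distrib by (intro mult_right_mono) auto
    also have "\<dots> \<le> \<Phi> V" using dens by (simp add: \<Phi>_def e_def algebra_simps)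
    also have "\<dots> \<le> \<Phi> Y" by (rule max) simp
    also have "\<dots> \<le> e Y" using \<alpha> by (simp add: \<Phi>_def)
    also have "\<dots> \<le> (\<Sum>x\<in>Y. \<Sum>y\<in>Y. 1)" unfolding e_def by (intro sum_mono) simp
    also have "\<dots> = (real (card Y))\<^sup>2" by (simp add: power2_eq_square)
    finally show "real (card Y) \<ge> \<beta> * real (card V)" by (rule power2_le_imp_le) simp
  next
    fix x assume x: "x \<in> Y"
    define Z where "Z = Y - {x}"
    have Z: "Y = insert x Z" "x \<notin> Z" "finite Z" using x finY by (auto simp: Z_def)
    define d where "d = (\<Sum>y\<in>Z. of_bool (W x y) :: real)"
    have swap: "(\<Sum>y\<in>Z. of_bool (W y x)) = d"
      unfolding d_def using sym by (intro sum.cong refl arg_cong[where f = of_bool]) blast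
    have eY: "e Y = e Z + 2 * d + of_bool (W x x)"
      unfolding e_def Z(1) using Z(2,3) by (simp add: sum.distrib swap del: sum_of_bool_eq flip: d_def)
    have degY: "real (card {y \<in> Y. W x y}) = d + of_bool (W x x)"
    proof -
      have "real (card {y \<in> Y. W x y}) = (\<Sum>y\<in>Y. of_bool (W x y))"
        using finY by (simp add: of_bool_def sum.If_cases Int_def)
      then show ?thesis unfolding Z(1) d_def using Z(2,3) by simp
    qed
    have cY: "real (card Y) = real (card Z) + 1" unfolding Z(1) using Z(2,3) by simp
    have "\<Phi> Z \<le> \<Phi> Y" by (rule max) (use Y(1) in \<open>auto simp: Z_def\<close>)
    then have "2 * d + of_bool (W x x) \<ge> \<alpha> * (2 * real (card Y) - 1)"
      unfolding \<Phi>_def eY cY by (simp add: power2_eq_square algebra_simps)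
    moreover have "e Y \<le> (real (card Y))\<^sup>2"
    proof -
      have "e Y \<le> (\<Sum>x\<in>Y. \<Sum>y\<in>Y. 1)" unfolding e_def by (intro sum_mono) simp
      then show ?thesis by (simp add: power2_eq_square)
    qed
    moreover have "\<alpha> \<le> 1"
    proof (rule ccontr)
      assume "\<not> \<alpha> \<le> 1"
      then have "1 * (real (card Y))\<^sup>2 < \<alpha> * (real (card Y))\<^sup>2"
        using x finY by (intro mult_strict_right_mono) (auto simp: card_gt_0_iff)
      then have "\<Phi> Y < 0" using calculation(2) by (simp add: \<Phi>_def)
      moreover have "\<Phi> {} = 0" by (simp add: \<Phi>_def e_def)
      ultimately show False using max[of "{}"] by simp
    qed
    ultimately show "real (card {y \<in> Y. W x y}) \<ge> \<alpha> * real (card Y) - 1 / 2"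
      unfolding degY by (cases "W x x") (simp_all add: algebra_simps)
  qed
qed

text \<open>
  In a subset with all relative degrees above \<open>1 - 1 / r + \<epsilon> / 4\<close>, any \<open>r\<close> vertices have at least a
  proportion \<open>\<epsilon> / 4\<close> of common neighbours, so cliques with up to \<open>r + 1\<close> vertices can be counted
  greedily. Colours that are all different make every pair of the index set an edge.
\<close>

lemma clique_supersaturation:
  fixes V :: "'v set" and \<epsilon> :: real and c :: "'i \<Rightarrow> nat"
  assumes V: "finite V" and sym: "\<And>x y. W x y \<Longrightarrow> W y x" and r: "r \<ge> 1"
    and \<epsilon>: "0 < \<epsilon>" "\<epsilon> \<le> 1" and n: "real (card V) * \<epsilon>\<^sup>2 \<ge> 4"
    and dens: "(\<Sum>x\<in>V. \<Sum>y\<in>V. of_bool (W x y)) \<ge> (1 - 1 / real r + \<epsilon>) * (real (card V))\<^sup>2"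
    and I: "finite I" "card I \<le> r + 1" "inj_on c I"
  shows "real (card (coloured_maps I c V W)) \<ge> (\<epsilon>\<^sup>2 / 8 * real (card V)) ^ card I"
proof -
  have r1: "1 / real r \<le> 1" using r by simp
  have d2: "(\<Sum>x\<in>V. \<Sum>y\<in>V. of_bool (W x y)) \<ge> ((1 - 1 / real r + \<epsilon> / 2) + \<epsilon> / 2) * (real (card V))\<^sup>2"
    using dens by (simp add: add.assoc)
  obtain Y where Y: "Y \<subseteq> V" "real (card Y) \<ge> \<epsilon> / 2 * real (card V)"
    "\<And>x. x \<in> Y \<Longrightarrow> real (card {y \<in> Y. W x y}) \<ge> (1 - 1 / real r + \<epsilon> / 2) * real (card Y) - 1 / 2"
    by (rule dense_subset_with_min_degree[OF V sym _ _ _ d2]) (use r1 \<epsilon> in simp_all)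
  have finY: "finite Y" by (rule finite_subset[OF Y(1) V])
  let ?y = "real (card Y)"
  have half: "1 / 2 \<le> \<epsilon> / 4 * ?y"
  proof -
    have "1 / 2 \<le> \<epsilon> / 4 * (\<epsilon> / 2 * real (card V))" using n by (simp add: power2_eq_square algebra_simps)
    also have "\<dots> \<le> \<epsilon> / 4 * ?y" using Y(2) \<epsilon> by (intro mult_left_mono) auto
    finally show ?thesis .
  qed
  have non: "real (card {y \<in> Y. \<not> W x y}) \<le> (1 / real r - \<epsilon> / 4) * ?y" if "x \<in> Y" for x
  proof -
    have "card Y = card {y \<in> Y. W x y} + card {y \<in> Y. \<not> W x y}"
      using finY by (subst card_Un_disjoint[symmetric]) (auto intro: arg_cong[where f = card])
    then show ?thesis using Y(3)[OF that] half by (simp add: algebra_simps)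
  qed
  have common: "real (card {x \<in> Y. \<forall>i\<in>I. W (\<psi> i) x}) \<ge> \<epsilon> / 4 * ?y"
    if I: "finite I" "card I \<le> r" and psi: "\<psi> \<in> coloured_maps I c Y W" for I and \<psi> :: "'i \<Rightarrow> 'v"
  proof -
    let ?N = "{x \<in> Y. \<forall>i\<in>I. W (\<psi> i) x}"
    have "Y \<subseteq> ?N \<union> (\<Union>i\<in>I. {x \<in> Y. \<not> W (\<psi> i) x})" by auto
    then have "card Y \<le> card (?N \<union> (\<Union>i\<in>I. {x \<in> Y. \<not> W (\<psi> i) x}))"
      using finY I by (intro card_mono) auto
    also have "\<dots> \<le> card ?N + (\<Sum>i\<in>I. card {x \<in> Y. \<not> W (\<psi> i) x})"
      by (rule order_trans[OF card_Un_le add_left_mono[OF card_UN_le[OF I(1)]]])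
    finally have "?y \<le> real (card ?N) + (\<Sum>i\<in>I. real (card {x \<in> Y. \<not> W (\<psi> i) x}))"
      by (simp flip: of_nat_sum of_nat_add)
    also have "(\<Sum>i\<in>I. real (card {x \<in> Y. \<not> W (\<psi> i) x})) \<le> (\<Sum>i\<in>I. (1 / real r - \<epsilon> / 4) * ?y)"
      using psi by (intro sum_mono non) (auto simp: coloured_maps_def PiE_iff)
    finally have 1: "?y \<le> real (card ?N) + real (card I) * ((1 / real r - \<epsilon> / 4) * ?y)" by simp
    show ?thesis
    proof (cases "card I = 0")
      case True
      have "\<epsilon> / 4 * ?y \<le> 1 * ?y" using \<epsilon> by (intro mult_right_mono) auto
      then show ?thesis using 1 True by simp
    next
      case False
      have "real (card I) * (1 / real r) \<le> 1" using I(2) r by (simp add: field_simps)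
      then have "real (card I) * (1 / real r) * ?y \<le> 1 * ?y" by (intro mult_right_mono) auto
      moreover have "1 * (\<epsilon> / 4 * ?y) \<le> real (card I) * (\<epsilon> / 4 * ?y)"
        using False \<epsilon> by (intro mult_right_mono) auto
      ultimately show ?thesis using 1 by (simp add: algebra_simps)
    qed
  qed
  have "real (card (coloured_maps I c Y W)) \<ge> (\<epsilon> / 4 * ?y) ^ card I"
    using I
  proof (induction I)
    case empty
    then show ?case by (simp add: coloured_maps_def)
  next
    case (insert t I)
    have ct: "c i \<noteq> c t" if "i \<in> I" for i using insert.prems(2) insert.hyps(2) that by (auto simp: inj_on_def)
    have IH: "real (card (coloured_maps I c Y W)) \<ge> (\<epsilon> / 4 * ?y) ^ card I"
      using insert by (auto simp: inj_on_def)
    have "card (coloured_maps (I \<union> {t}) c Y W)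
      = (\<Sum>\<psi>\<in>coloured_maps I c Y W. card {x \<in> Y. \<forall>i\<in>I. W (\<psi> i) x} ^ card {t})"
      by (rule card_coloured_maps_split[OF finY insert.hyps(1), where k = "c t"])
         (use insert.hyps ct sym in auto)
    then have "real (card (coloured_maps (insert t I) c Y W))
      = (\<Sum>\<psi>\<in>coloured_maps I c Y W. real (card {x \<in> Y. \<forall>i\<in>I. W (\<psi> i) x}))" by simp
    also have "\<dots> \<ge> (\<Sum>\<psi>\<in>coloured_maps I c Y W. \<epsilon> / 4 * ?y)"
      using insert by (intro sum_mono common) auto
    finally have "real (card (coloured_maps (insert t I) c Y W))
      \<ge> real (card (coloured_maps I c Y W)) * (\<epsilon> / 4 * ?y)" by simp
    moreover have "real (card (coloured_maps I c Y W)) * (\<epsilon> / 4 * ?y) \<ge> (\<epsilon> / 4 * ?y) ^ card I * (\<epsilon> / 4 * ?y)"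
      using IH \<epsilon> by (intro mult_right_mono) auto
    ultimately show ?case using insert.hyps by (simp add: mult.commute)
  qed
  moreover have "(\<epsilon>\<^sup>2 / 8 * real (card V)) ^ card I \<le> (\<epsilon> / 4 * ?y) ^ card I"
  proof (rule power_mono)
    have "\<epsilon>\<^sup>2 / 8 * real (card V) = \<epsilon> / 4 * (\<epsilon> / 2 * real (card V))" by (simp add: power2_eq_square)
    also have "\<dots> \<le> \<epsilon> / 4 * ?y" using Y(2) \<epsilon> by (intro mult_left_mono) auto
    finally show "\<epsilon>\<^sup>2 / 8 * real (card V) \<le> \<epsilon> / 4 * ?y" .
  qed (use \<epsilon> in auto)
  moreover have "card (coloured_maps I c Y W) \<le> card (coloured_maps I c V W)"
    using Y(1) I V by (intro card_mono finite_coloured_maps) (auto simp: coloured_maps_def PiE_iff)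
  ultimately show ?thesis by linarith
qed

text \<open>
  The convex function \<open>x ^ (m + 1)\<close> lies above its tangent at \<open>a\<close>.
\<close>

lemma power_tangent_line:
  fixes x a :: real
  assumes "x \<ge> 0" "a \<ge> 0"
  shows "x ^ Suc m \<ge> real (Suc m) * a ^ m * x - real m * a ^ Suc m"
proof (induction m)
  case 0
  then show ?case by simp
next
  case (Suc m)
  have "0 \<le> real (Suc m) * a ^ m * (x - a)\<^sup>2" using assms by simp
  also have "\<dots> = (real (Suc m) * a ^ m * x - real m * a ^ Suc m) * x
      - (real (Suc (Suc m)) * a ^ Suc m * x - real (Suc m) * a ^ Suc (Suc m))"
    by (simp add: power2_eq_square algebra_simps)
  also have "(real (Suc m) * a ^ m * x - real m * a ^ Suc m) * x \<le> x ^ Suc m * x"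
    using Suc assms by (intro mult_right_mono)
  finally show ?case by (simp add: mult.commute)
qed

text \<open>
  Replacing a single vertex \<open>t\<close> by a class \<open>J\<close> of copies raises the number of its possible
  placements to the power \<open>card J\<close>, for each placement of the rest. By convexity, applied as the tangent
  inequality at the average \<open>\<kappa> n\<close>, the density \<open>\<kappa>\<close> becomes at least \<open>\<kappa> ^ card J\<close>. The exponent
  \<open>Suc (card J)\<close> also covers an empty class, where \<open>\<kappa> ^ 0\<close> would be too much.
\<close>

lemma coloured_maps_blow_up:
  fixes V :: "'v set" and c :: "'i \<Rightarrow> nat"
  assumes fin: "finite V" "finite R" "finite J" and disj: "R \<inter> J = {}"
    and cJ: "\<And>j. j \<in> J \<Longrightarrow> c j = c t" and cR: "\<And>i. i \<in> R \<Longrightarrow> c i \<noteq> c t"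
    and sym: "\<And>x y. W x y \<Longrightarrow> W y x" and V: "V \<noteq> {}" and \<kappa>: "0 \<le> \<kappa>" "\<kappa> \<le> 1"
    and single: "real (card (coloured_maps (insert t R) c V W)) \<ge> \<kappa> * real (card V) ^ card (insert t R)"
  shows "real (card (coloured_maps (R \<union> J) c V W)) \<ge> \<kappa> ^ Suc (card J) * real (card V) ^ card (R \<union> J)"
proof -
  let ?n = "real (card V)" and ?H = "coloured_maps R c V W"
  define d where "d \<psi> = real (card {x \<in> V. \<forall>i\<in>R. W (\<psi> i) x})" for \<psi> :: "'i \<Rightarrow> 'v"
  have tR: "t \<notin> R" using cR by blast
  have n: "?n > 0" using V fin by (simp add: card_gt_0_iff)
  have "card (coloured_maps (R \<union> {t}) c V W) = (\<Sum>\<psi>\<in>?H. card {x \<in> V. \<forall>i\<in>R. W (\<psi> i) x} ^ card {t})"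
    by (rule card_coloured_maps_split[OF fin(1,2), where k = "c t"]) (use tR cR sym in auto)
  then have S1: "(\<Sum>\<psi>\<in>?H. d \<psi>) \<ge> \<kappa> * ?n ^ Suc (card R)"
    using single tR fin by (simp add: d_def)
  have "card (coloured_maps (R \<union> J) c V W) = (\<Sum>\<psi>\<in>?H. card {x \<in> V. \<forall>i\<in>R. W (\<psi> i) x} ^ card J)"
    by (rule card_coloured_maps_split[OF fin disj cJ cR sym])
  then have SJ: "real (card (coloured_maps (R \<union> J) c V W)) = (\<Sum>\<psi>\<in>?H. d \<psi> ^ card J)"
    by (simp add: d_def)
  have cH: "real (card ?H) \<le> ?n ^ card R"
    using card_coloured_maps_le[OF fin(2,1), of c W] by (simp flip: of_nat_power)
  have cRJ: "card (R \<union> J) = card R + card J" using fin disj by (simp add: card_Un_disjoint)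
  show ?thesis
  proof (cases "card J")
    case 0
    have "\<kappa> * ?n ^ Suc (card R) \<le> (\<Sum>\<psi>\<in>?H. ?n)"
      using S1 fin by (intro order_trans[OF S1] sum_mono) (auto simp: d_def intro: card_mono)
    then have "(\<kappa> * ?n ^ card R) * ?n \<le> real (card ?H) * ?n" by (simp add: algebra_simps)
    then have "\<kappa> * ?n ^ card R \<le> real (card ?H)" using n by simp
    then show ?thesis using SJ 0 cRJ by simp
  next
    case (Suc m)
    define a where "a = \<kappa> * ?n"
    have a0: "a \<ge> 0" using \<kappa> by (simp add: a_def)
    have "\<kappa> ^ Suc (Suc m) \<le> \<kappa> ^ Suc m" using \<kappa> by (intro power_decreasing) auto
    then have "\<kappa> ^ Suc (card J) * ?n ^ card (R \<union> J) \<le> \<kappa> ^ Suc m * ?n ^ (card R + Suc m)"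
      unfolding cRJ Suc by (intro mult_right_mono) auto
    also have "\<dots> = a ^ Suc m * ?n ^ card R"
      by (simp add: a_def power_mult_distrib power_add algebra_simps)
    also have "\<dots> = real (Suc m) * a ^ m * (\<kappa> * ?n ^ Suc (card R)) - real m * a ^ Suc m * ?n ^ card R"
      by (simp add: a_def algebra_simps)
    also have "\<dots> \<le> real (Suc m) * a ^ m * (\<Sum>\<psi>\<in>?H. d \<psi>) - real m * a ^ Suc m * real (card ?H)"
      using S1 cH a0 by (intro diff_mono mult_left_mono) auto
    also have "\<dots> = (\<Sum>\<psi>\<in>?H. real (Suc m) * a ^ m * d \<psi> - real m * a ^ Suc m)"
      by (simp add: sum_subtractf sum_distrib_left)
    also have "\<dots> \<le> (\<Sum>\<psi>\<in>?H. d \<psi> ^ Suc m)"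
      using a0 by (intro sum_mono power_tangent_line) (auto simp: d_def)
    finally show ?thesis using SJ Suc by simp
  qed
qed

text \<open>
  The density of cliques with \<open>r + 1\<close> vertices, after a loss of the power \<open>h + 1\<close> for blowing up each
  of the \<open>r + 1\<close> vertices.
\<close>

definition blow_up_density :: "nat \<Rightarrow> real \<Rightarrow> nat \<Rightarrow> real" where
  "blow_up_density r \<epsilon> h = ((\<epsilon>\<^sup>2 / 8) ^ (r + 1)) ^ (h + 1) ^ (r + 1)"

text \<open>
  Start from single vertices \<open>h, ..., h + r\<close>, one for each colour, and exchange them one after another
  for the colour classes of \<open>c\<close> in \<open>{..<h}\<close>.
\<close>

lemma partite_supersaturation:
  fixes V :: "'v set" and \<epsilon> :: real and c :: "nat \<Rightarrow> nat"
  assumes V: "finite V" and sym: "\<And>x y. W x y \<Longrightarrow> W y x" and r: "r \<ge> 1"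
    and \<epsilon>: "0 < \<epsilon>" "\<epsilon> \<le> 1" and n: "real (card V) * \<epsilon>\<^sup>2 \<ge> 4"
    and dens: "(\<Sum>x\<in>V. \<Sum>y\<in>V. of_bool (W x y)) \<ge> (1 - 1 / real r + \<epsilon>) * (real (card V))\<^sup>2"
    and c: "\<And>u. u < h \<Longrightarrow> c u \<le> r"
  shows "real (card (coloured_maps {..<h} c V W)) \<ge> blow_up_density r \<epsilon> h * real (card V) ^ h"
proof -
  let ?n = "real (card V)"
  define \<kappa> where "\<kappa> = (\<epsilon>\<^sup>2 / 8) ^ (r + 1)"
  have "\<epsilon>\<^sup>2 \<le> 1" using \<epsilon> by (simp add: power_le_one)
  then have "0 < \<epsilon>\<^sup>2 / 8" "\<epsilon>\<^sup>2 / 8 \<le> 1" using \<epsilon> by auto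
  then have \<kappa>: "0 < \<kappa>" "\<kappa> \<le> 1" unfolding \<kappa>_def by (intro zero_less_power power_le_one; simp)+
  have Vne: "V \<noteq> {}" using n by auto
  \<comment> \<open>The index \<open>h + i\<close> is the representative of colour \<open>i\<close>.\<close>
  define c' where "c' u = (if u < h then c u else u - h)" for u
  define stage where "stage k = {u. u < h \<and> c u < k} \<union> (\<lambda>i. h + i) ` {k..r}" for k
  have "real (card (coloured_maps (stage k) c' V W)) \<ge> \<kappa> ^ (h + 1) ^ k * ?n ^ card (stage k)"
    if "k \<le> r + 1" for k
    using that
  proof (induction k)
    case 0
    have s0: "stage 0 = (\<lambda>i. h + i) ` {..r}" by (simp add: stage_def atLeast0AtMost)
    have cs: "card (stage 0) = r + 1" unfolding s0 by (simp add: card_image)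
    have "real (card (coloured_maps (stage 0) c' V W)) \<ge> (\<epsilon>\<^sup>2 / 8 * ?n) ^ card (stage 0)"
      by (rule clique_supersaturation[OF V sym r \<epsilon> n dens])
         (auto simp: cs, auto simp: s0 inj_on_def c'_def)
    then show ?case unfolding cs \<kappa>_def power_mult_distrib by simp
  next
    case (Suc k)
    define R where "R = {u. u < h \<and> c u < k} \<union> (\<lambda>i. h + i) ` {Suc k..r}"
    define J where "J = {u. u < h \<and> c u = k}"
    have st: "stage k = insert (h + k) R" "stage (Suc k) = R \<union> J"
      using Suc.prems by (auto simp: stage_def R_def J_def image_iff Suc_le_eq le_less)
    have "J \<subseteq> {..<h}" by (auto simp: J_def)
    then have J: "finite J" "card J \<le> h" using finite_subset card_mono[of "{..<h}" J] by auto
    let ?k = "\<kappa> ^ (h + 1) ^ k"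
    have k01: "0 \<le> ?k" "?k \<le> 1" using \<kappa> by (auto intro!: power_le_one)
    have blown: "real (card (coloured_maps (R \<union> J) c' V W)) \<ge> ?k ^ Suc (card J) * ?n ^ card (R \<union> J)"
    proof (rule coloured_maps_blow_up[where t = "h + k"])
      show "real (card (coloured_maps (insert (h + k) R) c' V W)) \<ge> ?k * ?n ^ card (insert (h + k) R)"
        using Suc st by simp
    qed (use V J Vne k01 sym in \<open>auto simp: R_def J_def c'_def\<close>)
    have "?k ^ Suc h \<le> ?k ^ Suc (card J)" using k01 J by (intro power_decreasing) auto
    then have le: "?k ^ Suc h * ?n ^ card (R \<union> J) \<le> ?k ^ Suc (card J) * ?n ^ card (R \<union> J)"
      by (intro mult_right_mono) auto
    have eq: "?k ^ Suc h = \<kappa> ^ (h + 1) ^ Suc k"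
      by (simp only: power_mult[symmetric]) (simp add: mult.commute)
    show ?case using order_trans[OF le blown] unfolding st eq .
  qed
  from this[of "r + 1"] have "real (card (coloured_maps (stage (r + 1)) c' V W))
      \<ge> blow_up_density r \<epsilon> h * ?n ^ card (stage (r + 1))"
    by (simp add: blow_up_density_def \<kappa>_def)
  moreover have "stage (r + 1) = {..<h}" using c by (force simp: stage_def)
  moreover have "coloured_maps {..<h} c' V W = coloured_maps {..<h} c V W"
    by (auto simp: coloured_maps_def c'_def)
  ultimately show ?thesis by simp
qed

section \<open>Patterns in functions close to a small constant\<close>

lemma card_maps_pair:
  fixes V :: "'v set"
  assumes "finite V" "V \<noteq> {}" "finite I" "u \<in> I" "v \<in> I" "u \<noteq> v"
    and B: "real (card {z \<in> V \<times> V. B z}) \<le> b * (real (card V))\<^sup>2"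
  shows "real (card {\<phi> \<in> I \<rightarrow>\<^sub>E V. B (\<phi> u, \<phi> v)}) \<le> b * real (card V) ^ card I"
proof -
  let ?n = "real (card V)"
  have n: "?n > 0" using assms(1,2) by (simp add: card_gt_0_iff)
  have "?n\<^sup>2 * (\<Sum>\<phi>\<in>I \<rightarrow>\<^sub>E V. of_bool (B (\<phi> u, \<phi> v))) = ?n ^ card I * (\<Sum>z\<in>V \<times> V. of_bool (B z))"
    by (rule sum_maps_pair[OF assms(3-6)])
  then have "?n\<^sup>2 * real (card {\<phi> \<in> I \<rightarrow>\<^sub>E V. B (\<phi> u, \<phi> v)}) = ?n ^ card I * real (card {z \<in> V \<times> V. B z})"
    using assms(1,3) by (simp add: finite_PiE Int_def)
  also have "\<dots> \<le> ?n ^ card I * (b * ?n\<^sup>2)" using B by (intro mult_left_mono) auto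
  finally have "?n\<^sup>2 * real (card {\<phi> \<in> I \<rightarrow>\<^sub>E V. B (\<phi> u, \<phi> v)}) \<le> ?n\<^sup>2 * (b * ?n ^ card I)"
    by (simp add: algebra_simps)
  then show ?thesis using n by simp
qed

text \<open>
  Each unordered pair of pattern vertices exactly once, as the counting lemma requires.
\<close>

definition up_pairs :: "nat \<Rightarrow> (nat \<times> nat) set" where
  "up_pairs h = {(u, v). u < v \<and> v < h}"

lemma up_pairs_subset: "up_pairs h \<subseteq> {..<h} \<times> {..<h}"
  by (auto simp: up_pairs_def)

lemma finite_up_pairs: "finite (up_pairs h)"
  by (rule finite_subset[OF up_pairs_subset]) simp

lemma card_up_pairs_le: "real (card (up_pairs h)) \<le> (real h)\<^sup>2"
proof -
  have "card (up_pairs h) \<le> card ({..<h} \<times> {..<h})"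
    by (rule card_mono[OF _ up_pairs_subset]) simp
  then have "real (card (up_pairs h)) \<le> real (h * h)"
    by (simp only: card_cartesian_product card_lessThan of_nat_le_iff)
  then show ?thesis by (simp add: power2_eq_square)
qed

lemma card_maps_some_pair:
  fixes V :: "'v set"
  assumes "finite V" "V \<noteq> {}"
    and B: "real (card {z \<in> V \<times> V. B z}) \<le> b * (real (card V))\<^sup>2"
  shows "real (card {\<phi> \<in> {..<h} \<rightarrow>\<^sub>E V. \<exists>e\<in>up_pairs h. B (\<phi> (fst e), \<phi> (snd e))})
    \<le> real (card (up_pairs h)) * (b * real (card V) ^ h)"
proof -
  let ?B = "\<lambda>e. {\<phi> \<in> {..<h} \<rightarrow>\<^sub>E V. B (\<phi> (fst e), \<phi> (snd e))}"
  have "{\<phi> \<in> {..<h} \<rightarrow>\<^sub>E V. \<exists>e\<in>up_pairs h. B (\<phi> (fst e), \<phi> (snd e))} = (\<Union>e\<in>up_pairs h. ?B e)"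
    by auto
  then have "card {\<phi> \<in> {..<h} \<rightarrow>\<^sub>E V. \<exists>e\<in>up_pairs h. B (\<phi> (fst e), \<phi> (snd e))}
    \<le> (\<Sum>e\<in>up_pairs h. card (?B e))"
    using card_UN_le[OF finite_up_pairs] by simp
  then have "real (card {\<phi> \<in> {..<h} \<rightarrow>\<^sub>E V. \<exists>e\<in>up_pairs h. B (\<phi> (fst e), \<phi> (snd e))})
    \<le> (\<Sum>e\<in>up_pairs h. real (card (?B e)))"
    by (simp flip: of_nat_sum)
  also have "\<dots> \<le> (\<Sum>e\<in>up_pairs h. b * real (card V) ^ h)"
  proof (rule sum_mono)
    fix e assume "e \<in> up_pairs h"
    then have "fst e \<in> {..<h}" "snd e \<in> {..<h}" "fst e \<noteq> snd e" by (auto simp: up_pairs_def)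
    from card_maps_pair[OF assms(1,2) _ this B]
    show "real (card (?B e)) \<le> b * real (card V) ^ h" by simp
  qed
  finally show ?thesis by simp
qed

text \<open>
  With these weights, the pattern sum of a 0-1-valued symmetric \<open>g\<close> counts the maps, injective or not,
  under which \<open>g\<close> induces exactly the adjacencies of the pattern.
\<close>

definition pattern_weight ::
  "(nat \<Rightarrow> nat \<Rightarrow> bool) \<Rightarrow> ('v \<times> 'v \<Rightarrow> real) \<Rightarrow> nat \<times> nat \<Rightarrow> 'v \<times> 'v \<Rightarrow> real" where
  "pattern_weight a g e z = (if a (fst e) (snd e) then g z else 1 - g z)"

text \<open>
  The heart of the lower bound. The threshold \<open>\<delta> = \<epsilon> p / 4\<close> separates white (\<open>g < \<delta>\<close>), grey and black
  (\<open>g > 1 - \<delta>\<close>) pairs. A white pair uses up at least \<open>p (1 - \<epsilon> / 4)\<close> of the distance to \<open>p\<close> and a black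
  pair at least \<open>1 / 2\<close>. The budget \<open>(1 - \<epsilon>) p / r\<close> leaves enough grey pairs for supersaturation, and so
  few black ones that they spoil at most half of the maps found. Every pair of a surviving map
  contributes a factor of at least \<open>\<delta>\<close>: edges join different colours and hence are at grey pairs, and
  non-edges are not at black pairs.
\<close>

lemma pattern_sum_near_sparse:
  fixes V :: "'v set" and g :: "'v \<times> 'v \<Rightarrow> real" and p \<epsilon> :: real
  assumes V: "finite V" and r: "r \<ge> 1" and \<epsilon>: "0 < \<epsilon>" "\<epsilon> \<le> 1"
    and n: "real (card V) * (\<epsilon> / (4 * real r))\<^sup>2 \<ge> 4"
    and g01: "\<And>z. z \<in> V \<times> V \<Longrightarrow> 0 \<le> g z \<and> g z \<le> 1" and gsym: "\<And>x y. g (x, y) = g (y, x)"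
    and p: "0 < p" "p \<le> 1 / 4" "p \<le> \<epsilon> / (4 * real r)"
    and p\<kappa>: "4 * (real h)\<^sup>2 * p \<le> blow_up_density r (\<epsilon> / (4 * real r)) h"
    and close: "(\<Sum>z\<in>V \<times> V. \<bar>g z - p\<bar>) \<le> (1 - \<epsilon>) * (p / real r) * (real (card V))\<^sup>2"
    and c: "\<And>u. u < h \<Longrightarrow> c u \<le> r" and a: "\<And>u v. u < h \<Longrightarrow> v < h \<Longrightarrow> a u v \<Longrightarrow> c u \<noteq> c v"
  shows "pattern_sum {..<h} (up_pairs h) V (pattern_weight a g)
    \<ge> blow_up_density r (\<epsilon> / (4 * real r)) h / 2 * (\<epsilon> * p / 4) ^ card (up_pairs h) * real (card V) ^ h"
proof -
  let ?n = "real (card V)" and ?\<epsilon> = "\<epsilon> / (4 * real r)" and ?Z = "V \<times> V"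
  define \<kappa> where "\<kappa> = blow_up_density r ?\<epsilon> h"
  define \<delta> where "\<delta> = \<epsilon> * p / 4"
  have fin: "finite ?Z" using V by simp
  have Vne: "V \<noteq> {}" using n by auto
  have rr: "real r \<ge> 1" using r by simp
  have \<delta>: "0 < \<delta>" "\<delta> \<le> p / 4" using \<epsilon> p by (auto simp: \<delta>_def mult_left_le_one_le)
  define white where "white = {z \<in> ?Z. g z < \<delta>}"
  define black where "black = {z \<in> ?Z. g z > 1 - \<delta>}"
  define W where "W x y \<longleftrightarrow> \<delta> \<le> g (x, y) \<and> g (x, y) \<le> 1 - \<delta>" for x y
  have finwb: "finite white" "finite black" using fin by (auto simp: white_def black_def)
  have disj: "white \<inter> black = {}" using \<delta> p by (auto simp: white_def black_def)
  have wb: "real (card white) * (p - \<delta>) + real (card black) * (1 / 2) \<le> (1 - \<epsilon>) * (p / real r) * ?n\<^sup>2"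
  proof -
    have "real (card white) * (p - \<delta>) + real (card black) * (1 / 2)
      \<le> (\<Sum>z\<in>white. \<bar>g z - p\<bar>) + (\<Sum>z\<in>black. \<bar>g z - p\<bar>)"
    proof (rule add_mono)
      show "real (card white) * (p - \<delta>) \<le> (\<Sum>z\<in>white. \<bar>g z - p\<bar>)"
        by (rule sum_bounded_below) (auto simp: white_def)
      show "real (card black) * (1 / 2) \<le> (\<Sum>z\<in>black. \<bar>g z - p\<bar>)"
        by (rule sum_bounded_below) (use p \<delta> in \<open>auto simp: black_def\<close>)
    qed
    also have "\<dots> = (\<Sum>z\<in>white \<union> black. \<bar>g z - p\<bar>)"
      by (rule sum.union_disjoint[symmetric, OF finwb disj])
    also have "\<dots> \<le> (\<Sum>z\<in>?Z. \<bar>g z - p\<bar>)"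
      using fin by (intro sum_mono2) (auto simp: white_def black_def)
    finally show ?thesis using close by simp
  qed
  have pd: "p - \<delta> \<ge> 0" using \<delta> p by simp
  have black: "real (card black) \<le> 2 * p * ?n\<^sup>2"
  proof -
    have "0 \<le> real (card white) * (p - \<delta>)" using pd by simp
    then have "real (card black) \<le> 2 * ((1 - \<epsilon>) * (p / real r) * ?n\<^sup>2)" using wb by simp
    also have "(1 - \<epsilon>) * (p / real r) \<le> 1 * p"
      using \<epsilon> p rr by (intro mult_mono) (auto simp: divide_le_eq mult_left_le)
    then have "2 * ((1 - \<epsilon>) * (p / real r) * ?n\<^sup>2) \<le> 2 * (1 * p * ?n\<^sup>2)"
      by (intro mult_left_mono mult_right_mono) auto
    finally show ?thesis by simp
  qed
  have white: "real (card white) \<le> (1 - 3 * \<epsilon> / 4) / real r * ?n\<^sup>2"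
  proof -
    have pos: "p * (1 - \<epsilon> / 4) > 0" using p \<epsilon> by simp
    have sq: "1 - \<epsilon> \<le> (1 - \<epsilon> / 4) * (1 - 3 * \<epsilon> / 4)" by (simp add: algebra_simps)
    have "(p * (1 - \<epsilon> / 4)) * real (card white) = real (card white) * (p - \<delta>)"
      by (simp add: \<delta>_def algebra_simps)
    also have "\<dots> \<le> (1 - \<epsilon>) * (p / real r * ?n\<^sup>2)" using wb by simp
    also have "\<dots> \<le> ((1 - \<epsilon> / 4) * (1 - 3 * \<epsilon> / 4)) * (p / real r * ?n\<^sup>2)"
      using p sq by (intro mult_right_mono) auto
    also have "\<dots> = (p * (1 - \<epsilon> / 4)) * ((1 - 3 * \<epsilon> / 4) / real r * ?n\<^sup>2)" by simp
    finally have "(p * (1 - \<epsilon> / 4)) * real (card white)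
        \<le> (p * (1 - \<epsilon> / 4)) * ((1 - 3 * \<epsilon> / 4) / real r * ?n\<^sup>2)" .
    then show ?thesis using pos by (simp only: mult_le_cancel_left_pos)
  qed
  have Wsym: "W x y \<Longrightarrow> W y x" for x y using gsym[of x y] by (simp add: W_def)
  have dens: "(\<Sum>x\<in>V. \<Sum>y\<in>V. of_bool (W x y)) \<ge> (1 - 1 / real r + ?\<epsilon>) * ?n\<^sup>2"
  proof -
    have "(\<Sum>x\<in>V. \<Sum>y\<in>V. of_bool (W x y) :: real) = (\<Sum>z\<in>?Z. of_bool (W (fst z) (snd z)))"
      by (simp only: sum.cartesian_product case_prod_unfold)
    also have "\<dots> = real (card {z \<in> ?Z. W (fst z) (snd z)})" using fin by (simp add: Int_def)
    also have "{z \<in> ?Z. W (fst z) (snd z)} = ?Z - (white \<union> black)"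
      by (auto simp: W_def white_def black_def not_less)
    also have "real (card \<dots>) = real (card ?Z) - real (card (white \<union> black))"
      using fin finwb by (subst card_Diff_subset)
        (auto simp: white_def black_def intro!: of_nat_diff card_mono)
    also have "real (card (white \<union> black)) = real (card white) + real (card black)"
      by (simp add: card_Un_disjoint[OF finwb disj])
    also have "real (card ?Z) = ?n\<^sup>2" by (simp add: power2_eq_square card_cartesian_product)
    finally have "(\<Sum>x\<in>V. \<Sum>y\<in>V. of_bool (W x y)) = ?n\<^sup>2 - (real (card white) + real (card black))" .
    moreover have "2 * p * ?n\<^sup>2 \<le> 2 * ?\<epsilon> * ?n\<^sup>2" using p by (intro mult_right_mono) auto
    moreover have "(1 - 3 * \<epsilon> / 4) / real r * ?n\<^sup>2 = (1 / real r) * ?n\<^sup>2 - 3 * (?\<epsilon> * ?n\<^sup>2)"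
      using rr by (simp add: field_simps)
    ultimately show ?thesis using white black by (simp add: algebra_simps)
  qed
  have \<epsilon>1: "0 < ?\<epsilon>" "?\<epsilon> \<le> 1" using \<epsilon> rr by (auto simp: divide_le_eq)
  define cm where "cm = coloured_maps {..<h} c V W"
  have cm: "real (card cm) \<ge> \<kappa> * ?n ^ h"
    unfolding cm_def \<kappa>_def by (rule partite_supersaturation[OF V Wsym r \<epsilon>1 n dens c])
  define bad where "bad = {\<phi> \<in> {..<h} \<rightarrow>\<^sub>E V. \<exists>e\<in>up_pairs h. (\<phi> (fst e), \<phi> (snd e)) \<in> black}"
  have finM: "finite ({..<h} \<rightarrow>\<^sub>E V)" using V by (intro finite_PiE) auto
  have "real (card bad) \<le> real (card (up_pairs h)) * (2 * p * ?n ^ h)"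
    unfolding bad_def
  proof (rule card_maps_some_pair[OF V Vne])
    have "{z \<in> ?Z. z \<in> black} = black" by (auto simp: black_def)
    then show "real (card {z \<in> ?Z. z \<in> black}) \<le> 2 * p * ?n\<^sup>2" using black by simp
  qed
  also have "\<dots> \<le> (real h)\<^sup>2 * (2 * p * ?n ^ h)"
    using p card_up_pairs_le by (intro mult_right_mono) auto
  also have "\<dots> = (4 * (real h)\<^sup>2 * p) * (?n ^ h / 2)" by simp
  also have "\<dots> \<le> \<kappa> * (?n ^ h / 2)" using p\<kappa> unfolding \<kappa>_def by (intro mult_right_mono) auto
  finally have bad: "real (card bad) \<le> \<kappa> / 2 * ?n ^ h" by simp
  define good where "good = cm - bad"
  have "card cm \<le> card good + card bad"
    unfolding good_def
    by (rule order_trans[OF card_mono card_Un_le]) (use finM in \<open>auto simp: cm_def coloured_maps_def bad_def\<close>)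
  then have good: "real (card good) \<ge> \<kappa> / 2 * ?n ^ h" using cm bad by simp
  have w01: "0 \<le> pattern_weight a g e z" if "z \<in> ?Z" for e z
    using g01[OF that] by (simp add: pattern_weight_def)
  have mem: "(\<phi> (fst e), \<phi> (snd e)) \<in> ?Z" if "\<phi> \<in> {..<h} \<rightarrow>\<^sub>E V" "e \<in> up_pairs h" for \<phi> e
    using that by (auto simp: up_pairs_def PiE_iff)
  have lower: "\<delta> ^ card (up_pairs h) \<le> (\<Prod>e\<in>up_pairs h. pattern_weight a g e (\<phi> (fst e), \<phi> (snd e)))"
    if phi: "\<phi> \<in> good" for \<phi>
  proof -
    have phiM: "\<phi> \<in> {..<h} \<rightarrow>\<^sub>E V" using phi by (auto simp: good_def cm_def coloured_maps_def)
    have "(\<Prod>e\<in>up_pairs h. \<delta>) \<le> (\<Prod>e\<in>up_pairs h. pattern_weight a g e (\<phi> (fst e), \<phi> (snd e)))"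
    proof (rule prod_mono, intro conjI)
      fix e assume e: "e \<in> up_pairs h"
      show "0 \<le> \<delta>" using \<delta> by simp
      have eh: "fst e < h" "snd e < h" using e by (auto simp: up_pairs_def)
      show "\<delta> \<le> pattern_weight a g e (\<phi> (fst e), \<phi> (snd e))"
      proof (cases "a (fst e) (snd e)")
        case True
        then have "c (fst e) \<noteq> c (snd e)" using a eh by blast
        then have "W (\<phi> (fst e)) (\<phi> (snd e))"
          using phi eh by (simp add: good_def cm_def coloured_maps_def)
        then show ?thesis using True by (simp add: pattern_weight_def W_def)
      next
        case False
        have "(\<phi> (fst e), \<phi> (snd e)) \<notin> black" using phi phiM e by (auto simp: good_def bad_def)
        then have "g (\<phi> (fst e), \<phi> (snd e)) \<le> 1 - \<delta>" using mem[OF phiM e] by (auto simp: black_def)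
        then show ?thesis using False by (simp add: pattern_weight_def)
      qed
    qed
    then show ?thesis by simp
  qed
  have "\<kappa> / 2 * \<delta> ^ card (up_pairs h) * ?n ^ h = (\<kappa> / 2 * ?n ^ h) * \<delta> ^ card (up_pairs h)" by simp
  also have "\<dots> \<le> real (card good) * \<delta> ^ card (up_pairs h)" using good \<delta> by (intro mult_right_mono) auto
  also have "\<dots> = (\<Sum>\<phi>\<in>good. \<delta> ^ card (up_pairs h))" by simp
  also have "\<dots> \<le> (\<Sum>\<phi>\<in>good. \<Prod>e\<in>up_pairs h. pattern_weight a g e (\<phi> (fst e), \<phi> (snd e)))"
    by (intro sum_mono lower)
  also have "\<dots> \<le> pattern_sum {..<h} (up_pairs h) V (pattern_weight a g)"
    unfolding pattern_sum_def using finM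
    by (intro sum_mono2 prod_nonneg w01 mem) (auto simp: good_def cm_def coloured_maps_def)
  finally show ?thesis by (simp add: \<kappa>_def \<delta>_def)
qed

lemma blow_up_density_pos: "\<epsilon> > 0 \<Longrightarrow> blow_up_density r \<epsilon> h > 0"
  by (simp add: blow_up_density_def)

text \<open>
  A graph \<open>adj\<close> within total distance \<open>l\<close> (as a fraction of all ordered pairs) of a function \<open>q\<close> that
  has cut distance at most \<open>D\<close> from the constant \<open>p\<close> contains the pattern \<open>a\<close> on \<open>{..<h}\<close> as an
  induced subgraph, provided that it has at least \<open>n0\<close> vertices. The order \<open>u < v\<close> only selects one of
  the two ways to write a pair.
\<close>

definition contains_pattern_near_constant ::
  "(nat \<Rightarrow> nat \<Rightarrow> bool) \<Rightarrow> nat \<Rightarrow> real \<Rightarrow> real \<Rightarrow> real \<Rightarrow> nat \<Rightarrow> bool" where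
  "contains_pattern_near_constant a h p D l n0 \<longleftrightarrow>
     (\<forall>(V :: nat set) adj q. finite V \<and> card V \<ge> n0 \<and> (\<forall>x y. adj x y \<longrightarrow> adj y x) \<and>
       (\<forall>A B. A \<subseteq> V \<longrightarrow> B \<subseteq> V \<longrightarrow> \<bar>\<Sum>z\<in>A \<times> B. q z - p\<bar> \<le> D * (real (card V))\<^sup>2) \<and>
       (\<Sum>z\<in>V \<times> V. \<bar>of_bool (adj (fst z) (snd z)) - q z\<bar>) \<le> l * (real (card V))\<^sup>2 \<longrightarrow>
       (\<exists>\<phi>. inj_on \<phi> {..<h} \<and> \<phi> ` {..<h} \<subseteq> V \<and>
         (\<forall>u v. u < v \<and> v < h \<longrightarrow> (adj (\<phi> u) (\<phi> v) \<longleftrightarrow> a u v))))"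

text \<open>
  Averaging over the cells of a weakly regular partition turns the graph into a function \<open>g\<close> that is
  close to the constant \<open>p\<close> in total distance, and the counting lemma carries the pattern density
  of \<open>g\<close> back to the graph. Non-injective maps are too few to account for this density.
\<close>

lemma near_quasirandom_contains_pattern:
  fixes p \<epsilon> :: real
  assumes r: "r \<ge> 1" and \<epsilon>: "0 < \<epsilon>" "\<epsilon> \<le> 1"
    and p: "0 < p" "p \<le> 1 / 4" "p \<le> \<epsilon> / (8 * real r)"
    and p\<kappa>: "4 * (real h)\<^sup>2 * p \<le> blow_up_density r (\<epsilon> / (8 * real r)) h"
    and c: "\<And>u. u < h \<Longrightarrow> c u \<le> r" and a: "\<And>u v. u < h \<Longrightarrow> v < h \<Longrightarrow> a u v \<Longrightarrow> c u \<noteq> c v"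
  shows "\<exists>D>0. \<exists>n0. contains_pattern_near_constant a h p D ((1 - \<epsilon>) * (p / real r)) n0"
proof -
  let ?P = "up_pairs h"
  \<comment> \<open>Half of \<open>\<epsilon>\<close> pays for the discrepancy of \<open>q\<close> on the cells.\<close>
  define \<epsilon>' where "\<epsilon>' = \<epsilon> / 2"
  have \<epsilon>': "0 < \<epsilon>'" "\<epsilon>' \<le> 1" using \<epsilon> by (auto simp: \<epsilon>'_def)
  have e8: "\<epsilon>' / (4 * real r) = \<epsilon> / (8 * real r)" by (simp add: \<epsilon>'_def)
  have rr: "real r \<ge> 1" using r by simp
  define \<kappa> where "\<kappa> = blow_up_density r (\<epsilon>' / (4 * real r)) h"
  \<comment> \<open>Half of the density that \<open>g\<close> guarantees; the counting lemma may lose the other half.\<close>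
  define \<tau> where "\<tau> = \<kappa> / 4 * (\<epsilon>' * p / 4) ^ card ?P"
  have \<kappa>0: "\<kappa> > 0" unfolding \<kappa>_def using \<epsilon>' rr by (intro blow_up_density_pos) auto
  have \<tau>0: "\<tau> > 0" unfolding \<tau>_def using \<kappa>0 \<epsilon>' p by simp
  define \<eta> where "\<eta> = \<tau> / (real (card ?P) + 1)"
  have \<eta>0: "\<eta> > 0" using \<tau>0 by (simp add: \<eta>_def)
  have \<eta>\<tau>: "real (card ?P) * \<eta> \<le> \<tau>" using \<tau>0 by (simp add: \<eta>_def field_simps)
  define N where "N = nat \<lceil>1 / \<eta>\<^sup>2\<rceil>"
  have N: "real N * \<eta>\<^sup>2 \<ge> 1"
  proof -
    have "1 / \<eta>\<^sup>2 \<le> real N" unfolding N_def by linarith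
    then show ?thesis using \<eta>0 by (simp add: divide_le_eq)
  qed
  \<comment> \<open>A partition from \<open>2 N\<close> sets has at most \<open>4 ^ (2 N)\<close> pairs of cells.\<close>
  define D where "D = \<epsilon>' * (p / real r) / 4 ^ (2 * N)"
  have D0: "D > 0" using \<epsilon>' p rr by (simp add: D_def)
  define n0 where "n0 = nat \<lceil>4 / (\<epsilon>' / (4 * real r))\<^sup>2\<rceil> + nat \<lceil>real (card ?P) / \<tau>\<rceil> + 1"
  have "contains_pattern_near_constant a h p D ((1 - \<epsilon>) * (p / real r)) n0"
    unfolding contains_pattern_near_constant_def
  proof (intro allI impI)
    fix V :: "nat set" and adj q
    assume "finite V \<and> card V \<ge> n0 \<and> (\<forall>x y. adj x y \<longrightarrow> adj y x) \<and>
       (\<forall>A B. A \<subseteq> V \<longrightarrow> B \<subseteq> V \<longrightarrow> \<bar>\<Sum>z\<in>A \<times> B. q z - p\<bar> \<le> D * (real (card V))\<^sup>2) \<and>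
       (\<Sum>z\<in>V \<times> V. \<bar>of_bool (adj (fst z) (snd z)) - q z\<bar>)
         \<le> (1 - \<epsilon>) * (p / real r) * (real (card V))\<^sup>2"
    then have V: "finite V" and n: "card V \<ge> n0" and sym: "\<And>x y. adj x y \<Longrightarrow> adj y x"
      and disc: "\<And>A B. A \<subseteq> V \<Longrightarrow> B \<subseteq> V \<Longrightarrow> \<bar>\<Sum>z\<in>A \<times> B. q z - p\<bar> \<le> D * (real (card V))\<^sup>2"
      and close: "(\<Sum>z\<in>V \<times> V. \<bar>of_bool (adj (fst z) (snd z)) - q z\<bar>) \<le> (1 - \<epsilon>) * (p / real r) * (real (card V))\<^sup>2"
      by blast+
    let ?n = "real (card V)" and ?Z = "V \<times> V"
    have fin: "finite ?Z" using V by simp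
    have nn: "real n0 \<le> ?n" using n by simp
    have n1: "?n * (\<epsilon>' / (4 * real r))\<^sup>2 \<ge> 4"
    proof -
      have "4 / (\<epsilon>' / (4 * real r))\<^sup>2 \<le> ?n" using nn unfolding n0_def by linarith
      moreover have "(\<epsilon>' / (4 * real r))\<^sup>2 > 0" using \<epsilon>' rr by simp
      ultimately show ?thesis by (simp only: divide_le_eq if_True)
    qed
    have n2: "real (card ?P) < \<tau> * ?n"
    proof -
      have "real (card ?P) / \<tau> < ?n" using nn unfolding n0_def by linarith
      then show ?thesis using \<tau>0 by (simp add: divide_less_eq mult.commute)
    qed
    have npos: "?n > 0" using nn unfolding n0_def by linarith
    have Vne: "V \<noteq> {}" using npos by auto
    define f where "f z = (of_bool (adj (fst z) (snd z)) :: real)" for z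
    have f01: "0 \<le> f z \<and> f z \<le> 1" for z by (simp add: f_def)
    have f01': "\<And>z. z \<in> ?Z \<Longrightarrow> 0 \<le> f z \<and> f z \<le> 1" using f01 by blast
    obtain \<S> where S: "finite \<S>" "card \<S> \<le> 2 * N"
      "\<And>A B. A \<subseteq> V \<Longrightarrow> B \<subseteq> V \<Longrightarrow>
         \<bar>\<Sum>z\<in>A \<times> B. f z - fibre_avg ?Z (cell_label \<S>) f z\<bar> \<le> \<eta> * ?n\<^sup>2"
      using weak_regularity[where f = f, OF V f01' \<eta>0 N] by blast
    let ?L = "cell_label \<S>"
    define g where "g = fibre_avg ?Z ?L f"
    have g01: "0 \<le> g z \<and> g z \<le> 1" if z: "z \<in> ?Z" for z
    proof
      have "fibre_avg ?Z ?L (\<lambda>_. 0) z \<le> g z" unfolding g_def by (rule fibre_avg_mono) (simp add: f01)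
      then show "0 \<le> g z" by (simp add: fibre_avg_const[OF fin z])
      have "g z \<le> fibre_avg ?Z ?L (\<lambda>_. 1) z" unfolding g_def by (rule fibre_avg_mono) (simp add: f01)
      then show "g z \<le> 1" by (simp add: fibre_avg_const[OF fin z])
    qed
    have gsym: "g (x, y) = g (y, x)" for x y
    proof -
      let ?A = "{z \<in> ?Z. ?L z = ?L (x, y)}" and ?B = "{z \<in> ?Z. ?L z = ?L (y, x)}"
      have mem: "z \<in> ?B \<Longrightarrow> prod.swap z \<in> ?A" "z \<in> ?A \<Longrightarrow> prod.swap z \<in> ?B" for z
        by (cases z; simp add: cell_label_def)+
      have "adj (snd z) (fst z) = adj (fst z) (snd z)" for z using sym by blast
      then have fs: "f (prod.swap z) = f z" for z by (simp add: f_def)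
      have sw: "sum u ?B = (\<Sum>z\<in>?A. u (prod.swap z))" for u :: "nat \<times> nat \<Rightarrow> real"
        by (rule sum.reindex_bij_witness[where i = prod.swap and j = prod.swap])
           (erule mem | rule swap_swap | simp only: swap_swap)+
      have "sum f ?B = sum f ?A" using sw[of f] by (simp only: fs)
      moreover have "real (card ?B) = real (card ?A)" using sw[of "\<lambda>_. 1"] by (simp only: real_of_card)
      ultimately show ?thesis by (simp only: g_def fibre_avg_def)
    qed
    have gclose: "(\<Sum>z\<in>?Z. \<bar>g z - p\<bar>) \<le> (1 - \<epsilon>') * (p / real r) * ?n\<^sup>2"
    proof -
      have "(\<Sum>z\<in>?Z. \<bar>g z - p\<bar>)
        \<le> (\<Sum>z\<in>?Z. \<bar>fibre_avg ?Z ?L (\<lambda>z. f z - q z) z\<bar> + \<bar>fibre_avg ?Z ?L (\<lambda>z. q z - p) z\<bar>)"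
      proof (rule sum_mono)
        fix z assume z: "z \<in> ?Z"
        show "\<bar>g z - p\<bar> \<le> \<bar>fibre_avg ?Z ?L (\<lambda>z. f z - q z) z\<bar> + \<bar>fibre_avg ?Z ?L (\<lambda>z. q z - p) z\<bar>"
          unfolding fibre_avg_diff g_def fibre_avg_const[OF fin z] by linarith
      qed
      also have "\<dots> = (\<Sum>z\<in>?Z. \<bar>fibre_avg ?Z ?L (\<lambda>z. f z - q z) z\<bar>)
          + (\<Sum>z\<in>?Z. \<bar>fibre_avg ?Z ?L (\<lambda>z. q z - p) z\<bar>)" by (rule sum.distrib)
      also have "\<dots> \<le> (\<Sum>z\<in>?Z. \<bar>f z - q z\<bar>) + 4 ^ card \<S> * (D * ?n\<^sup>2)"
        by (intro add_mono fibre_avg_contraction[OF fin] fibre_avg_discrepancy[OF V S(1) disc])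
      also have "\<dots> \<le> (1 - \<epsilon>) * (p / real r) * ?n\<^sup>2 + 4 ^ (2 * N) * (D * ?n\<^sup>2)"
        using close S(2) D0 by (intro add_mono mult_right_mono power_increasing) (auto simp: f_def)
      also have "\<dots> = (1 - \<epsilon>') * (p / real r) * ?n\<^sup>2"
      proof -
        have "4 ^ (2 * N) * (D * ?n\<^sup>2) = \<epsilon>' * (p / real r) * ?n\<^sup>2" by (simp add: D_def)
        moreover have "(1 - \<epsilon>) + \<epsilon>' = 1 - \<epsilon>'" by (simp add: \<epsilon>'_def)
        ultimately show ?thesis by (metis distrib_right)
      qed
      finally show ?thesis .
    qed
    have "pattern_sum {..<h} ?P V (pattern_weight a g)
      \<ge> \<kappa> / 2 * (\<epsilon>' * p / 4) ^ card ?P * ?n ^ h"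
      unfolding \<kappa>_def
      by (rule pattern_sum_near_sparse[OF V r \<epsilon>' n1 g01 gsym p(1,2) _ _ gclose c a])
         (use p p\<kappa> in \<open>simp_all add: e8\<close>)
    then have low: "pattern_sum {..<h} ?P V (pattern_weight a g) \<ge> 2 * \<tau> * ?n ^ h"
      by (simp add: \<tau>_def)
    have "?n\<^sup>2 * \<bar>pattern_sum {..<h} ?P V (pattern_weight a f) - pattern_sum {..<h} ?P V (pattern_weight a g)\<bar>
      \<le> real (card ?P) * (?n ^ card {..<h} * (\<eta> * ?n\<^sup>2))"
    proof (rule counting_lemma[OF V _ up_pairs_subset])
      show "\<bar>\<Sum>z\<in>A \<times> B. pattern_weight a f e z - pattern_weight a g e z\<bar> \<le> \<eta> * ?n\<^sup>2"
        if "A \<subseteq> V" "B \<subseteq> V" for e A B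
      proof (cases "a (fst e) (snd e)")
        case True
        then show ?thesis using S(3)[OF that] by (simp add: pattern_weight_def g_def)
      next
        case False
        then have "(\<Sum>z\<in>A \<times> B. pattern_weight a f e z - pattern_weight a g e z) = - (\<Sum>z\<in>A \<times> B. f z - g z)"
          by (simp add: pattern_weight_def sum_negf[symmetric])
        then show ?thesis using S(3)[OF that] by (simp only: abs_minus_cancel g_def)
      qed
    qed (use f01 g01 in \<open>auto simp: pattern_weight_def up_pairs_def\<close>)
    also have "\<dots> = ?n\<^sup>2 * (real (card ?P) * \<eta> * ?n ^ h)" by simp
    also have "\<dots> \<le> ?n\<^sup>2 * (\<tau> * ?n ^ h)" using \<eta>\<tau> by (intro mult_left_mono mult_right_mono) auto
    finally have "\<bar>pattern_sum {..<h} ?P V (pattern_weight a f) - pattern_sum {..<h} ?P V (pattern_weight a g)\<bar> \<le> \<tau> * ?n ^ h"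
      using npos by simp
    then have high: "pattern_sum {..<h} ?P V (pattern_weight a f) \<ge> \<tau> * ?n ^ h" using low by simp
    let ?M = "{..<h} \<rightarrow>\<^sub>E V"
    have finM: "finite ?M" using V by (intro finite_PiE) auto
    \<comment> \<open>The maps that identify two vertices of the pattern.\<close>
    define coll where "coll = {\<phi> \<in> ?M. \<exists>e\<in>?P. case_prod (=) (\<phi> (fst e), \<phi> (snd e))}"
    have cardcoll: "real (card coll) < \<tau> * ?n ^ h"
    proof -
      have diag: "{z \<in> ?Z. case_prod (=) z} = (\<lambda>x. (x, x)) ` V" by auto
      have "card {z \<in> ?Z. case_prod (=) z} = card V" unfolding diag by (intro card_image) (auto simp: inj_on_def)
      then have "real (card {z \<in> ?Z. case_prod (=) z}) \<le> 1 / ?n * ?n\<^sup>2" using npos by (simp add: power2_eq_square)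
      then have "real (card coll) \<le> real (card ?P) * (1 / ?n * ?n ^ h)"
        unfolding coll_def by (rule card_maps_some_pair[OF V Vne])
      also have "\<dots> = real (card ?P) / ?n * ?n ^ h" by simp
      also have "\<dots> < \<tau> * ?n ^ h"
        using n2 npos by (intro mult_strict_right_mono) (auto simp: divide_less_eq)
      finally show ?thesis .
    qed
    have "\<exists>\<phi>\<in>?M - coll. (\<Prod>e\<in>?P. pattern_weight a f e (\<phi> (fst e), \<phi> (snd e))) \<noteq> 0"
    proof (rule ccontr)
      assume none: "\<not> ?thesis"
      have "pattern_sum {..<h} ?P V (pattern_weight a f) = (\<Sum>\<phi>\<in>coll. \<Prod>e\<in>?P. pattern_weight a f e (\<phi> (fst e), \<phi> (snd e)))"
        unfolding pattern_sum_def using finM none by (intro sum.mono_neutral_right) (auto simp: coll_def)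
      also have "\<dots> \<le> (\<Sum>\<phi>\<in>coll. 1)"
        by (intro sum_mono prod_le_1) (auto simp: pattern_weight_def f01)
      finally show False using high cardcoll by simp
    qed
    then obtain \<phi> where phi: "\<phi> \<in> ?M" "\<phi> \<notin> coll"
      and nz: "(\<Prod>e\<in>?P. pattern_weight a f e (\<phi> (fst e), \<phi> (snd e))) \<noteq> 0" by blast
    have "inj_on \<phi> {..<h}"
    proof (rule linorder_inj_onI)
      fix u v assume "u < v" "u \<in> {..<h}" "v \<in> {..<h}"
      then have "(u, v) \<in> ?P" by (simp add: up_pairs_def)
      then show "\<phi> u \<noteq> \<phi> v" using phi by (force simp: coll_def)
    qed auto
    moreover have "\<phi> ` {..<h} \<subseteq> V" using phi(1) by (auto simp: PiE_iff)
    moreover have "adj (\<phi> u) (\<phi> v) \<longleftrightarrow> a u v" if "u < v" "v < h" for u v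
    proof -
      have "(u, v) \<in> ?P" using that by (simp add: up_pairs_def)
      then have "pattern_weight a f (u, v) (\<phi> u, \<phi> v) \<noteq> 0"
        using nz finite_up_pairs by (force simp: prod_zero_iff)
      then show ?thesis by (auto simp: pattern_weight_def f_def split: if_splits)
    qed
    ultimately show "\<exists>\<phi>. inj_on \<phi> {..<h} \<and> \<phi> ` {..<h} \<subseteq> V \<and> (\<forall>u v. u < v \<and> v < h \<longrightarrow> (adj (\<phi> u) (\<phi> v) \<longleftrightarrow> a u v))"
      by blast
  qed
  then show ?thesis using D0 by blast
qed

section \<open>Quasirandom graphs with a prescribed number of edges\<close>

lemma card_ordered_pairs:
  assumes V: "finite V" and E: "E \<subseteq> all_pairs V"
  shows "card {z \<in> V \<times> V. {fst z, snd z} \<in> E} = 2 * card E"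
proof -
  have finE: "finite E" using V by (intro finite_subset[OF E]) (simp add: all_pairs_def)
  let ?S = "\<lambda>e. {z \<in> V \<times> V. {fst z, snd z} = e}"
  have two: "card (?S e) = 2" if "e \<in> E" for e
  proof -
    have "e \<subseteq> V" "card e = 2" using E that by (auto simp: all_pairs_def)
    then obtain a b where ab: "e = {a, b}" "a \<noteq> b" "a \<in> V" "b \<in> V" by (auto simp: card_2_iff)
    then have "?S e = {(a, b), (b, a)}" by (auto simp: doubleton_eq_iff)
    then show ?thesis using ab by simp
  qed
  have "{z \<in> V \<times> V. {fst z, snd z} \<in> E} = (\<Union>e\<in>E. ?S e)" by auto
  also have "card \<dots> = (\<Sum>e\<in>E. card (?S e))"
    using V finE by (intro card_UN_disjoint) auto
  also have "\<dots> = 2 * card E" using two by simp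
  finally show ?thesis .
qed

text \<open>
  The vertex \<open>x = a q + b\<close> stands for the point \<open>(a, b)\<close> of the plane over the field with \<open>q\<close>
  elements; two points are related when \<open>a c + b + d\<close> lies in \<open>{0..<s}\<close>.
\<close>

definition product_relation :: "nat \<Rightarrow> nat \<Rightarrow> nat \<Rightarrow> nat \<Rightarrow> bool" where
  "product_relation q s x y \<longleftrightarrow> ((x div q) * (y div q) + x mod q + y mod q) mod q < s"

lemma product_relation_commute: "product_relation q s x y \<longleftrightarrow> product_relation q s y x"
  by (simp add: product_relation_def algebra_simps)

text \<open>
  For points with different first coordinates \<open>a\<close> and \<open>a'\<close>, the map \<open>(c, d) \<mapsto> (a c + b + d, a' c + b' + d)\<close>
  is a bijection of the plane, because \<open>a - a'\<close> is invertible. So the sum factors into two sums over the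
  field, both of which vanish since the function has mean \<open>0\<close>.
\<close>

lemma product_relation_orthogonal:
  assumes q: "prime q" and s: "s \<le> q" and x: "x < q\<^sup>2" "x' < q\<^sup>2" "x div q \<noteq> x' div q"
  shows "(\<Sum>y<q\<^sup>2. (of_bool (product_relation q s x y) - real s / real q) *
            (of_bool (product_relation q s x' y) - real s / real q)) = 0"
proof -
  have q0: "q > 0" using q prime_gt_0_nat by blast
  define form where "form z y = ((z div q) * (y div q) + z mod q + y mod q) mod q" for z y
  have inj: "inj_on (\<lambda>y. (form x y, form x' y)) {..<q\<^sup>2}"
  proof (rule inj_onI)
    fix y y' assume y: "y \<in> {..<q\<^sup>2}" "y' \<in> {..<q\<^sup>2}"
      and eq: "(form x y, form x' y) = (form x y', form x' y')"
    have dq: "z div q < q" if "z < q\<^sup>2" for z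
      using that q0 by (simp add: less_mult_imp_div_less power2_eq_square)
    have 1: "int q dvd (int (z div q) * (int (y div q) - int (y' div q)) + (int (y mod q) - int (y' mod q)))"
      if "form z y = form z y'" for z
    proof -
      have "int ((z div q) * (y div q) + z mod q + y mod q) mod int q
          = int ((z div q) * (y' div q) + z mod q + y' mod q) mod int q"
        using that unfolding form_def by (metis of_nat_mod)
      then have "int q dvd int ((z div q) * (y div q) + z mod q + y mod q) - int ((z div q) * (y' div q) + z mod q + y' mod q)"
        by (simp add: mod_eq_dvd_iff)
      then show ?thesis by (simp add: algebra_simps)
    qed
    have "int q dvd (int (x div q) * (int (y div q) - int (y' div q)) + (int (y mod q) - int (y' mod q)))
       - (int (x' div q) * (int (y div q) - int (y' div q)) + (int (y mod q) - int (y' mod q)))"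
      using eq by (intro dvd_diff 1) auto
    then have "int q dvd (int (x div q) - int (x' div q)) * (int (y div q) - int (y' div q))"
      by (simp add: algebra_simps)
    moreover have small: "u = v" if "int q dvd int u - int v" "u < q" "v < q" for u v
    proof -
      have "int u mod int q = int v mod int q" using that(1) by (simp add: mod_eq_dvd_iff)
      then show ?thesis using that(2,3) by (simp add: zmod_int[symmetric])
    qed
    moreover have "prime (int q)" using q by simp
    ultimately have "int q dvd (int (y div q) - int (y' div q))"
      using small[of "x div q" "x' div q"] x dq by (auto simp: prime_dvd_mult_iff)
    then have div: "y div q = y' div q" using small dq y by simp
    then have "int q dvd int (y mod q) - int (y' mod q)" using 1[of x] eq by simp
    then have "y mod q = y' mod q" by (rule small) (use q0 in auto)
    then show "y = y'" using div by (metis div_mult_mod_eq)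
  qed
  have img: "(\<lambda>y. (form x y, form x' y)) ` {..<q\<^sup>2} = {..<q} \<times> {..<q}"
  proof (rule card_subset_eq)
    show "(\<lambda>y. (form x y, form x' y)) ` {..<q\<^sup>2} \<subseteq> {..<q} \<times> {..<q}" using q0 by (auto simp: form_def)
    show "card ((\<lambda>y. (form x y, form x' y)) ` {..<q\<^sup>2}) = card ({..<q} \<times> {..<q})"
      unfolding card_image[OF inj] by (simp add: power2_eq_square card_cartesian_product)
  qed simp
  define \<xi> where "\<xi> u = of_bool (u < s) - real s / real q" for u
  have "(\<Sum>u<q. \<xi> u) = 0"
  proof -
    have "{..<q} \<inter> {u. u < s} = {..<s}" using s by auto
    then show ?thesis unfolding \<xi>_def using q0 by (simp add: sum_subtractf)
  qed
  moreover have "(\<Sum>(u, v)\<in>{..<q} \<times> {..<q}. \<xi> u * \<xi> v) = (\<Sum>u<q. \<xi> u) * (\<Sum>v<q. \<xi> v)"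
    by (simp add: sum_product sum.cartesian_product)
  moreover have "(\<Sum>y<q\<^sup>2. \<xi> (form x y) * \<xi> (form x' y)) = (\<Sum>(u, v)\<in>{..<q} \<times> {..<q}. \<xi> u * \<xi> v)"
    unfolding img[symmetric] by (subst sum.reindex[OF inj]) simp
  ultimately show ?thesis by (simp add: \<xi>_def form_def product_relation_def)
qed

text \<open>
  Expanding the square after the Cauchy-Schwarz inequality leaves correlations of pairs of rows.
  Only the at most \<open>q\<^sup>3\<close> pairs of rows with the same first coordinate have a nonzero correlation, of
  size at most \<open>q\<^sup>2\<close>; the remaining factor \<open>q\<^sup>2\<close> is the number of columns.
\<close>

lemma product_relation_discrepancy:
  assumes q: "prime q" and s: "s \<le> q" and AB: "A \<subseteq> {..<q\<^sup>2}" "B \<subseteq> {..<q\<^sup>2}"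
  shows "(\<Sum>z\<in>A \<times> B. of_bool (product_relation q s (fst z) (snd z)) - real s / real q)\<^sup>2 \<le> real q ^ 7"
proof -
  have q0: "q > 0" using q prime_gt_0_nat by blast
  define F where "F x y = of_bool (product_relation q s x y) - real s / real q" for x y
  have F1: "\<bar>F x y\<bar> \<le> 1" for x y
  proof -
    have "0 \<le> real s / real q" "real s / real q \<le> 1" using s q0 by auto
    then show ?thesis by (auto simp: F_def of_bool_def)
  qed
  have finA: "finite A" "finite B" using AB finite_subset by blast+
  have cB: "real (card B) \<le> (real q)\<^sup>2" using card_mono[OF _ AB(2)] by (simp flip: of_nat_power)
  have cA: "real (card A) \<le> (real q)\<^sup>2" using card_mono[OF _ AB(1)] by (simp flip: of_nat_power)
  define c where "c y = (\<Sum>x\<in>A. F x y)" for y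
  have row: "(\<Sum>x'\<in>A. (\<Sum>y<q\<^sup>2. F x y * F x' y)) \<le> real q * (real q)\<^sup>2" if "x \<in> A" for x
  proof -
    let ?K = "{x' \<in> A. x' div q = x div q}"
    have "(\<Sum>x'\<in>A. (\<Sum>y<q\<^sup>2. F x y * F x' y)) = (\<Sum>x'\<in>?K. (\<Sum>y<q\<^sup>2. F x y * F x' y))"
    proof (rule sum.mono_neutral_right)
      show "\<forall>x'\<in>A - ?K. (\<Sum>y<q\<^sup>2. F x y * F x' y) = 0"
        using AB(1) that product_relation_orthogonal[OF q s, of x] by (force simp: F_def)
    qed (use finA in auto)
    also have "\<dots> \<le> (\<Sum>x'\<in>?K. (\<Sum>y<q\<^sup>2. 1))"
    proof (intro sum_mono)
      fix x' y show "F x y * F x' y \<le> 1"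
      proof -
        have "\<bar>F x y * F x' y\<bar> \<le> 1 * 1" unfolding abs_mult by (intro mult_mono F1) auto
        then show ?thesis by simp
      qed
    qed
    also have "\<dots> = real (card ?K) * (real q)\<^sup>2" by simp
    also have "\<dots> \<le> real q * (real q)\<^sup>2"
    proof (rule mult_right_mono)
      have "?K \<subseteq> {(x div q) * q..<(x div q) * q + q}"
      proof
        fix x' assume "x' \<in> ?K"
        then have "x' = (x div q) * q + x' mod q" by (metis (mono_tags, lifting) mem_Collect_eq div_mult_mod_eq)
        moreover have "x' mod q < q" using q0 by simp
        ultimately show "x' \<in> {(x div q) * q..<(x div q) * q + q}"
          unfolding atLeastLessThan_iff by linarith
      qed
      then have "card ?K \<le> card {(x div q) * q..<(x div q) * q + q}" by (intro card_mono) auto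
      then show "real (card ?K) \<le> real q" by simp
    qed simp
    finally show ?thesis .
  qed
  have "(\<Sum>z\<in>A \<times> B. F (fst z) (snd z)) = (\<Sum>y\<in>B. c y)"
    unfolding c_def by (simp add: sum.cartesian_product' sum.swap[of _ A B])
  then have "(\<Sum>z\<in>A \<times> B. F (fst z) (snd z))\<^sup>2 = (\<Sum>y\<in>B. 1 * c y)\<^sup>2" by simp
  also have "\<dots> \<le> (\<Sum>y\<in>B. 1\<^sup>2) * (\<Sum>y\<in>B. (c y)\<^sup>2)" by (rule Cauchy_Schwarz_ineq_sum)
  also have "\<dots> \<le> (real q)\<^sup>2 * (\<Sum>y<q\<^sup>2. (c y)\<^sup>2)"
    using cB AB(2) by (intro mult_mono sum_mono2) (auto intro: sum_nonneg)
  also have "(\<Sum>y<q\<^sup>2. (c y)\<^sup>2) = (\<Sum>x\<in>A. \<Sum>x'\<in>A. \<Sum>y<q\<^sup>2. F x y * F x' y)"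
  proof -
    have "(\<Sum>y<q\<^sup>2. (c y)\<^sup>2) = (\<Sum>y<q\<^sup>2. \<Sum>x\<in>A. \<Sum>x'\<in>A. F x y * F x' y)"
      unfolding c_def power2_eq_square sum_product by simp
    also have "\<dots> = (\<Sum>x\<in>A. \<Sum>y<q\<^sup>2. \<Sum>x'\<in>A. F x y * F x' y)" by (rule sum.swap)
    also have "\<dots> = (\<Sum>x\<in>A. \<Sum>x'\<in>A. \<Sum>y<q\<^sup>2. F x y * F x' y)" by (intro sum.cong refl sum.swap)
    finally show ?thesis .
  qed
  also have "(real q)\<^sup>2 * \<dots> \<le> (real q)\<^sup>2 * (\<Sum>x\<in>A. real q * (real q)\<^sup>2)"
    by (intro mult_left_mono sum_mono row) auto
  also have "\<dots> = (real q)\<^sup>2 * (real (card A) * (real q * (real q)\<^sup>2))" by simp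
  also have "\<dots> \<le> (real q)\<^sup>2 * ((real q)\<^sup>2 * (real q * (real q)\<^sup>2))"
    using cA by (intro mult_left_mono mult_right_mono) auto
  also have "\<dots> = real q ^ 7" by (simp add: eval_nat_numeral)
  finally show ?thesis by (simp add: F_def)
qed

text \<open>
  A relation that is quasirandom with density \<open>\<rho>\<close> slightly above \<open>p\<close> has more than enough edges.
  Discarding loops and any surplus edges changes it by \<open>O(D)\<close> per pair on average, because \<open>\<rho> - p\<close> is \<open>O(D)\<close>.
\<close>

lemma graph_inside_quasirandom_relation:
  fixes Q :: "nat \<Rightarrow> nat \<Rightarrow> bool" and p \<rho> D :: real
  assumes sym: "\<And>x y. Q x y \<longleftrightarrow> Q y x"
    and disc: "\<And>A B. A \<subseteq> {..<n} \<Longrightarrow> B \<subseteq> {..<n} \<Longrightarrow>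
      \<bar>\<Sum>z\<in>A \<times> B. of_bool (Q (fst z) (snd z)) - \<rho>\<bar> \<le> D * (real n)\<^sup>2"
    and \<rho>: "p + 2 * D \<le> \<rho>" "\<rho> \<le> p + 4 * D" and p: "0 \<le> p" "p \<le> 1" and D: "D \<ge> 0"
    and n: "real n + 2 \<le> D * (real n)\<^sup>2"
    and m: "\<bar>real m - p * real (n choose 2)\<bar> \<le> 1"
  obtains G :: "nat graph" where "simple_graph G" "verts G = {..<n}" "card (edges G) = m"
    "\<And>A B. A \<subseteq> {..<n} \<Longrightarrow> B \<subseteq> {..<n} \<Longrightarrow>
      \<bar>\<Sum>z\<in>A \<times> B. of_bool ({fst z, snd z} \<in> edges G) - p\<bar> \<le> 11 * D * (real n)\<^sup>2"
proof -
  let ?V = "{..<n}" and ?n = "real n"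
  define E where "E = {e \<in> all_pairs ?V. \<exists>x y. e = {x, y} \<and> Q x y}"
  have EV: "E \<subseteq> all_pairs ?V" by (auto simp: E_def)
  have finE: "finite E" by (rule finite_subset[OF EV]) (simp add: all_pairs_def)
  have Eiff: "{x, y} \<in> E \<longleftrightarrow> x \<noteq> y \<and> Q x y" if "x < n" "y < n" for x y
    using that sym by (auto simp: E_def all_pairs_def doubleton_eq_iff card_2_iff)
  define R where "R = {z \<in> ?V \<times> ?V. Q (fst z) (snd z)}"
  have finR: "finite R" by (simp add: R_def)
  have cR: "real (card R) \<ge> (\<rho> - D) * ?n\<^sup>2" "real (card R) \<le> (\<rho> + D) * ?n\<^sup>2"
  proof -
    have "(\<Sum>z\<in>?V \<times> ?V. of_bool (Q (fst z) (snd z)) - \<rho>) = real (card R) - \<rho> * ?n\<^sup>2"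
      by (simp add: sum_subtractf R_def Int_def power2_eq_square card_cartesian_product)
    then have "\<bar>real (card R) - \<rho> * ?n\<^sup>2\<bar> \<le> D * ?n\<^sup>2" using disc[of ?V ?V] by simp
    then show "real (card R) \<ge> (\<rho> - D) * ?n\<^sup>2" "real (card R) \<le> (\<rho> + D) * ?n\<^sup>2"
      by (simp_all add: abs_le_iff algebra_simps)
  qed
  have choose: "2 * real (n choose 2) = ?n\<^sup>2 - ?n"
  proof (cases n)
    case (Suc k)
    have "even (n * (n - 1))" using Suc by simp
    then have "2 * (n choose 2) = n * (n - 1)" unfolding choose_two by (rule dvd_mult_div_cancel)
    then have "2 * real (n choose 2) = real (n * (n - 1))" by (metis of_nat_mult of_nat_numeral)
    then show ?thesis using Suc by (simp add: power2_eq_square algebra_simps)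
  qed simp
  have m2: "2 * real m \<le> p * ?n\<^sup>2 + 2" "2 * real m \<ge> p * ?n\<^sup>2 - ?n - 2"
  proof -
    have pc: "p * (2 * real (n choose 2)) = p * ?n\<^sup>2 - p * ?n" unfolding choose by (simp add: algebra_simps)
    have "0 \<le> p * ?n" "p * ?n \<le> 1 * ?n" using p by (simp, intro mult_right_mono) simp_all
    then show "2 * real m \<le> p * ?n\<^sup>2 + 2" "2 * real m \<ge> p * ?n\<^sup>2 - ?n - 2"
      using m pc by (simp_all add: abs_le_iff)
  qed
  have "real m \<le> real (card E)"
  proof -
    have "R \<subseteq> {z \<in> ?V \<times> ?V. {fst z, snd z} \<in> E} \<union> (\<lambda>x. (x, x)) ` ?V"
      using Eiff by (auto simp: R_def image_iff)
    then have "card R \<le> card ({z \<in> ?V \<times> ?V. {fst z, snd z} \<in> E} \<union> (\<lambda>x. (x, x)) ` ?V)"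
      by (intro card_mono) auto
    also have "\<dots> \<le> 2 * card E + n"
      using card_Un_le[of "{z \<in> ?V \<times> ?V. {fst z, snd z} \<in> E}" "(\<lambda>x. (x, x)) ` ?V"]
        card_image_le[of ?V "\<lambda>x. (x, x)"] card_ordered_pairs[OF _ EV] by simp
    finally have "real (card R) \<le> real (2 * card E + n)" by (rule of_nat_mono)
    moreover have "(p + D) * ?n\<^sup>2 \<le> (\<rho> - D) * ?n\<^sup>2" using \<rho> by (intro mult_right_mono) auto
    ultimately have "(p + D) * ?n\<^sup>2 \<le> 2 * real (card E) + ?n" using cR(1) by simp
    then show ?thesis using m2(1) n by (simp add: algebra_simps)
  qed
  then have "m \<le> card E" by simp
  then obtain E' where E': "E' \<subseteq> E" "card E' = m" using obtain_subset_with_card_n by blast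
  have E'V: "E' \<subseteq> all_pairs ?V" using E' EV by blast
  define G where "G = Graph ?V E'"
  define d where "d z = (of_bool (Q (fst z) (snd z)) - of_bool ({fst z, snd z} \<in> E') :: real)" for z
  have d0: "d z \<ge> 0" if "z \<in> ?V \<times> ?V" for z
    using that Eiff[of "fst z" "snd z"] E'(1) by (auto simp: d_def)
  have dsum: "(\<Sum>z\<in>?V \<times> ?V. d z) \<le> 6 * D * ?n\<^sup>2"
  proof -
    have "(\<Sum>z\<in>?V \<times> ?V. d z) = real (card R) - real (card {z \<in> ?V \<times> ?V. {fst z, snd z} \<in> E'})"
      unfolding d_def by (simp add: sum_subtractf R_def Int_def)
    also have "\<dots> = real (card R) - 2 * real m" using card_ordered_pairs[OF _ E'V] E'(2) by simp
    also have "\<dots> \<le> (\<rho> + D) * ?n\<^sup>2 - (p * ?n\<^sup>2 - ?n - 2)" using cR(2) m2(2) by linarith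
    also have "(\<rho> + D) * ?n\<^sup>2 \<le> (p + 5 * D) * ?n\<^sup>2" using \<rho> by (intro mult_right_mono) auto
    finally show ?thesis using n by (simp add: algebra_simps)
  qed
  show ?thesis
  proof (rule that[of G])
    show "simple_graph G" using E'V by (simp add: G_def simple_graph_def)
    show "verts G = {..<n}" "card (edges G) = m" using E' by (simp_all add: G_def)
    fix A B assume AB: "A \<subseteq> ?V" "B \<subseteq> ?V"
    then have ABV: "A \<times> B \<subseteq> ?V \<times> ?V" by auto
    have cAB: "real (card (A \<times> B)) \<le> ?n\<^sup>2"
    proof -
      have "card (A \<times> B) \<le> card (?V \<times> ?V)" by (rule card_mono[OF _ ABV]) simp
      then have "real (card (A \<times> B)) \<le> real (card (?V \<times> ?V))" by (rule of_nat_mono)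
      then show ?thesis by (simp add: power2_eq_square card_cartesian_product)
    qed
    have "(\<Sum>z\<in>A \<times> B. of_bool ({fst z, snd z} \<in> edges G) - p)
      = (\<Sum>z\<in>A \<times> B. of_bool (Q (fst z) (snd z)) - \<rho>) - (\<Sum>z\<in>A \<times> B. d z) + (\<Sum>z\<in>A \<times> B. \<rho> - p)"
      unfolding sum_subtractf[symmetric] sum.distrib[symmetric] by (simp add: d_def G_def)
    moreover have "\<bar>\<Sum>z\<in>A \<times> B. of_bool (Q (fst z) (snd z)) - \<rho>\<bar> \<le> D * ?n\<^sup>2" by (rule disc[OF AB])
    moreover have "0 \<le> (\<Sum>z\<in>A \<times> B. d z)" using ABV d0 by (intro sum_nonneg) blast
    moreover have "(\<Sum>z\<in>A \<times> B. d z) \<le> (\<Sum>z\<in>?V \<times> ?V. d z)" using ABV d0 by (intro sum_mono2) auto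
    moreover have "(\<Sum>z\<in>A \<times> B. \<rho> - p) = real (card (A \<times> B)) * (\<rho> - p)" by simp
    moreover have "0 \<le> real (card (A \<times> B)) * (\<rho> - p)" using \<rho> D by simp
    moreover have "real (card (A \<times> B)) * (\<rho> - p) \<le> ?n\<^sup>2 * (4 * D)" using cAB \<rho> D by (intro mult_mono) auto
    moreover have "?n\<^sup>2 * (4 * D) = 4 * (D * ?n\<^sup>2)" "6 * D * ?n\<^sup>2 = 6 * (D * ?n\<^sup>2)"
      "11 * D * ?n\<^sup>2 = 11 * (D * ?n\<^sup>2)" by simp_all
    ultimately show "\<bar>\<Sum>z\<in>A \<times> B. of_bool ({fst z, snd z} \<in> edges G) - p\<bar> \<le> 11 * D * ?n\<^sup>2"
      using dsum by linarith
  qed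
qed

text \<open>
  The discrepancy \<open>q powr (7 / 2)\<close> of the product relation is \<open>o(n\<^sup>2)\<close> for \<open>n = q\<^sup>2\<close>. The condition on
  \<open>m\<close> admits both roundings of \<open>p * (n choose 2)\<close>: complements turn rounding down into rounding up.
\<close>

lemma quasirandom_graphs_exist:
  fixes p D :: real
  assumes p: "0 < p" "p \<le> 1 / 4" and D: "D > 0"
  obtains n where "n \<ge> n0" "\<And>m. \<bar>real m - p * real (n choose 2)\<bar> \<le> 1 \<Longrightarrow>
    \<exists>G :: nat graph. simple_graph G \<and> verts G = {..<n} \<and> card (edges G) = m \<and>
      (\<forall>A B. A \<subseteq> {..<n} \<longrightarrow> B \<subseteq> {..<n} \<longrightarrow>
        \<bar>\<Sum>z\<in>A \<times> B. of_bool ({fst z, snd z} \<in> edges G) - p\<bar> \<le> D * (real n)\<^sup>2)"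
proof -
  define D' where "D' = min (D / 11) (1 / 16)"
  have D': "D' > 0" "11 * D' \<le> D" "D' \<le> 1 / 16" using D by (auto simp: D'_def)
  obtain q where q: "prime q" "q > n0 + nat \<lceil>3 / D'\<^sup>2\<rceil> + nat \<lceil>3 / D'\<rceil>"
    using bigger_prime by blast
  have qr: "real q \<ge> 3 / D'\<^sup>2" "real q \<ge> 3 / D'" "q \<ge> n0" "real q \<ge> 1" using q(2) by linarith+
  have q1: "1 \<le> D'\<^sup>2 * real q" "3 \<le> D' * real q"
    using qr(1,2) D' by (simp_all add: divide_le_eq mult.commute)
  \<comment> \<open>Rounding up leaves room: \<open>s / q\<close> stays between \<open>p + 2 D'\<close> and \<open>p + 4 D'\<close>.\<close>
  define s where "s = nat \<lceil>(p + 2 * D') * real q\<rceil>"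
  have s0: "(p + 2 * D') * real q \<le> real s" "real s \<le> (p + 2 * D') * real q + 1"
  proof -
    have "0 \<le> (p + 2 * D') * real q" using p D' by simp
    then show "(p + 2 * D') * real q \<le> real s" "real s \<le> (p + 2 * D') * real q + 1"
      unfolding s_def by linarith+
  qed
  have \<rho>: "p + 2 * D' \<le> real s / real q" "real s / real q \<le> p + 4 * D'"
  proof -
    show "p + 2 * D' \<le> real s / real q" using s0(1) qr(4) by (simp add: le_divide_eq)
    have "real s \<le> (p + 4 * D') * real q" using s0(2) q1(2) by (simp add: algebra_simps)
    then show "real s / real q \<le> p + 4 * D'" using qr(4) by (simp add: divide_le_eq)
  qed
  have sq: "s \<le> q"
  proof -
    have "real s / real q \<le> 1" using \<rho>(2) p D' by linarith
    then have "real s \<le> real q" using qr(4) by (simp add: divide_le_eq)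
    then show ?thesis by simp
  qed
  let ?n = "q\<^sup>2"
  have disc: "\<bar>\<Sum>z\<in>A \<times> B. of_bool (product_relation q s (fst z) (snd z)) - real s / real q\<bar> \<le> D' * (real ?n)\<^sup>2"
    if "A \<subseteq> {..<?n}" "B \<subseteq> {..<?n}" for A B
  proof -
    have "\<bar>\<Sum>z\<in>A \<times> B. of_bool (product_relation q s (fst z) (snd z)) - real s / real q\<bar>\<^sup>2 \<le> real q ^ 7 * 1"
      using product_relation_discrepancy[OF q(1) sq that] by simp
    also have "\<dots> \<le> real q ^ 7 * (D'\<^sup>2 * real q)" using q1(1) by (intro mult_left_mono) auto
    also have "\<dots> = (D' * (real ?n)\<^sup>2)\<^sup>2" by (simp add: power_mult_distrib eval_nat_numeral)
    finally show ?thesis by (rule power2_le_imp_le) (use D' in simp)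
  qed
  have nn: "real ?n + 2 \<le> D' * (real ?n)\<^sup>2"
  proof -
    have n1: "real ?n \<ge> 1" using qr(4) by simp
    have "real q \<le> real ?n" using qr(4) by (simp add: power2_eq_square)
    then have "3 \<le> D' * real ?n" using q1(2) D' by (smt (verit) mult_left_mono)
    then have "3 * real ?n \<le> D' * real ?n * real ?n" using n1 by (intro mult_right_mono) auto
    then show ?thesis using n1 unfolding power2_eq_square[of "real ?n"] mult.assoc by linarith
  qed
  show ?thesis
  proof (rule that[of ?n])
    have "q \<le> ?n" by (simp add: power2_eq_square)
    then show "?n \<ge> n0" using qr(3) by linarith
    fix m assume m: "\<bar>real m - p * real (?n choose 2)\<bar> \<le> 1"
    have p1: "0 \<le> p" "p \<le> 1" "0 \<le> D'" using p D' by auto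
    show "\<exists>G :: nat graph. simple_graph G \<and> verts G = {..<?n} \<and> card (edges G) = m \<and>
      (\<forall>A B. A \<subseteq> {..<?n} \<longrightarrow> B \<subseteq> {..<?n} \<longrightarrow>
        \<bar>\<Sum>z\<in>A \<times> B. of_bool ({fst z, snd z} \<in> edges G) - p\<bar> \<le> D * (real ?n)\<^sup>2)"
    proof (rule graph_inside_quasirandom_relation[OF product_relation_commute disc \<rho> p1 nn m])
      fix G :: "nat graph"
      assume G: "simple_graph G" "verts G = {..<?n}" "card (edges G) = m"
        and dG: "\<And>A B. A \<subseteq> {..<?n} \<Longrightarrow> B \<subseteq> {..<?n} \<Longrightarrow>
          \<bar>\<Sum>z\<in>A \<times> B. of_bool ({fst z, snd z} \<in> edges G) - p\<bar> \<le> 11 * D' * (real ?n)\<^sup>2"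
      have "11 * D' * (real ?n)\<^sup>2 \<le> D * (real ?n)\<^sup>2" using D'(2) by (intro mult_right_mono) auto
      then show ?thesis
        using G by (intro exI[of _ G] conjI allI impI order_trans[OF dG]) simp_all
    qed
  qed
qed

section \<open>Chromatic numbers\<close>

lemma finite_all_pairs: "finite V \<Longrightarrow> finite (all_pairs V)"
  by (simp add: all_pairs_def)

lemma card_all_pairs: "finite V \<Longrightarrow> card (all_pairs V) = card V choose 2"
  unfolding all_pairs_def by (rule n_subsets)

lemma simple_graph_finite_edges: "simple_graph G \<Longrightarrow> finite (edges G)"
  unfolding simple_graph_def by (metis finite_all_pairs finite_subset)

lemma edge_distinct: "simple_graph G \<Longrightarrow> {u, v} \<in> edges G \<Longrightarrow> u \<noteq> v"
  by (auto simp: simple_graph_def all_pairs_def)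

lemma colouring_exists:
  assumes "simple_graph G"
  shows "\<exists>c. proper_colouring G (card (verts G)) c"
proof -
  have "finite (verts G)" using assms by (simp add: simple_graph_def)
  then obtain f where f: "bij_betw f (verts G) {..<card (verts G)}"
    using ex_bij_betw_finite_nat by (metis atLeast0LessThan)
  have "proper_colouring G (card (verts G)) f"
    unfolding proper_colouring_def
  proof (intro conjI ballI impI)
    show "f ` verts G \<subseteq> {..<card (verts G)}" using f by (simp add: bij_betw_def)
    fix u v assume "u \<in> verts G" "v \<in> verts G" "{u, v} \<in> edges G"
    then show "f u \<noteq> f v" using edge_distinct[OF assms] f by (auto simp: bij_betw_def inj_on_def)
  qed
  then show ?thesis by blast
qed

lemma chromatic_number_colouring:
  assumes "simple_graph G"
  obtains c where "proper_colouring G (chromatic_number G) c"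
  using LeastI_ex[of "\<lambda>k. \<exists>c. proper_colouring G k c"] colouring_exists[OF assms]
  unfolding chromatic_number_def by blast

lemma chromatic_number_le: "proper_colouring G k c \<Longrightarrow> chromatic_number G \<le> k"
  unfolding chromatic_number_def by (rule Least_le) blast

lemma chromatic_number_ge_2:
  assumes G: "simple_graph G" "\<not> is_anticlique G"
  shows "chromatic_number G \<ge> 2"
proof -
  obtain c where c: "proper_colouring G (chromatic_number G) c" by (rule chromatic_number_colouring[OF G(1)])
  obtain e where e: "e \<in> edges G" using G(2) by (auto simp: is_anticlique_def)
  then have "e \<subseteq> verts G" "card e = 2" using G(1) by (auto simp: simple_graph_def all_pairs_def)
  then obtain u v where uv: "e = {u, v}" "u \<in> verts G" "v \<in> verts G" by (auto simp: card_2_iff)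
  then have "c u \<noteq> c v" "c u < chromatic_number G" "c v < chromatic_number G"
    using c e by (auto simp: proper_colouring_def)
  then show ?thesis by linarith
qed

lemma family_chromatic_number_attained:
  assumes "\<F> \<noteq> {}"
  obtains F where "F \<in> \<F>" "chromatic_number F = family_chromatic_number \<F>"
proof -
  have "family_chromatic_number \<F> \<in> chromatic_number ` \<F>"
    unfolding family_chromatic_number_def by (rule Inf_nat_def1) (use assms in simp)
  then show ?thesis using that by auto
qed

lemma family_chromatic_number_le: "F \<in> \<F> \<Longrightarrow> family_chromatic_number \<F> \<le> chromatic_number F"
  unfolding family_chromatic_number_def by (rule cINF_lower) auto

section \<open>Deleting monochromatic edges\<close>

text \<open>
  A colouring of a graph restricts to all its induced subgraphs.
\<close>

lemma Forb_if_colourable: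
  assumes G: "simple_graph G" and c: "proper_colouring G k c"
    and k: "k < family_chromatic_number \<F>"
  shows "G \<in> Forb \<F>"
proof -
  have "\<not> isomorphic F (induced_subgraph G U)" if F: "F \<in> \<F>" and U: "U \<subseteq> verts G" for F U
  proof
    assume "isomorphic F (induced_subgraph G U)"
    then obtain f where f: "bij_betw f (verts F) U"
      and fe: "\<And>u v. u \<in> verts F \<Longrightarrow> v \<in> verts F \<Longrightarrow> {u, v} \<in> edges F \<Longrightarrow> {f u, f v} \<in> edges G"
      unfolding isomorphic_def induced_subgraph_def by auto
    have fG: "f u \<in> verts G" if "u \<in> verts F" for u using f U that by (auto simp: bij_betw_def)
    have cG: "c x < k" if "x \<in> verts G" for x using c that by (auto simp: proper_colouring_def)
    have "proper_colouring F k (c \<circ> f)"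
      using c fG fe cG by (auto simp: proper_colouring_def)
    then show False using chromatic_number_le family_chromatic_number_le[OF F] k by fastforce
  qed
  then show ?thesis using G by (auto simp: Forb_def)
qed

text \<open>
  An edge is monochromatic in one of \<open>r\<close> of all colourings, so some colouring does at least as well
  as the average.
\<close>

lemma few_monochromatic_edges:
  assumes V: "finite V" and E: "E \<subseteq> all_pairs V" and r: "r \<ge> 1"
  obtains c :: "'a \<Rightarrow> nat" where "c ` V \<subseteq> {..<r}"
    "real (card {e \<in> E. \<forall>x\<in>e. \<forall>y\<in>e. c x = c y}) \<le> real (card E) / real r"
proof -
  let ?C = "V \<rightarrow>\<^sub>E {..<r}"
  define mono where "mono c e \<longleftrightarrow> (\<forall>x\<in>e. \<forall>y\<in>e. c x = c y)" for c :: "'a \<Rightarrow> nat" and e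
  have finE: "finite E" by (rule finite_subset[OF E finite_all_pairs[OF V]])
  have finC: "finite ?C" using V by (simp add: finite_PiE)
  have cC: "real (card ?C) = real r ^ card V" using V by (simp add: card_PiE)
  have one: "real (card {c \<in> ?C. mono c e}) \<le> real r ^ card V / real r" if e: "e \<in> E" for e
  proof -
    have "e \<subseteq> V" "card e = 2" using E e by (auto simp: all_pairs_def)
    then obtain x y where xy: "e = {x, y}" "x \<noteq> y" "x \<in> V" "y \<in> V" by (auto simp: card_2_iff)
    have diag: "{z \<in> {..<r} \<times> {..<r}. fst z = snd z} = (\<lambda>i. (i, i)) ` {..<r}" by auto
    have "card {z \<in> {..<r} \<times> {..<r}. fst z = snd z} = r"
      unfolding diag by (subst card_image) (auto simp: inj_on_def)
    then have "real (card {z \<in> {..<r} \<times> {..<r}. fst z = snd z}) \<le> 1 / real r * (real (card {..<r}))\<^sup>2"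
      using r by (simp add: power2_eq_square)
    then have "real (card {\<phi> \<in> ?C. fst (\<phi> x, \<phi> y) = snd (\<phi> x, \<phi> y)}) \<le> 1 / real r * real (card {..<r}) ^ card V"
      using r by (intro card_maps_pair[OF _ _ V xy(3,4,2)]) (auto simp: lessThan_empty_iff)
    moreover have "mono \<phi> e \<longleftrightarrow> \<phi> x = \<phi> y" for \<phi> using xy by (auto simp: mono_def)
    ultimately show ?thesis by simp
  qed
  have "(\<Sum>c\<in>?C. real (card {e \<in> E. mono c e})) = (\<Sum>c\<in>?C. \<Sum>e\<in>E. of_bool (mono c e))"
    using finE by (simp add: Int_def)
  also have "\<dots> = (\<Sum>e\<in>E. \<Sum>c\<in>?C. of_bool (mono c e))" by (rule sum.swap)
  also have "\<dots> = (\<Sum>e\<in>E. real (card {c \<in> ?C. mono c e}))" using finC by (simp add: Int_def)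
  also have "\<dots> \<le> (\<Sum>e\<in>E. real r ^ card V / real r)" by (intro sum_mono one)
  also have "\<dots> = (\<Sum>c\<in>?C. real (card E) / real r)" using cC by simp
  finally have total: "(\<Sum>c\<in>?C. real (card {e \<in> E. mono c e})) \<le> (\<Sum>c\<in>?C. real (card E) / real r)" .
  have "\<exists>c\<in>?C. real (card {e \<in> E. mono c e}) \<le> real (card E) / real r"
  proof (rule ccontr)
    assume "\<not> ?thesis"
    moreover have "real (card ?C) > 0" unfolding cC using r by simp
    then have "?C \<noteq> {}" by fastforce
    ultimately have "(\<Sum>c\<in>?C. real (card E) / real r) < (\<Sum>c\<in>?C. real (card {e \<in> E. mono c e}))"
      using finC by (intro sum_strict_mono) auto
    then show False using total by simp
  qed
  then obtain c where "c \<in> ?C" "real (card {e \<in> E. mono c e}) \<le> real (card E) / real r" by blast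
  then show ?thesis by (intro that[of c]) (auto simp: mono_def PiE_iff)
qed

lemma close_member_of_Forb:
  fixes G :: "'b graph"
  assumes G: "simple_graph G" and r: "r \<ge> 1" "r < family_chromatic_number \<F>"
  obtains H where "H \<in> Forb \<F>" "verts H = verts G"
    "graph_dist G H \<le> real (card (edges G)) / real r / real (card (verts G) choose 2)"
proof -
  have V: "finite (verts G)" and E: "edges G \<subseteq> all_pairs (verts G)" using G by (auto simp: simple_graph_def)
  obtain c :: "'b \<Rightarrow> nat" where c: "c ` verts G \<subseteq> {..<r}"
    "real (card {e \<in> edges G. \<forall>x\<in>e. \<forall>y\<in>e. c x = c y}) \<le> real (card (edges G)) / real r"
    by (rule few_monochromatic_edges[OF V E r(1)])
  let ?M = "{e \<in> edges G. \<forall>x\<in>e. \<forall>y\<in>e. c x = c y}"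
  define H where "H = Graph (verts G) (edges G - ?M)"
  have H: "simple_graph H" using V E by (auto simp: simple_graph_def H_def)
  have "proper_colouring H r c" using c(1) by (auto simp: proper_colouring_def H_def)
  then have "H \<in> Forb \<F>" by (rule Forb_if_colourable[OF H _ r(2)])
  moreover have "sym_diff (edges G) (edges H) = ?M" by (auto simp: H_def)
  then have "graph_dist G H \<le> real (card (edges G)) / real r / real (card (verts G) choose 2)"
    unfolding graph_dist_def using c(2) by (intro divide_right_mono) auto
  ultimately show ?thesis using that by (simp add: H_def)
qed

section \<open>The farthest distance to a forbidden family\<close>

lemma Forb_simple: "H \<in> Forb \<F> \<Longrightarrow> simple_graph H"
  by (simp add: Forb_def)

lemma finite_Forb_distances:
  assumes "finite (verts G)"
  shows "finite {graph_dist G H |H. H \<in> Forb \<F> \<and> verts H = verts G}"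
proof -
  have "{graph_dist G H |H. H \<in> Forb \<F> \<and> verts H = verts G}
    \<subseteq> (\<lambda>E. graph_dist G (Graph (verts G) E)) ` Pow (all_pairs (verts G))"
  proof
    fix d assume "d \<in> {graph_dist G H |H. H \<in> Forb \<F> \<and> verts H = verts G}"
    then obtain H where H: "H \<in> Forb \<F>" "verts H = verts G" "d = graph_dist G H" by blast
    have "H = Graph (verts G) (edges H)" using H(2) by (cases H) simp
    moreover have "edges H \<in> Pow (all_pairs (verts G))"
      using Forb_simple[OF H(1)] H(2) by (simp add: simple_graph_def)
    ultimately show "d \<in> (\<lambda>E. graph_dist G (Graph (verts G) E)) ` Pow (all_pairs (verts G))"
      using H(3) by (metis image_eqI)
  qed
  then show ?thesis by (rule finite_subset) (simp add: finite_all_pairs[OF assms])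
qed

lemma dist_to_Forb_le:
  assumes "simple_graph G" "H \<in> Forb \<F>" "verts H = verts G"
  shows "dist_to_property G (Forb \<F>) \<le> graph_dist G H"
  unfolding dist_to_property_def
  by (rule Min_le[OF finite_Forb_distances]) (use assms in \<open>auto simp: simple_graph_def\<close>)

lemma dist_to_Forb_attained:
  fixes G :: "'b graph"
  assumes "simple_graph G" and r: "r \<ge> 1" "r < family_chromatic_number \<F>"
  obtains H where "H \<in> Forb \<F>" "verts H = verts G" "dist_to_property G (Forb \<F>) = graph_dist G H"
proof -
  have "{graph_dist G H |H. H \<in> Forb \<F> \<and> verts H = verts G} \<noteq> {}"
    using close_member_of_Forb[OF assms] by blast
  then have "dist_to_property G (Forb \<F>) \<in> {graph_dist G H |H. H \<in> Forb \<F> \<and> verts H = verts G}"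
    unfolding dist_to_property_def using assms(1)
    by (intro Min_in finite_Forb_distances) (auto simp: simple_graph_def)
  then show ?thesis using that by blast
qed

text \<open>
  The maximum in the definition of the edit distance function, with the number of edges as a free
  parameter, so that complementation can act on it.
\<close>

definition farthest_distance :: "nat graph set \<Rightarrow> nat \<Rightarrow> nat \<Rightarrow> real" where
  "farthest_distance \<H> n m = Max {dist_to_property G \<H> | G. simple_graph G \<and> card (verts G) = n \<and> card (edges G) = m}"

lemma finite_distances_to_Forb:
  assumes r: "r \<ge> 1" "r < family_chromatic_number \<F>"
  shows "finite {dist_to_property G (Forb \<F>) | G :: nat graph. simple_graph G \<and> card (verts G) = n \<and> card (edges G) = m}"
proof -
  have "{dist_to_property G (Forb \<F>) | G :: nat graph. simple_graph G \<and> card (verts G) = n \<and> card (edges G) = m}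
    \<subseteq> (\<lambda>k. real k / real (n choose 2)) ` {..n choose 2}"
  proof
    fix d assume "d \<in> {dist_to_property G (Forb \<F>) | G :: nat graph. simple_graph G \<and> card (verts G) = n \<and> card (edges G) = m}"
    then obtain G :: "nat graph" where G: "simple_graph G" "card (verts G) = n" "d = dist_to_property G (Forb \<F>)" by blast
    obtain H where H: "H \<in> Forb \<F>" "verts H = verts G" "d = graph_dist G H"
      using dist_to_Forb_attained[OF G(1) r] G(3) by metis
    have V: "finite (verts G)" using G(1) by (simp add: simple_graph_def)
    have "sym_diff (edges G) (edges H) \<subseteq> all_pairs (verts G)"
      using G(1) Forb_simple[OF H(1)] H(2) by (auto simp: simple_graph_def)
    then have "card (sym_diff (edges G) (edges H)) \<le> n choose 2"
      using card_mono[OF finite_all_pairs[OF V]] card_all_pairs[OF V] G(2) by metis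
    then show "d \<in> (\<lambda>k. real k / real (n choose 2)) ` {..n choose 2}"
      using H(3) G(2) by (auto simp: graph_dist_def)
  qed
  then show ?thesis by (rule finite_subset) simp
qed

lemma farthest_distance_le:
  assumes r: "r \<ge> 1" "r < family_chromatic_number \<F>" and m: "m \<le> n choose 2"
  shows "farthest_distance (Forb \<F>) n m \<le> real m / real r / real (n choose 2)"
proof -
  let ?S = "{dist_to_property G (Forb \<F>) | G :: nat graph. simple_graph G \<and> card (verts G) = n \<and> card (edges G) = m}"
  have "m \<le> card (all_pairs {..<n})" using m card_all_pairs[of "{..<n}"] by simp
  then obtain E where E: "E \<subseteq> all_pairs {..<n}" "card E = m" using obtain_subset_with_card_n by blast
  have "dist_to_property (Graph {..<n} E) (Forb \<F>) \<in> ?S"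
    using E by (intro CollectI exI[of _ "Graph {..<n} E"]) (simp add: simple_graph_def)
  then have ne: "?S \<noteq> {}" by blast
  have "d \<le> real m / real r / real (n choose 2)" if "d \<in> ?S" for d
  proof -
    obtain G :: "nat graph" where G: "simple_graph G" "card (verts G) = n" "card (edges G) = m" "d = dist_to_property G (Forb \<F>)"
      using \<open>d \<in> ?S\<close> by blast
    obtain H where H: "H \<in> Forb \<F>" "verts H = verts G"
      "graph_dist G H \<le> real (card (edges G)) / real r / real (card (verts G) choose 2)"
      by (rule close_member_of_Forb[OF G(1) r])
    show ?thesis using dist_to_Forb_le[OF G(1) H(1,2)] H(3) G by simp
  qed
  then show ?thesis unfolding farthest_distance_def
    using Max_in[OF finite_distances_to_Forb[OF r] ne] by blast
qed

lemma farthest_distance_ge: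
  fixes G :: "nat graph"
  assumes r: "r \<ge> 1" "r < family_chromatic_number \<F>"
    and "simple_graph G" "card (verts G) = n" "card (edges G) = m"
  shows "farthest_distance (Forb \<F>) n m \<ge> dist_to_property G (Forb \<F>)"
  unfolding farthest_distance_def by (rule Max_ge[OF finite_distances_to_Forb[OF r]]) (use assms in blast)

text \<open>
  The ordered pairs count every edge twice, and \<open>2 (n choose 2) \<le> n\<^sup>2\<close>.
\<close>

lemma sum_edge_indicator_diff:
  assumes G: "simple_graph G" and H: "simple_graph H" "verts H = verts G"
  shows "(\<Sum>z\<in>verts G \<times> verts G. \<bar>of_bool ({fst z, snd z} \<in> edges H) - of_bool ({fst z, snd z} \<in> edges G) :: real\<bar>)
    \<le> graph_dist G H * (real (card (verts G)))\<^sup>2"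
proof -
  let ?V = "verts G" and ?D = "sym_diff (edges G) (edges H)"
  have V: "finite ?V" using G by (simp add: simple_graph_def)
  have D: "?D \<subseteq> all_pairs ?V" using G H by (auto simp: simple_graph_def)
  have "(\<Sum>z\<in>?V \<times> ?V. \<bar>of_bool ({fst z, snd z} \<in> edges H) - of_bool ({fst z, snd z} \<in> edges G) :: real\<bar>)
    = (\<Sum>z\<in>?V \<times> ?V. of_bool ({fst z, snd z} \<in> ?D))"
    by (intro sum.cong) auto
  also have "\<dots> = real (card {z \<in> ?V \<times> ?V. {fst z, snd z} \<in> ?D})"
  proof -
    have "(\<Sum>z\<in>?V \<times> ?V. of_bool (B z)) = real (card {z \<in> ?V \<times> ?V. B z})" for B
      using V by (simp add: Int_def)
    then show ?thesis .
  qed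
  also have "\<dots> = 2 * real (card ?D)" by (simp only: card_ordered_pairs[OF V D] of_nat_mult of_nat_numeral)
  also have "\<dots> = graph_dist G H * (2 * real (card ?V choose 2))"
  proof (cases "card ?V choose 2 = 0")
    case True
    then have "card (all_pairs ?V) = 0" using card_all_pairs[OF V] by simp
    then have "all_pairs ?V = {}" using finite_all_pairs[OF V] by simp
    then have "?D = {}" using D by blast
    then have "card ?D = 0" by (simp only: card.empty)
    then show ?thesis unfolding True by simp
  qed (simp add: graph_dist_def)
  also have "\<dots> \<le> graph_dist G H * (real (card ?V))\<^sup>2"
  proof (rule mult_left_mono)
    have "2 * (card ?V choose 2) \<le> card ?V * (card ?V - 1)" unfolding choose_two by simp
    also have "\<dots> \<le> (card ?V)\<^sup>2" by (simp add: power2_eq_square)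
    finally have "real (2 * (card ?V choose 2)) \<le> real ((card ?V)\<^sup>2)" by (rule of_nat_mono)
    then show "2 * real (card ?V choose 2) \<le> (real (card ?V))\<^sup>2" by simp
  qed (simp add: graph_dist_def)
  finally show ?thesis .
qed

text \<open>
  An enumeration \<open>\<beta>\<close> of the vertices of \<open>F\<close> translates between the graph \<open>F\<close> and a pattern on \<open>{..<h}\<close>.
\<close>

lemma isomorphic_induced_if_pattern:
  fixes h :: nat
  assumes F: "simple_graph F" and H: "simple_graph H"
    and \<beta>: "bij_betw \<beta> {..<h} (verts F)"
    and \<phi>: "inj_on \<phi> {..<h}" "\<phi> ` {..<h} \<subseteq> verts H"
    and adj: "\<And>u v. u < v \<Longrightarrow> v < h \<Longrightarrow> {\<phi> u, \<phi> v} \<in> edges H \<longleftrightarrow> {\<beta> u, \<beta> v} \<in> edges F"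
  shows "isomorphic F (induced_subgraph H (\<phi> ` {..<h}))"
proof -
  define \<gamma> where "\<gamma> = the_inv_into {..<h} \<beta>"
  have \<gamma>: "bij_betw \<gamma> (verts F) {..<h}" unfolding \<gamma>_def by (rule bij_betw_the_inv_into[OF \<beta>])
  have \<beta>\<gamma>: "\<beta> (\<gamma> u) = u" if "u \<in> verts F" for u
    unfolding \<gamma>_def using \<beta> that by (intro f_the_inv_into_f) (auto simp: bij_betw_def)
  have \<gamma>h: "\<gamma> u < h" if "u \<in> verts F" for u using \<gamma> that by (auto simp: bij_betw_def)
  have all: "{\<phi> i, \<phi> j} \<in> edges H \<longleftrightarrow> {\<beta> i, \<beta> j} \<in> edges F" if "i < h" "j < h" for i j
  proof (cases i j rule: linorder_cases)
    case less
    then show ?thesis using adj that by blast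
  next
    case equal
    then show ?thesis using edge_distinct[OF F, of "\<beta> i" "\<beta> i"] edge_distinct[OF H, of "\<phi> i" "\<phi> i"] by blast
  next
    case greater
    then show ?thesis using adj[of j i] that by (simp add: insert_commute)
  qed
  have "bij_betw (\<phi> \<circ> \<gamma>) (verts F) (\<phi> ` {..<h})"
    by (rule bij_betw_trans[OF \<gamma>]) (simp add: bij_betw_def \<phi>(1))
  moreover have "{u, v} \<in> edges F \<longleftrightarrow> {\<phi> (\<gamma> u), \<phi> (\<gamma> v)} \<in> edges H" if "u \<in> verts F" "v \<in> verts F" for u v
    using all[OF \<gamma>h[OF that(1)] \<gamma>h[OF that(2)]] \<beta>\<gamma> that by simp
  ultimately show ?thesis
    unfolding isomorphic_def induced_subgraph_def using \<gamma>h by (intro exI[of _ "\<phi> \<circ> \<gamma>"]) auto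
qed

text \<open>
  The lower bound: a graph within \<open>(1 - \<epsilon>) p / r\<close> of a quasirandom graph contains an induced copy of a
  member of \<open>\<F>\<close> that attains the chromatic number. The bound \<open>p0\<close> depends only on \<open>\<epsilon>\<close> and this member.
\<close>

lemma far_graphs_exist:
  fixes \<F> :: "'a graph set"
  assumes F: "\<F> \<noteq> {}" "\<forall>F\<in>\<F>. simple_graph F"
    and r: "r \<ge> 1" "family_chromatic_number \<F> = r + 1" and \<epsilon>: "0 < \<epsilon>" "\<epsilon> \<le> 1"
  obtains p0 where "p0 > 0" "\<And>p N. 0 < p \<Longrightarrow> p < p0 \<Longrightarrow>
    \<exists>n\<ge>N. \<forall>m. \<bar>real m - p * real (n choose 2)\<bar> \<le> 1 \<longrightarrow>
      farthest_distance (Forb \<F>) n m \<ge> (1 - \<epsilon>) * (p / real r)"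
proof -
  obtain F0 where F0: "F0 \<in> \<F>" "chromatic_number F0 = r + 1"
    using family_chromatic_number_attained[OF F(1)] r(2) by metis
  have sF0: "simple_graph F0" using F F0 by blast
  obtain col where col: "proper_colouring F0 (r + 1) col"
    using chromatic_number_colouring[OF sF0] F0(2) by metis
  define h where "h = card (verts F0)"
  obtain \<beta> where \<beta>: "bij_betw \<beta> {..<h} (verts F0)"
    using ex_bij_betw_nat_finite[of "verts F0"] sF0 by (auto simp: simple_graph_def h_def atLeast0LessThan)
  have \<beta>V: "\<beta> u \<in> verts F0" if "u < h" for u using \<beta> that by (auto simp: bij_betw_def)
  define a where "a u v \<longleftrightarrow> {\<beta> u, \<beta> v} \<in> edges F0" for u v
  define c where "c u = col (\<beta> u)" for u
  have c: "c u \<le> r" if "u < h" for u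
    using col \<beta>V[OF that] by (auto simp: c_def proper_colouring_def less_Suc_eq_le)
  have a: "c u \<noteq> c v" if "u < h" "v < h" "a u v" for u v
    using col \<beta>V[OF that(1)] \<beta>V[OF that(2)] that(3) by (auto simp: a_def c_def proper_colouring_def)
  have rr: "real r \<ge> 1" using r by simp
  define \<kappa> where "\<kappa> = blow_up_density r (\<epsilon> / (8 * real r)) h"
  have \<kappa>0: "\<kappa> > 0" unfolding \<kappa>_def using \<epsilon> rr by (intro blow_up_density_pos) auto
  \<comment> \<open>The last bound makes black pairs rare compared with the maps that supersaturation provides.\<close>
  define p0 where "p0 = min (1 / 4) (min (\<epsilon> / (8 * real r)) (\<kappa> / (4 * (real h)\<^sup>2 + 1)))"
  have h1: "4 * (real h)\<^sup>2 + 1 > 0" by (simp add: add_nonneg_pos)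
  have p0: "p0 > 0" using \<epsilon> rr \<kappa>0 h1 by (simp add: p0_def)
  show ?thesis
  proof (rule that[OF p0])
    fix p N assume p: "0 < p" "p < p0"
    have pp: "p \<le> 1 / 4" "p \<le> \<epsilon> / (8 * real r)" using p by (auto simp: p0_def)
    have "p \<le> \<kappa> / (4 * (real h)\<^sup>2 + 1)" using p by (auto simp: p0_def)
    then have "p * (4 * (real h)\<^sup>2 + 1) \<le> \<kappa>" using h1 by (simp add: le_divide_eq)
    then have p\<kappa>: "4 * (real h)\<^sup>2 * p \<le> blow_up_density r (\<epsilon> / (8 * real r)) h"
      using p(1) by (simp add: \<kappa>_def algebra_simps)
    have "\<exists>D>0. \<exists>n0. contains_pattern_near_constant a h p D ((1 - \<epsilon>) * (p / real r)) n0"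
      by (rule near_quasirandom_contains_pattern[where c = c, OF r(1) \<epsilon> p(1) pp p\<kappa>]) (fact c, fact a)
    then obtain D n0 where D: "D > 0"
      and pat: "contains_pattern_near_constant a h p D ((1 - \<epsilon>) * (p / real r)) n0" by blast
    obtain n where n: "n \<ge> max N n0" and qr: "\<And>m. \<bar>real m - p * real (n choose 2)\<bar> \<le> 1 \<Longrightarrow>
      \<exists>G :: nat graph. simple_graph G \<and> verts G = {..<n} \<and> card (edges G) = m \<and>
      (\<forall>A B. A \<subseteq> {..<n} \<longrightarrow> B \<subseteq> {..<n} \<longrightarrow>
        \<bar>\<Sum>z\<in>A \<times> B. of_bool ({fst z, snd z} \<in> edges G) - p\<bar> \<le> D * (real n)\<^sup>2)"
      using quasirandom_graphs_exist[OF p(1) pp(1) D] by blast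
    have "farthest_distance (Forb \<F>) n m \<ge> (1 - \<epsilon>) * (p / real r)"
      if m: "\<bar>real m - p * real (n choose 2)\<bar> \<le> 1" for m
    proof -
      obtain G :: "nat graph" where G: "simple_graph G" "verts G = {..<n}" "card (edges G) = m"
        and disc: "\<forall>A B. A \<subseteq> {..<n} \<longrightarrow> B \<subseteq> {..<n} \<longrightarrow>
          \<bar>\<Sum>z\<in>A \<times> B. of_bool ({fst z, snd z} \<in> edges G) - p\<bar> \<le> D * (real n)\<^sup>2"
        using qr[OF m] by blast
      have r': "r < family_chromatic_number \<F>" using r by simp
      obtain H where H: "H \<in> Forb \<F>" "verts H = verts G" "dist_to_property G (Forb \<F>) = graph_dist G H"
        by (rule dist_to_Forb_attained[OF G(1) r(1) r'])
      have sH: "simple_graph H" by (rule Forb_simple[OF H(1)])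
      have "graph_dist G H \<ge> (1 - \<epsilon>) * (p / real r)"
      proof (rule ccontr)
        assume "\<not> ?thesis"
        then have lt: "graph_dist G H \<le> (1 - \<epsilon>) * (p / real r)" by simp
        have "\<exists>\<phi>. inj_on \<phi> {..<h} \<and> \<phi> ` {..<h} \<subseteq> {..<n} \<and>
          (\<forall>u v. u < v \<and> v < h \<longrightarrow> ({\<phi> u, \<phi> v} \<in> edges H \<longleftrightarrow> a u v))"
        proof (rule pat[unfolded contains_pattern_near_constant_def, rule_format, where q = "\<lambda>z. of_bool ({fst z, snd z} \<in> edges G)"], intro conjI allI impI)
          show "\<bar>\<Sum>z\<in>A \<times> B. of_bool ({fst z, snd z} \<in> edges G) - p\<bar> \<le> D * (real (card {..<n}))\<^sup>2"
            if "A \<subseteq> {..<n}" "B \<subseteq> {..<n}" for A B using disc that by simp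
          show "(\<Sum>z\<in>{..<n} \<times> {..<n}. \<bar>of_bool ({fst z, snd z} \<in> edges H) - of_bool ({fst z, snd z} \<in> edges G)\<bar>)
            \<le> (1 - \<epsilon>) * (p / real r) * (real (card {..<n}))\<^sup>2"
            using sum_edge_indicator_diff[OF G(1) sH H(2)] mult_right_mono[OF lt, of "(real n)\<^sup>2"] G(2) by simp
        qed (use n in \<open>simp_all add: insert_commute\<close>)
        then obtain \<phi> where \<phi>: "inj_on \<phi> {..<h}" "\<phi> ` {..<h} \<subseteq> {..<n}"
          "\<And>u v. u < v \<Longrightarrow> v < h \<Longrightarrow> {\<phi> u, \<phi> v} \<in> edges H \<longleftrightarrow> {\<beta> u, \<beta> v} \<in> edges F0"
          by (auto simp: a_def)
        have "\<phi> ` {..<h} \<subseteq> verts H" using \<phi>(2) H(2) G(2) by simp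
        then have "isomorphic F0 (induced_subgraph H (\<phi> ` {..<h}))"
          by (rule isomorphic_induced_if_pattern[OF sF0 sH \<beta> \<phi>(1) _ \<phi>(3)])
        then show False using H(1) F0(1) \<open>\<phi> ` {..<h} \<subseteq> verts H\<close> by (auto simp: Forb_def)
      qed
      moreover have "farthest_distance (Forb \<F>) n m \<ge> dist_to_property G (Forb \<F>)"
        by (rule farthest_distance_ge[OF r(1) r' G(1) _ G(3)]) (simp add: G(2))
      ultimately show ?thesis using H(3) by simp
    qed
    then show "\<exists>n\<ge>N. \<forall>m. \<bar>real m - p * real (n choose 2)\<bar> \<le> 1 \<longrightarrow>
      farthest_distance (Forb \<F>) n m \<ge> (1 - \<epsilon>) * (p / real r)"
      using n by (intro exI[of _ n]) auto
  qed
qed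
text \<open>
  Allowing any edge counts \<open>m n\<close> within \<open>1\<close> of \<open>p * (n choose 2)\<close> serves the original family with
  \<open>m n\<close> rounded down and the family of complements with \<open>m n\<close> rounded up.
\<close>

lemma edit_distance_as_limsup:
  fixes \<F> :: "'a graph set"
  assumes F: "\<F> \<noteq> {}" "\<forall>F\<in>\<F>. simple_graph F" and r: "r \<ge> 1" "family_chromatic_number \<F> = r + 1"
    and \<epsilon>: "0 < \<epsilon>" "\<epsilon> \<le> 1"
  obtains p0 where "p0 > 0" "\<And>p m. 0 < p \<Longrightarrow> p < p0 \<Longrightarrow>
    (\<And>n. \<bar>real (m n) - p * real (n choose 2)\<bar> \<le> 1 \<and> m n \<le> n choose 2) \<Longrightarrow>
    (1 - \<epsilon>) * (p / real r) \<le> real_of_ereal (limsup (\<lambda>n. ereal (farthest_distance (Forb \<F>) n (m n)))) \<and>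
    real_of_ereal (limsup (\<lambda>n. ereal (farthest_distance (Forb \<F>) n (m n)))) \<le> p / real r"
proof -
  obtain p0 where p0: "p0 > 0" and far: "\<And>p N. 0 < p \<Longrightarrow> p < p0 \<Longrightarrow>
    \<exists>n\<ge>N. \<forall>m. \<bar>real m - p * real (n choose 2)\<bar> \<le> 1 \<longrightarrow>
      farthest_distance (Forb \<F>) n m \<ge> (1 - \<epsilon>) * (p / real r)"
    using far_graphs_exist[OF F r \<epsilon>] by blast
  have rr: "real r \<ge> 1" using r by simp
  have r': "r < family_chromatic_number \<F>" using r by simp
  show ?thesis
  proof (rule that[OF p0])
    fix p and m :: "nat \<Rightarrow> nat"
    assume p: "0 < p" "p < p0"
      and m: "\<And>n. \<bar>real (m n) - p * real (n choose 2)\<bar> \<le> 1 \<and> m n \<le> n choose 2"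
    define L where "L = limsup (\<lambda>n. ereal (farthest_distance (Forb \<F>) n (m n)))"
    have up: "L \<le> ereal (p / real r)"
    proof (rule ereal_le_epsilon2)
      fix e :: real assume e: "e > 0"
      have "\<forall>\<^sub>F n in sequentially. ereal (farthest_distance (Forb \<F>) n (m n)) \<le> ereal (p / real r + e)"
      proof (rule eventually_sequentiallyI)
        fix n assume n: "n \<ge> max 2 (nat \<lceil>1 / e\<rceil> + 2)"
        have "n - 1 \<le> n choose 2"
        proof -
          have "2 * (n - 1) \<le> n * (n - 1)" using n by (intro mult_right_mono) auto
          then show ?thesis unfolding choose_two by linarith
        qed
        then have "1 / e \<le> real (n choose 2)" using n by linarith
        moreover have C: "real (n choose 2) > 0" using n \<open>n - 1 \<le> n choose 2\<close> by simp
        ultimately have inv: "1 / real (n choose 2) \<le> e" using e by (simp add: divide_le_eq mult.commute)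
        have "farthest_distance (Forb \<F>) n (m n) \<le> real (m n) / real r / real (n choose 2)"
          by (rule farthest_distance_le[OF r(1) r']) (use m in blast)
        also have "\<dots> \<le> (p * real (n choose 2) + 1) / real r / real (n choose 2)"
          using m[of n] by (intro divide_right_mono) auto
        also have "\<dots> = p / real r + (1 / real (n choose 2)) / real r"
          using C rr by (simp add: field_simps)
        also have "\<dots> \<le> p / real r + e"
        proof -
          have "(1 / real (n choose 2)) / real r \<le> e / 1"
            using inv rr e by (intro frac_le) auto
          then show ?thesis by simp
        qed
        finally show "ereal (farthest_distance (Forb \<F>) n (m n)) \<le> ereal (p / real r + e)" by simp
      qed
      then have "L \<le> ereal (p / real r + e)" unfolding L_def by (rule Limsup_bounded)
      then show "L \<le> ereal (p / real r) + ereal e" by simp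
    qed
    have low: "ereal ((1 - \<epsilon>) * (p / real r)) \<le> L"
    proof (rule ccontr)
      assume "\<not> ?thesis"
      then have "L < ereal ((1 - \<epsilon>) * (p / real r))" by simp
      then have "\<forall>\<^sub>F n in sequentially. ereal (farthest_distance (Forb \<F>) n (m n)) < ereal ((1 - \<epsilon>) * (p / real r))"
        unfolding L_def by (rule Limsup_lessD)
      then obtain N where N: "\<And>n. n \<ge> N \<Longrightarrow> farthest_distance (Forb \<F>) n (m n) < (1 - \<epsilon>) * (p / real r)"
        by (auto simp: eventually_sequentially)
      obtain n where "n \<ge> N" "farthest_distance (Forb \<F>) n (m n) \<ge> (1 - \<epsilon>) * (p / real r)"
        using far[OF p, of N] m by blast
      then show False using N[of n] by simp
    qed
    obtain l where l: "L = ereal l" using up low by (cases L) auto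
    show "(1 - \<epsilon>) * (p / real r) \<le> real_of_ereal (limsup (\<lambda>n. ereal (farthest_distance (Forb \<F>) n (m n)))) \<and>
      real_of_ereal (limsup (\<lambda>n. ereal (farthest_distance (Forb \<F>) n (m n)))) \<le> p / real r"
      using up low unfolding L_def[symmetric] l by simp
  qed
qed

lemma edit_distance_function_farthest:
  assumes "0 \<le> p"
  shows "edit_distance_function \<H> p =
    real_of_ereal (limsup (\<lambda>n. ereal (farthest_distance \<H> n (nat \<lfloor>p * real (n choose 2)\<rfloor>))))"
proof -
  have "int k = \<lfloor>p * real (n choose 2)\<rfloor> \<longleftrightarrow> k = nat \<lfloor>p * real (n choose 2)\<rfloor>" for n k
  proof -
    have "0 \<le> \<lfloor>p * real (n choose 2)\<rfloor>" using assms by simp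
    then show ?thesis by linarith
  qed
  then show ?thesis unfolding edit_distance_function_def farthest_distance_def by simp
qed

section \<open>Complements\<close>

definition complement :: "'a graph \<Rightarrow> 'a graph" where
  "complement G = Graph (verts G) (all_pairs (verts G) - edges G)"

lemma verts_complement [simp]: "verts (complement G) = verts G"
  by (simp add: complement_def)

lemma simple_graph_complement: "simple_graph G \<Longrightarrow> simple_graph (complement G)"
  by (auto simp: simple_graph_def complement_def)

lemma complement_complement: "simple_graph G \<Longrightarrow> complement (complement G) = G"
  by (cases G) (auto simp: simple_graph_def complement_def)

lemma edge_complement_iff:
  assumes "simple_graph G" "u \<in> verts G" "v \<in> verts G"
  shows "{u, v} \<in> edges (complement G) \<longleftrightarrow> u \<noteq> v \<and> {u, v} \<notin> edges G"
  using assms by (auto simp: complement_def all_pairs_def)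

lemma simple_induced_subgraph:
  "simple_graph G \<Longrightarrow> U \<subseteq> verts G \<Longrightarrow> simple_graph (induced_subgraph G U)"
  by (auto simp: simple_graph_def induced_subgraph_def all_pairs_def intro: finite_subset)

lemma induced_subgraph_complement:
  assumes "U \<subseteq> verts G"
  shows "induced_subgraph (complement G) U = complement (induced_subgraph G U)"
  using assms by (auto simp: complement_def induced_subgraph_def all_pairs_def)

lemma isomorphic_complement:
  assumes F: "simple_graph F" and G: "simple_graph G" and iso: "isomorphic F G"
  shows "isomorphic (complement F) (complement G)"
proof -
  obtain f where f: "bij_betw f (verts F) (verts G)"
    and adj: "\<And>u v. u \<in> verts F \<Longrightarrow> v \<in> verts F \<Longrightarrow> {u, v} \<in> edges F \<longleftrightarrow> {f u, f v} \<in> edges G"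
    using iso unfolding isomorphic_def by blast
  have "{u, v} \<in> edges (complement F) \<longleftrightarrow> {f u, f v} \<in> edges (complement G)"
    if "u \<in> verts F" "v \<in> verts F" for u v
  proof -
    have "f u \<in> verts G" "f v \<in> verts G" "f u = f v \<longleftrightarrow> u = v"
      using f that by (auto simp: bij_betw_def inj_on_def)
    then show ?thesis using adj[OF that] that by (simp add: edge_complement_iff F G)
  qed
  then show ?thesis unfolding isomorphic_def using f by (intro exI[of _ f]) simp
qed

lemma complement_in_Forb:
  assumes F: "\<forall>F\<in>\<F>. simple_graph F" and H: "H \<in> Forb \<F>"
  shows "complement H \<in> Forb (complement ` \<F>)"
proof -
  have sH: "simple_graph H" by (rule Forb_simple[OF H])
  have "\<not> isomorphic (complement F) (induced_subgraph (complement H) U)"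
    if FF: "F \<in> \<F>" and U: "U \<subseteq> verts H" for F U
  proof
    assume iso: "isomorphic (complement F) (induced_subgraph (complement H) U)"
    have sF: "simple_graph F" using F FF by blast
    have sI: "simple_graph (induced_subgraph H U)" by (rule simple_induced_subgraph[OF sH U])
    have "isomorphic (complement F) (complement (induced_subgraph H U))"
      using iso by (simp only: induced_subgraph_complement[OF U])
    then have "isomorphic (complement (complement F)) (complement (complement (induced_subgraph H U)))"
      by (rule isomorphic_complement[OF simple_graph_complement[OF sF] simple_graph_complement[OF sI]])
    then have "isomorphic F (induced_subgraph H U)"
      by (simp only: complement_complement[OF sF] complement_complement[OF sI])
    then show False using H FF U by (auto simp: Forb_def)
  qed
  then show ?thesis using simple_graph_complement[OF sH] by (auto simp: Forb_def)
qed

lemma complement_family: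
  "\<forall>F\<in>\<F>. simple_graph F \<Longrightarrow> complement ` complement ` \<F> = \<F>"
  by (simp add: image_image complement_complement)

lemma graph_dist_complement:
  assumes "simple_graph G" "simple_graph H" "verts H = verts G"
  shows "graph_dist (complement G) (complement H) = graph_dist G H"
proof -
  have "sym_diff (edges (complement G)) (edges (complement H)) = sym_diff (edges G) (edges H)"
    using assms by (auto simp: complement_def simple_graph_def)
  then show ?thesis by (simp only: graph_dist_def verts_complement)
qed

lemma dist_to_property_complement:
  fixes \<F> :: "'a graph set" and G :: "'b graph"
  assumes F: "\<forall>F\<in>\<F>. simple_graph F" and G: "simple_graph G"
  shows "dist_to_property (complement G) (Forb (complement ` \<F>)) = dist_to_property G (Forb \<F>)"
proof -
  let ?S = "\<lambda>(\<G> :: 'a graph set) (G :: 'b graph). {graph_dist G H |H. H \<in> Forb \<G> \<and> verts H = verts G}"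
  have sub: "?S \<G> G \<subseteq> ?S (complement ` \<G>) (complement G)"
    if "\<forall>F\<in>\<G>. simple_graph F" "simple_graph G" for \<G> and G :: "'b graph"
  proof
    fix d assume "d \<in> ?S \<G> G"
    then obtain H where H: "H \<in> Forb \<G>" "verts H = verts G" "d = graph_dist G H" by blast
    have "d = graph_dist (complement G) (complement H)"
      using graph_dist_complement[OF that(2) Forb_simple[OF H(1)] H(2)] H(3) by simp
    then show "d \<in> ?S (complement ` \<G>) (complement G)"
      using complement_in_Forb[OF that(1) H(1)] H(2) by (intro CollectI exI[of _ "complement H"]) simp
  qed
  have "?S (complement ` \<F>) (complement G) \<subseteq> ?S (complement ` complement ` \<F>) (complement (complement G))"
    using F G by (intro sub) (auto simp: simple_graph_complement)
  then have "?S (complement ` \<F>) (complement G) \<subseteq> ?S \<F> G"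
    by (simp only: complement_family[OF F] complement_complement[OF G])
  then have "?S (complement ` \<F>) (complement G) = ?S \<F> G" using sub[OF F G] by (rule equalityI)
  then show ?thesis unfolding dist_to_property_def by (rule arg_cong)
qed

lemma card_edges_complement:
  assumes "simple_graph G"
  shows "card (edges (complement G)) = (card (verts G) choose 2) - card (edges G)"
proof -
  have V: "finite (verts G)" "edges G \<subseteq> all_pairs (verts G)" using assms by (auto simp: simple_graph_def)
  show ?thesis
    using card_Diff_subset[OF simple_graph_finite_edges[OF assms] V(2)]
    by (simp add: complement_def card_all_pairs[OF V(1)])
qed

lemma farthest_distance_complement:
  fixes \<F> :: "'a graph set"
  assumes F: "\<forall>F\<in>\<F>. simple_graph F" and m: "m \<le> n choose 2"
  shows "farthest_distance (Forb \<F>) n m = farthest_distance (Forb (complement ` \<F>)) n ((n choose 2) - m)"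
proof -
  let ?S = "\<lambda>(\<G> :: 'a graph set) m. {dist_to_property G (Forb \<G>) | G :: nat graph.
    simple_graph G \<and> card (verts G) = n \<and> card (edges G) = m}"
  have sub: "?S \<G> m \<subseteq> ?S (complement ` \<G>) ((n choose 2) - m)"
    if "\<forall>F\<in>\<G>. simple_graph F" for \<G> m
  proof
    fix d assume "d \<in> ?S \<G> m"
    then obtain G :: "nat graph" where G: "simple_graph G" "card (verts G) = n" "card (edges G) = m"
      "d = dist_to_property G (Forb \<G>)" by blast
    have "d = dist_to_property (complement G) (Forb (complement ` \<G>))"
      using dist_to_property_complement[OF that G(1)] G(4) by simp
    then show "d \<in> ?S (complement ` \<G>) ((n choose 2) - m)"
      using simple_graph_complement[OF G(1)] card_edges_complement[OF G(1)] G(2,3)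
      by (intro CollectI exI[of _ "complement G"]) simp
  qed
  have "?S (complement ` \<F>) ((n choose 2) - m) \<subseteq> ?S (complement ` complement ` \<F>) ((n choose 2) - ((n choose 2) - m))"
    using F by (intro sub) (auto simp: simple_graph_complement)
  then have "?S (complement ` \<F>) ((n choose 2) - m) \<subseteq> ?S \<F> m"
    by (simp only: complement_family[OF F] diff_diff_cancel[OF m])
  then have "?S \<F> m = ?S (complement ` \<F>) ((n choose 2) - m)" using sub[OF F, of m] by (intro equalityI)
  then show ?thesis unfolding farthest_distance_def by (rule arg_cong)
qed

text \<open>
  Colour classes of the complement are cliques. A clique cover must consist of nonempty sets, so
  unused colours disappear: a colouring gives a cover with possibly fewer parts, which is
  enough for comparing the two minima.
\<close>

lemma chromatic_number_complement:
  assumes G: "simple_graph G"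
  shows "chromatic_number (complement G) = clique_cover_number G"
proof -
  let ?V = "verts G"
  have V: "finite ?V" and E: "edges G \<subseteq> all_pairs ?V" using G by (auto simp: simple_graph_def)
  define cover where "cover k \<longleftrightarrow> (\<exists>P. partition_on ?V P \<and> card P = k \<and> (\<forall>C\<in>P. is_clique (induced_subgraph G C)))" for k
  have cc: "clique_cover_number G = (LEAST k. cover k)"
    unfolding clique_cover_number_def cover_def ..
  have adj: "{u, v} \<in> edges (complement G) \<longleftrightarrow> u \<noteq> v \<and> {u, v} \<notin> edges G" if "u \<in> ?V" "v \<in> ?V" for u v
    by (rule edge_complement_iff[OF G that])
  have to_colouring: "\<exists>c. proper_colouring (complement G) k c" if "cover k" for k
  proof -
    obtain P where P: "partition_on ?V P" "card P = k" "\<forall>C\<in>P. is_clique (induced_subgraph G C)"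
      using \<open>cover k\<close> by (auto simp: cover_def)
    have "finite P" by (rule finite_elements[OF V P(1)])
    then obtain g where g: "bij_betw g P {..<k}"
      using ex_bij_betw_finite_nat[of P] P(2) by (auto simp: atLeast0LessThan)
    have "\<forall>x\<in>?V. \<exists>B. B \<in> P \<and> x \<in> B" using P(1) by (auto simp: partition_on_def)
    then obtain block where block: "\<And>x. x \<in> ?V \<Longrightarrow> block x \<in> P \<and> x \<in> block x" by metis
    have "proper_colouring (complement G) k (g \<circ> block)"
      unfolding proper_colouring_def
    proof (intro conjI ballI impI)
      show "(g \<circ> block) ` verts (complement G) \<subseteq> {..<k}" using g block by (auto simp: bij_betw_def)
      fix u v assume "u \<in> verts (complement G)" "v \<in> verts (complement G)" and e: "{u, v} \<in> edges (complement G)"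
      then have uv: "u \<in> ?V" "v \<in> ?V" by simp_all
      have ne: "u \<noteq> v" "{u, v} \<notin> edges G" using e adj[OF uv] by blast+
      show "(g \<circ> block) u \<noteq> (g \<circ> block) v"
      proof
        assume "(g \<circ> block) u = (g \<circ> block) v"
        then have same: "block u = block v" using g block uv by (auto simp: bij_betw_def inj_on_def)
        have "is_clique (induced_subgraph G (block u))" using P(3) block uv by blast
        moreover have "{u, v} \<in> all_pairs (block u)" using block uv same ne by (auto simp: all_pairs_def)
        ultimately have "{u, v} \<in> edges G" by (auto simp: is_clique_def induced_subgraph_def)
        then show False using ne by blast
      qed
    qed
    then show ?thesis by blast
  qed
  have to_cover: "\<exists>k'\<le>k. cover k'" if c: "proper_colouring (complement G) k c" for k c
  proof -
    let ?fib = "\<lambda>i. {x \<in> ?V. c x = i}"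
    let ?P = "?fib ` (c ` ?V)"
    have "partition_on ?V ?P" by (rule partition_onI) (auto simp: disjnt_def)
    moreover have "is_clique (induced_subgraph G C)" if CP: "C \<in> ?P" for C
    proof -
      obtain i where C: "C = ?fib i" using CP by blast
      have "e \<in> edges G" if e: "e \<in> all_pairs C" for e
      proof -
        have "e \<subseteq> C" "card e = 2" using e by (auto simp: all_pairs_def)
        then obtain u v where uv: "e = {u, v}" "u \<noteq> v" "u \<in> ?V" "v \<in> ?V" "c u = c v"
          by (auto simp: card_2_iff C)
        then have "{u, v} \<notin> edges (complement G)" using c by (auto simp: proper_colouring_def)
        then show ?thesis using adj[OF uv(3,4)] uv(1,2) by blast
      qed
      moreover have "e \<in> all_pairs C" if "e \<in> edges G" "e \<subseteq> C" for e
        using that E by (auto simp: all_pairs_def)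
      ultimately show ?thesis by (auto simp: is_clique_def induced_subgraph_def all_pairs_def)
    qed
    moreover have "card ?P \<le> k"
    proof -
      have "card ?P \<le> card (c ` ?V)" using V by (intro card_image_le) simp
      also have "\<dots> \<le> card {..<k}" using c by (intro card_mono) (auto simp: proper_colouring_def)
      finally show ?thesis by simp
    qed
    ultimately show ?thesis unfolding cover_def by blast
  qed
  obtain c where c: "proper_colouring (complement G) (chromatic_number (complement G)) c"
    by (rule chromatic_number_colouring[OF simple_graph_complement[OF G]])
  obtain k' where k': "k' \<le> chromatic_number (complement G)" "cover k'" using to_cover[OF c] by blast
  show ?thesis
  proof (rule antisym)
    have "cover (clique_cover_number G)" unfolding cc by (rule LeastI[of cover, OF k'(2)])
    then obtain c' where "proper_colouring (complement G) (clique_cover_number G) c'" using to_colouring by blast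
    then show "chromatic_number (complement G) \<le> clique_cover_number G" by (rule chromatic_number_le)
    have "clique_cover_number G \<le> k'" unfolding cc by (rule Least_le[of cover, OF k'(2)])
    then show "clique_cover_number G \<le> chromatic_number (complement G)" using k'(1) by simp
  qed
qed

lemma family_chromatic_number_complement:
  assumes "\<forall>F\<in>\<F>. simple_graph F"
  shows "family_chromatic_number (complement ` \<F>) = family_clique_cover_number \<F>"
  unfolding family_chromatic_number_def family_clique_cover_number_def image_image
  using assms by (intro arg_cong[where f = Inf] image_cong refl) (simp add: chromatic_number_complement)

lemma anticlique_complement:
  "simple_graph G \<Longrightarrow> is_anticlique (complement G) \<Longrightarrow> is_clique G"
  by (auto simp: is_anticlique_def is_clique_def complement_def simple_graph_def)

section \<open>The limits\<close>

lemma limsup_ratio_limit: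
  fixes \<F> :: "'a graph set" and M :: "real \<Rightarrow> nat \<Rightarrow> nat"
  assumes F: "\<F> \<noteq> {}" "\<forall>F\<in>\<F>. simple_graph F" "\<forall>F\<in>\<F>. \<not> is_anticlique F"
    and M: "\<And>p n. 0 < p \<Longrightarrow> p < 1 \<Longrightarrow> \<bar>real (M p n) - p * real (n choose 2)\<bar> \<le> 1 \<and> M p n \<le> n choose 2"
  shows "((\<lambda>p. 1 / p * real_of_ereal (limsup (\<lambda>n. ereal (farthest_distance (Forb \<F>) n (M p n)))))
     \<longlongrightarrow> 1 / (real (family_chromatic_number \<F>) - 1)) (at_right 0)"
proof -
  define r where "r = family_chromatic_number \<F> - 1"
  obtain F0 where "F0 \<in> \<F>" "chromatic_number F0 = family_chromatic_number \<F>"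
    by (rule family_chromatic_number_attained[OF F(1)])
  then have "family_chromatic_number \<F> \<ge> 2" using chromatic_number_ge_2[of F0] F by simp
  then have r: "r \<ge> 1" "family_chromatic_number \<F> = r + 1" by (auto simp: r_def)
  have rr: "real r \<ge> 1" using r by simp
  define ed where "ed p = real_of_ereal (limsup (\<lambda>n. ereal (farthest_distance (Forb \<F>) n (M p n))))" for p
  have "((\<lambda>p. 1 / p * ed p) \<longlongrightarrow> 1 / real r) (at_right 0)"
  proof (rule tendstoI)
    fix e :: real assume e: "e > 0"
    define \<epsilon> where "\<epsilon> = min 1 (e / 2)"
    have \<epsilon>: "0 < \<epsilon>" "\<epsilon> \<le> 1" "\<epsilon> < e" using e by (auto simp: \<epsilon>_def)
    obtain p0 where p0: "p0 > 0" and bounds: "\<And>p m. 0 < p \<Longrightarrow> p < p0 \<Longrightarrow>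
      (\<And>n. \<bar>real (m n) - p * real (n choose 2)\<bar> \<le> 1 \<and> m n \<le> n choose 2) \<Longrightarrow>
      (1 - \<epsilon>) * (p / real r) \<le> real_of_ereal (limsup (\<lambda>n. ereal (farthest_distance (Forb \<F>) n (m n)))) \<and>
      real_of_ereal (limsup (\<lambda>n. ereal (farthest_distance (Forb \<F>) n (m n)))) \<le> p / real r"
      using edit_distance_as_limsup[OF F(1,2) r \<epsilon>(1,2)] by blast
    have "\<forall>\<^sub>F p in at_right 0. p \<in> {0<..<min p0 1}" using p0 by (intro eventually_at_right_real) simp
    then show "\<forall>\<^sub>F p in at_right 0. dist (1 / p * ed p) (1 / real r) < e"
    proof eventually_elim
      case (elim p)
      then have p: "0 < p" "p < p0" "p < 1" by auto
      have b: "(1 - \<epsilon>) * (p / real r) \<le> ed p" "ed p \<le> p / real r"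
        using bounds[OF p(1,2), of "M p"] M[OF p(1,3)] unfolding ed_def by blast+
      have "1 / p * ((1 - \<epsilon>) * (p / real r)) \<le> 1 / p * ed p" using b(1) p by (intro mult_left_mono) auto
      moreover have "1 / p * ed p \<le> 1 / p * (p / real r)" using b(2) p by (intro mult_left_mono) auto
      ultimately have "(1 - \<epsilon>) / real r \<le> 1 / p * ed p" "1 / p * ed p \<le> 1 / real r" using p by simp_all
      moreover have "\<epsilon> / real r \<le> \<epsilon>" using \<epsilon> rr by (simp add: divide_le_eq mult_left_le)
      ultimately show ?case using \<epsilon> by (simp add: dist_real_def diff_divide_distrib)
    qed
  qed
  then show ?thesis using r by (simp add: ed_def)
qed

theorem theorem1p1:
  fixes \<F> :: "'a graph set"
  assumes "\<F> \<noteq> {}"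
    and "\<forall>F\<in>\<F>. simple_graph F"
  shows "((\<forall>F\<in>\<F>. \<not> is_anticlique F) \<longrightarrow>
            ((\<lambda>p. 1 / p * edit_distance_function (Forb \<F>) p)
               \<longlongrightarrow> 1 / (real (family_chromatic_number \<F>) - 1)) (at_right 0)) \<and>
         ((\<forall>F\<in>\<F>. \<not> is_clique F) \<longrightarrow>
            ((\<lambda>p. 1 / (1 - p) * edit_distance_function (Forb \<F>) p)
               \<longlongrightarrow> 1 / (real (family_clique_cover_number \<F>) - 1)) (at_left 1))"
proof (intro conjI impI)
  define M where "M p n = nat \<lfloor>p * real (n choose 2)\<rfloor>" for p n
  have M: "real (M p n) \<le> p * real (n choose 2)" "p * real (n choose 2) \<le> real (M p n) + 1" "M p n \<le> n choose 2"
    if "0 < p" "p < 1" for p n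
  proof -
    have "p * real (n choose 2) \<le> 1 * real (n choose 2)" by (rule mult_right_mono) (use that in auto)
    moreover have "0 \<le> p * real (n choose 2)" using that by simp
    ultimately show "real (M p n) \<le> p * real (n choose 2)" "p * real (n choose 2) \<le> real (M p n) + 1"
      and "M p n \<le> n choose 2" unfolding M_def by linarith+
  qed
  {
    assume anti: "\<forall>F\<in>\<F>. \<not> is_anticlique F"
    have lim: "((\<lambda>p. 1 / p * real_of_ereal (limsup (\<lambda>n. ereal (farthest_distance (Forb \<F>) n (M p n)))))
      \<longlongrightarrow> 1 / (real (family_chromatic_number \<F>) - 1)) (at_right 0)"
    proof (rule limsup_ratio_limit[OF assms anti])
      show "\<bar>real (M p n) - p * real (n choose 2)\<bar> \<le> 1 \<and> M p n \<le> n choose 2" if "0 < p" "p < 1" for p n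
        using M[OF that, of n] by linarith
    qed
    have "\<forall>\<^sub>F p :: real in at_right 0. p \<in> {0<..<1}" by (rule eventually_at_right_real) simp
    then show "((\<lambda>p. 1 / p * edit_distance_function (Forb \<F>) p)
      \<longlongrightarrow> 1 / (real (family_chromatic_number \<F>) - 1)) (at_right 0)"
      by (intro Lim_transform_eventually[OF lim], eventually_elim)
         (simp add: edit_distance_function_farthest M_def)
  next
    assume cl: "\<forall>F\<in>\<F>. \<not> is_clique F"
    have sc: "\<forall>F\<in>complement ` \<F>. simple_graph F" using assms(2) by (simp add: simple_graph_complement)
    have ac: "\<forall>F\<in>complement ` \<F>. \<not> is_anticlique F" using assms(2) cl anticlique_complement by blast
    let ?M = "\<lambda>p n. (n choose 2) - M (1 - p) n"
    have "((\<lambda>p. 1 / p * real_of_ereal (limsup (\<lambda>n. ereal (farthest_distance (Forb (complement ` \<F>)) n (?M p n)))))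
      \<longlongrightarrow> 1 / (real (family_chromatic_number (complement ` \<F>)) - 1)) (at_right 0)"
    proof (rule limsup_ratio_limit[OF _ sc ac])
      show "complement ` \<F> \<noteq> {}" using assms(1) by simp
      show "\<bar>real (?M p n) - p * real (n choose 2)\<bar> \<le> 1 \<and> ?M p n \<le> n choose 2" if "0 < p" "p < 1" for p n
      proof -
        have m: "0 < 1 - p" "1 - p < 1" using that by auto
        have "real (?M p n) = real (n choose 2) - real (M (1 - p) n)" using M(3)[OF m] by (simp add: of_nat_diff)
        then show ?thesis using M(1,2)[OF m, of n] by (simp add: algebra_simps)
      qed
    qed
    moreover have "filterlim (\<lambda>p :: real. 1 - p) (at_right 0) (at_left 1)"
      unfolding filterlim_at
    proof
      show "\<forall>\<^sub>F p :: real in at_left 1. 1 - p \<in> {0<..} \<and> 1 - p \<noteq> 0"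
        using eventually_at_left_real[of 0 "1 :: real"] by (simp, elim eventually_mono) auto
      show "((\<lambda>p :: real. 1 - p) \<longlongrightarrow> 0) (at_left 1)" by (auto intro!: tendsto_eq_intros)
    qed
    ultimately have lim: "((\<lambda>p. 1 / (1 - p) * real_of_ereal (limsup (\<lambda>n. ereal (farthest_distance (Forb (complement ` \<F>)) n (?M (1 - p) n)))))
      \<longlongrightarrow> 1 / (real (family_clique_cover_number \<F>) - 1)) (at_left 1)"
      unfolding family_chromatic_number_complement[OF assms(2)] by (rule filterlim_compose)
    have "\<forall>\<^sub>F p :: real in at_left 1. p \<in> {0<..<1}" by (rule eventually_at_left_real) simp
    then have "\<forall>\<^sub>F p in at_left 1.
      1 / (1 - p) * real_of_ereal (limsup (\<lambda>n. ereal (farthest_distance (Forb (complement ` \<F>)) n (?M (1 - p) n))))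
      = 1 / (1 - p) * edit_distance_function (Forb \<F>) p"
    proof eventually_elim
      case (elim p)
      then have p: "0 < p" "p < 1" by auto
      have "farthest_distance (Forb (complement ` \<F>)) n ((n choose 2) - M p n) = farthest_distance (Forb \<F>) n (M p n)" for n
        by (rule farthest_distance_complement[OF assms(2) M(3)[OF p], symmetric])
      then show ?case using p by (simp add: edit_distance_function_farthest M_def)
    qed
    then show "((\<lambda>p. 1 / (1 - p) * edit_distance_function (Forb \<F>) p)
      \<longlongrightarrow> 1 / (real (family_clique_cover_number \<F>) - 1)) (at_left 1)"
      by (rule Lim_transform_eventually[OF lim])
  }
qed

end
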